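(* Let $X=(X_t)_{t\in[0,1]}$ be a real centered continuous Gaussian process and let $g$ be a speed function. For $\varepsilon\in(0,1]$ put $X^\varepsilon_t=X_{\varepsilon t}$ and $$Y^\varepsilon_t=g(\varepsilon)^{1/2}\,X_{\varepsilon t},\qquad t\in[0,1].$$ If $(Y^\varepsilon)_\varepsilon$ converges in law, as $\varepsilon\to0$, in $\mathcal C([0,1],\mathbb R)$ to some continuous process $Y^0$, then the family of small time processes $(X^\varepsilon)_\varepsilon$ satisfies, as $\varepsilon\to0$, a Large Deviations Principle on $\mathcal C([0,1],\mathbb R)$ with speed $g$ and rate function $$I(h)=\begin{cases}\frac12\,|h|^2_{\mathcal Y^0}& h\in\mathcal Y^0\\ +\infty&\text{otherwise,}\end{cases}$$ where $\mathcal Y^0$ and $|\cdot|_{\mathcal Y^0}$ denote the Reproducing Kernel Hilbert Space (RKHS) and the related norm associated to the law of $Y^0$.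
   Context: $\mathcal C([0,1],\mathbb R)$ is the Banach space of continuous paths with the supremum norm. A speed function is a function $g:\mathbb R^+\to\mathbb R^+$ with $g(\varepsilon)\to+\infty$ as $\varepsilon\to0$. A rate function on a topological space $E$ is a lower semicontinuous $I:E\to[0,+\infty]$ whose level sets $\{I\le a\}$, $a\ge0$, are compact. A family of $E$-valued random variables with laws $(\mu_\varepsilon)_{\varepsilon}$ satisfies a Large Deviations Principle (LDP) as $\varepsilon\to0$ with speed $g$ and rate function $I$ if $\limsup_{\varepsilon\to0}\frac1{g(\varepsilon)}\log\mu_\varepsilon(F)\le-\inf_FI$ for every closed $F\subset E$ and $\liminf_{\varepsilon\to0}\frac1{g(\varepsilon)}\log\mu_\varepsilon(G)\ge-\inf_GI$ for every open $G\subset E$. The RKHS (Cameron–Martin space) of a centered Gaussian random variable $Z$ with values in a separable Banach space $E$: let $\mathcal H_Z$ be the closure in $L^2$ of $\{\langle\alpha,Z\rangle:\alpha\in E'\}$; the RKHS is $\{\mathbb E[\xi Z]:\xi\in\mathcal H_Z\}\subset E$ with norm $|\mathbb E[\xi Z]|=\|\xi\|_{L^2}$. *)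

theory Defs
  imports "HOL-Probability.Probability"
begin

section \<open>The Banach space of continuous paths on the unit interval\<close>

text \<open>
  The unit interval is turned into a metric space type, so that \<open>C([0,1], \<real>)\<close> becomes the
  library type \<open>unit_interval \<Rightarrow>\<^sub>C real\<close> of bounded continuous functions with the supremum norm
  (by compactness every continuous function is bounded).
\<close>

typedef unit_interval = "{0..1::real}"
  morphisms time_of Unit_Interval
  by (rule exI[of _ 0]) simp

class compact_metric_space = metric_space +
  assumes compact_UNIV_space: "compact UNIV"

instantiation unit_interval :: metric_space
begin

definition dist_unit_interval :: "unit_interval \<Rightarrow> unit_interval \<Rightarrow> real"
  where "dist_unit_interval s t = \<bar>time_of s - time_of t\<bar>"

definition uniformity_unit_interval :: "(unit_interval \<times> unit_interval) filter"
  where "uniformity_unit_interval = (INF e\<in>{0 <..}. principal {(x, y). dist x y < e})"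

definition open_unit_interval :: "unit_interval set \<Rightarrow> bool"
  where "open_unit_interval U \<longleftrightarrow>
    (\<forall>x\<in>U. eventually (\<lambda>(x', y). x' = x \<longrightarrow> y \<in> U) uniformity)"

instance
  by standard
    (auto simp: dist_unit_interval_def uniformity_unit_interval_def open_unit_interval_def
      time_of_inject)

end

lemma continuous_on_Unit_Interval: "continuous_on {0..1} Unit_Interval"
  unfolding continuous_on_iff
  by (metis Unit_Interval_inverse dist_real_def dist_unit_interval_def)

lemma continuous_on_time_of: "continuous_on S time_of"
  unfolding continuous_on_iff by (metis dist_real_def dist_unit_interval_def)

instance unit_interval :: compact_metric_space
proof
  have "Unit_Interval ` {0..1} = UNIV"
    using time_of time_of_inverse by (metis UNIV_eq_I image_eqI)
  then show "compact (UNIV :: unit_interval set)"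
    using compact_continuous_image[OF continuous_on_Unit_Interval] by simp
qed

text \<open>
  Separability of spaces of continuous functions on a compact metric space; it is needed for
  Bochner integrals with values in \<open>C([0,1], \<real>)\<close>.
\<close>

instance bcontfun ::
  (compact_metric_space, "{metric_space, second_countable_topology}") second_countable_topology
proof
  obtain D :: "'b set" where D: "countable D" "\<And>X. open X \<Longrightarrow> X \<noteq> {} \<Longrightarrow> \<exists>d\<in>D. d \<in> X"
    by (rule countable_dense_setE) blast
  have "\<exists>F::'a set. finite F \<and> (UNIV::'a set) \<subseteq> (\<Union>x\<in>F. ball x (1 / real (Suc n)))" for n
    using seq_compact_imp_totally_bounded[OF compact_imp_seq_compact[OF compact_UNIV_space]]
    by (auto dest!: spec[of _ "1 / real (Suc n)"])
  then obtain F :: "nat \<Rightarrow> 'a set" where fin: "\<And>n. finite (F n)"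
    and cover: "\<And>n. (UNIV::'a set) \<subseteq> (\<Union>x\<in>F n. ball x (1 / real (Suc n)))"
    by metis
  define near where "near = (\<lambda>n m q (f :: 'a \<Rightarrow>\<^sub>C 'b).
    \<forall>x\<in>F n. \<forall>y\<in>ball x (1 / real (Suc n)). dist (apply_bcontfun f y) (q x) < 1 / real (Suc m))"
  define E where
    "E = (\<Union>n. \<Union>m. (\<lambda>q. SOME f. near n m q f) ` (\<Pi>\<^sub>E x\<in>F n. D))"
  have cE: "countable E"
    unfolding E_def using fin D(1) by (intro countable_UN countable_image countable_PiE) auto
  have dense: "\<exists>d\<in>E. dist d f < e" if e: "e > 0" for f :: "'a \<Rightarrow>\<^sub>C 'b" and e
  proof -
    obtain m where m: "1 / real (Suc m) < e / 4"
      using nat_approx_posE[of "e / 4"] e by auto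
    let ?r = "1 / real (Suc m)"
    have "uniformly_continuous_on UNIV (apply_bcontfun f)"
      using compact_uniformly_continuous[OF _ compact_UNIV_space] continuous_on_apply_bcontfun
      by blast
    then obtain d where d: "d > 0"
      "\<And>x y. dist x y < d \<Longrightarrow> dist (apply_bcontfun f x) (apply_bcontfun f y) < ?r / 2"
      unfolding uniformly_continuous_on_def
      by (metis UNIV_I half_gt_zero of_nat_0_less_iff zero_less_Suc zero_less_divide_1_iff)
    obtain n where n: "1 / real (Suc n) < d"
      using nat_approx_posE[OF d(1)] by auto
    have "\<exists>b\<in>D. dist (apply_bcontfun f x) b < ?r / 2" for x
    proof -
      have "ball (apply_bcontfun f x) (?r / 2) \<noteq> {}" by simp
      then show ?thesis using D(2)[OF open_ball] by (meson mem_ball)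
    qed
    then obtain q0 where q0: "\<And>x. q0 x \<in> D" "\<And>x. dist (apply_bcontfun f x) (q0 x) < ?r / 2"
      by metis
    define q where "q = restrict q0 (F n)"
    have "near n m q f"
      unfolding near_def
    proof (intro ballI)
      fix x y assume x: "x \<in> F n" and y: "y \<in> ball x (1 / real (Suc n))"
      have "dist (apply_bcontfun f x) (apply_bcontfun f y) < ?r / 2"
        using y n by (intro d(2)) auto
      then have "dist (apply_bcontfun f y) (q0 x) < ?r"
        using q0(2)[of x]
          dist_triangle3[of "apply_bcontfun f y" "q0 x" "apply_bcontfun f x"] by linarith
      then show "dist (apply_bcontfun f y) (q x) < ?r" using x by (simp add: q_def)
    qed
    define h where "h = (SOME f. near n m q f)"
    have h: "near n m q h" unfolding h_def using \<open>near n m q f\<close> by (rule someI)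
    have "q \<in> (\<Pi>\<^sub>E x\<in>F n. D)" using q0(1) by (auto simp: q_def)
    then have "h \<in> E" unfolding E_def h_def by blast
    moreover have "dist h f \<le> 2 * ?r"
    proof (rule dist_bound)
      fix y
      obtain x where x: "x \<in> F n" "y \<in> ball x (1 / real (Suc n))" using cover[of n] by blast
      have "dist (apply_bcontfun h y) (q x) < ?r" "dist (apply_bcontfun f y) (q x) < ?r"
        using h \<open>near n m q f\<close> x unfolding near_def by blast+
      then show "dist (apply_bcontfun h y) (apply_bcontfun f y) \<le> 2 * ?r"
        using dist_triangle2[of "apply_bcontfun h y" "apply_bcontfun f y" "q x"] by linarith
    qed
    ultimately show ?thesis using m e by (intro bexI[of _ h]) auto
  qed
  define B where "B = (\<lambda>(f :: 'a \<Rightarrow>\<^sub>C 'b, n). ball f (1 / real (Suc n))) ` (E \<times> UNIV)"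
  have "countable B" unfolding B_def using cE by auto
  moreover have "topological_basis B"
  proof (rule topological_basisI)
    fix U assume "U \<in> B" then show "open U" by (auto simp: B_def)
  next
    fix O' :: "('a \<Rightarrow>\<^sub>C 'b) set" and f assume "open O'" "f \<in> O'"
    then obtain e where e: "e > 0" "ball f e \<subseteq> O'" using openE by blast
    obtain n where n: "1 / real (Suc n) < e / 2" using nat_approx_posE[of "e / 2"] e by auto
    obtain d where d: "d \<in> E" "dist d f < 1 / real (Suc n)" using dense[of "1 / real (Suc n)" f]
      by auto
    have "ball d (1 / real (Suc n)) \<subseteq> ball f e"
    proof
      fix k assume "k \<in> ball d (1 / real (Suc n))"
      then show "k \<in> ball f e"
        using d n dist_triangle[of f k d] by (simp add: dist_commute)
    qed
    then show "\<exists>B'\<in>B. f \<in> B' \<and> B' \<subseteq> O'"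
      using d e by (intro bexI[of _ "ball d (1 / real (Suc n))"]) (auto simp: B_def)
  qed
  ultimately show "\<exists>B::('a \<Rightarrow>\<^sub>C 'b) set set. countable B \<and> open = generate_topology B"
    using topological_basis_imp_subbasis by blast
qed

instance bcontfun :: (metric_space, banach) banach ..

definition path_of :: "(real \<Rightarrow> real) \<Rightarrow> unit_interval \<Rightarrow>\<^sub>C real"
  where "path_of f = Bcontfun (\<lambda>s. f (time_of s))"

lemma apply_path_of:
  assumes "continuous_on {0..1} f"
  shows "apply_bcontfun (path_of f) s = f (time_of s)"
proof -
  have cont: "continuous_on UNIV (\<lambda>s. f (time_of s))"
    using time_of by (intro continuous_on_compose2[OF assms continuous_on_time_of]) auto
  then have "compact (range (\<lambda>s. f (time_of s)))"
    using compact_continuous_image compact_UNIV_space by blast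
  then have "(\<lambda>s. f (time_of s)) \<in> bcontfun"
    using cont compact_imp_bounded by (auto simp: bcontfun_def)
  then show ?thesis by (simp add: path_of_def Bcontfun_inverse)
qed

section \<open>Continuous and Gaussian processes indexed by the unit interval\<close>

definition continuous_process :: "'w measure \<Rightarrow> (real \<Rightarrow> 'w \<Rightarrow> real) \<Rightarrow> bool"
  where "continuous_process M X \<longleftrightarrow>
    (\<forall>t\<in>{0..1}. X t \<in> borel_measurable M) \<and>
    (\<forall>\<omega>\<in>space M. continuous_on {0..1} (\<lambda>t. X t \<omega>))"

text \<open>The second disjunct is the degenerate Gaussian law with variance zero.\<close>

definition centered_gaussian :: "'w measure \<Rightarrow> ('w \<Rightarrow> real) \<Rightarrow> bool"
  where "centered_gaussian M V \<longleftrightarrow> V \<in> borel_measurable M \<and>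
    ((\<exists>\<sigma>>0. distributed M lborel V (normal_density 0 \<sigma>)) \<or> (AE \<omega> in M. V \<omega> = 0))"

definition centered_gaussian_process :: "'w measure \<Rightarrow> (real \<Rightarrow> 'w \<Rightarrow> real) \<Rightarrow> bool"
  where "centered_gaussian_process M X \<longleftrightarrow>
    (\<forall>T c. finite T \<and> T \<subseteq> {0..1} \<longrightarrow> centered_gaussian M (\<lambda>\<omega>. \<Sum>t\<in>T. c t * X t \<omega>))"

definition path_law :: "'w measure \<Rightarrow> (real \<Rightarrow> 'w \<Rightarrow> real) \<Rightarrow> (unit_interval \<Rightarrow>\<^sub>C real) measure"
  where "path_law M X = distr M borel (\<lambda>\<omega>. path_of (\<lambda>t. X t \<omega>))"

section \<open>Convergence in law\<close>

definition converges_weakly ::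
  "('i \<Rightarrow> 'a::topological_space measure) \<Rightarrow> 'a measure \<Rightarrow> 'i filter \<Rightarrow> bool"
  where "converges_weakly \<mu> \<nu> A \<longleftrightarrow>
    (\<forall>\<phi> :: 'a \<Rightarrow>\<^sub>C real.
      ((\<lambda>i. \<integral>x. apply_bcontfun \<phi> x \<partial>\<mu> i) \<longlongrightarrow> (\<integral>x. apply_bcontfun \<phi> x \<partial>\<nu>)) A)"

section \<open>Large deviations\<close>

definition speed_function :: "(real \<Rightarrow> real) \<Rightarrow> bool"
  where "speed_function g \<longleftrightarrow> (\<forall>\<epsilon>>0. 0 \<le> g \<epsilon>) \<and> filterlim g at_top (at_right 0)"

definition rate_function :: "('a::topological_space \<Rightarrow> ennreal) \<Rightarrow> bool"
  where "rate_function I \<longleftrightarrow>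
    (\<forall>a. open {x. a < I x}) \<and> (\<forall>a::real. 0 \<le> a \<longrightarrow> compact {x. I x \<le> ennreal a})"

text \<open>The library sets \<open>ln 0 = 0\<close>, whereas here the logarithm of a null probability is \<open>-\<infinity>\<close>.\<close>

definition log_prob :: "'a measure \<Rightarrow> 'a set \<Rightarrow> ereal"
  where "log_prob \<mu> A = (if measure \<mu> A = 0 then -\<infinity> else ereal (ln (measure \<mu> A)))"

definition satisfies_LDP ::
  "(real \<Rightarrow> 'a::topological_space measure) \<Rightarrow> (real \<Rightarrow> real) \<Rightarrow> ('a \<Rightarrow> ennreal) \<Rightarrow> bool"
  where "satisfies_LDP \<mu> g I \<longleftrightarrow> rate_function I \<and>
    (\<forall>F. closed F \<longrightarrow>
      Limsup (at_right 0) (\<lambda>\<epsilon>. ereal (1 / g \<epsilon>) * log_prob (\<mu> \<epsilon>) F)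
        \<le> - enn2ereal (INF x\<in>F. I x)) \<and>
    (\<forall>G. open G \<longrightarrow>
      - enn2ereal (INF x\<in>G. I x)
        \<le> Liminf (at_right 0) (\<lambda>\<epsilon>. ereal (1 / g \<epsilon>) * log_prob (\<mu> \<epsilon>) G))"

section \<open>Reproducing kernel Hilbert spaces\<close>

definition square_integrable :: "'w measure \<Rightarrow> ('w \<Rightarrow> real) \<Rightarrow> bool"
  where "square_integrable M \<xi> \<longleftrightarrow>
    \<xi> \<in> borel_measurable M \<and> integrable M (\<lambda>\<omega>. (\<xi> \<omega>)\<^sup>2)"

definition L2_norm_of :: "'w measure \<Rightarrow> ('w \<Rightarrow> real) \<Rightarrow> real"
  where "L2_norm_of M \<xi> = sqrt (\<integral>\<omega>. (\<xi> \<omega>)\<^sup>2 \<partial>M)"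

text \<open>
  The \<open>L\<^sup>2\<close>-closure of the continuous linear functionals of \<open>Z\<close>. Its elements are functions rather
  than classes modulo almost sure equality.
\<close>

definition gaussian_space :: "'w measure \<Rightarrow> ('w \<Rightarrow> 'e::real_normed_vector) \<Rightarrow> ('w \<Rightarrow> real) set"
  where "gaussian_space M Z = {\<xi>. square_integrable M \<xi> \<and>
    (\<forall>\<delta>>0. \<exists>\<alpha> :: 'e \<Rightarrow>\<^sub>L real.
      square_integrable M (\<lambda>\<omega>. blinfun_apply \<alpha> (Z \<omega>)) \<and>
      L2_norm_of M (\<lambda>\<omega>. \<xi> \<omega> - blinfun_apply \<alpha> (Z \<omega>)) < \<delta>)}"

definition rkhs ::
  "'w measure \<Rightarrow> ('w \<Rightarrow> 'e::{banach, second_countable_topology}) \<Rightarrow> 'e set"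
  where "rkhs M Z = (\<lambda>\<xi>. \<integral>\<omega>. \<xi> \<omega> *\<^sub>R Z \<omega> \<partial>M) ` gaussian_space M Z"

text \<open>
  For \<open>h\<close> in the space, the representing \<open>\<xi>\<close> is unique up to almost sure equality, so its norm is
  determined by \<open>h\<close>.
\<close>

definition rkhs_norm ::
  "'w measure \<Rightarrow> ('w \<Rightarrow> 'e::{banach, second_countable_topology}) \<Rightarrow> 'e \<Rightarrow> real"
  where "rkhs_norm M Z h =
    (THE r. \<exists>\<xi>\<in>gaussian_space M Z. h = (\<integral>\<omega>. \<xi> \<omega> *\<^sub>R Z \<omega> \<partial>M) \<and> r = L2_norm_of M \<xi>)"

end

theory Submission
  imports Defs
begin

text \<open>
  Write \<open>W\<^sub>\<epsilon>\<close> for the small time path and \<open>Z\<close> for the weak limit of \<open>\<surd>g W\<^sub>\<epsilon>\<close>. For a finite combination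
  \<open>\<alpha>\<close> of evaluations, \<open>\<alpha>(W\<^sub>\<epsilon>)\<close> is Gaussian, so its exponential moments at scale \<open>g\<close> are explicit and
  converge to those of \<open>\<alpha>(Z)\<close>. Weak convergence controls the modulus of continuity of \<open>\<surd>g W\<^sub>\<epsilon>\<close> in
  probability, and Fernique's inequality (a consequence of the rotation invariance of a pair of
  independent copies) upgrades this to a bound at exponential speed \<open>g\<close>; hence only the values on a
  finite grid matter. By Riesz representation in \<open>L\<^sup>2\<close>, \<open>I(h) \<le> l\<close> iff
  \<open>\<alpha>(h)\<^sup>2 \<le> 2 l Var \<alpha>(Z)\<close> for all \<open>\<alpha>\<close>. The upper bound follows by covering with half-spaces
  \<open>{\<alpha> > l + Var \<alpha>(Z) / 2}\<close> and the exponential Markov inequality. The lower bound is obtained by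
  tilting with \<open>exp (g \<alpha>(W\<^sub>\<epsilon>))\<close>: under the tilted law \<open>W\<^sub>\<epsilon>\<close> concentrates near \<open>E[\<alpha>(Z) Z]\<close>, and paths
  of this form approximate any \<open>h\<close> of finite rate together with \<open>I(h)\<close>.
\<close>

section \<open>Uniqueness of joint laws\<close>

text \<open>Weak convergence controls events at a fixed scale of
  \<open>sqrt (g i) *\<^sub>R W i\<close>, whereas the LDP concerns deviations of order
  \<open>sqrt (g i)\<close> on that scale. Fernique's inequality bridges the gap because its
  hypothesis concerns a single level s: from P(sup > s) \<le> 1/4 it yields exp (- t^2 / (32 s^2)).
  A fine enough mesh r allows s to be as small as desired, so the oscillation of W exceeds \<delta>
  with probability at most exp (- a g) for any prescribed a. Fernique's inequality in turn compares
  the joint laws of a pair of independent copies and of the rotated pair, which is why uniqueness of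
  joint laws comes at the start. The RKHS is defined through the whole dual of the path space, but
  the estimates use only finite sums of evaluations: the element found by Riesz representation
  already lies in their L2 closure, and uniqueness of the representing element identifies its norm
  with the RKHS norm. Gaussianity of the limit is not an assumption; it results from the convergence
  of characteristic functions, together with the convergence of variances.\<close>

lemma finite_measure_eqI_char:
  fixes P Q :: "real measure"
  assumes P: "finite_measure P" "sets P = sets borel" and Q: "finite_measure Q" "sets Q = sets borel"
    and char: "\<And>t. char P t = char Q t"
  shows "P = Q"
proof -
  interpret P: finite_measure P by fact
  interpret Q: finite_measure Q by fact
  have sp: "space P = UNIV" "space Q = UNIV"
    using sets_eq_imp_space_eq[OF P(2)] sets_eq_imp_space_eq[OF Q(2)] by auto
  \<comment> \<open>The characteristic function at 0 is the total mass, so one common factor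
    normalises both measures to probability laws, to which Levy's uniqueness theorem applies. Mass 0
    is treated apart.\<close>
  have m: "measure P UNIV = measure Q UNIV"
    using char[of 0] sp by (simp add: char_def)
  show ?thesis
  proof (cases "measure P UNIV = 0")
    case True
    then have "emeasure P UNIV = 0" "emeasure Q UNIV = 0"
      using m by (simp_all add: P.emeasure_eq_measure Q.emeasure_eq_measure)
    then have "emeasure P A = emeasure Q A" for A
      using emeasure_mono[of A UNIV P] emeasure_mono[of A UNIV Q] P(2) Q(2)
      by (metis emeasure_space le_zero_eq sp)
    then show ?thesis using P(2) Q(2) by (intro measure_eqI) auto
  next
    case False
    define m where "m = measure P UNIV"
    have mp: "m > 0" using False by (simp add: m_def less_le)
    define r where "r = ennreal (1 / m)"
    have real: "real_distribution (scale_measure r L)"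
      if L: "finite_measure L" "sets L = sets borel" "measure L UNIV = m" "space L = UNIV" for L :: "real measure"
    proof -
      interpret L: finite_measure L by fact
      have "emeasure (scale_measure r L) UNIV = 1"
        using mp L(3) by (simp add: r_def L.emeasure_eq_measure ennreal_mult[symmetric])
      then show ?thesis
        unfolding real_distribution_def real_distribution_axioms_def using L(2,4)
        by (auto intro!: prob_spaceI simp: space_scale_measure)
    qed
    have charL: "char (scale_measure r L) t = char L t / m"
      if L: "sets L = sets borel" for L :: "real measure" and t
    proof -
      have "scale_measure r L = density L (\<lambda>_. r)"
        by (intro measure_eqI) (auto simp: emeasure_density nn_integral_cmult_indicator)
      also have "char (density L (\<lambda>_. r)) t = (CLINT x|density L (\<lambda>_. ennreal (1 / m)). iexp (t * x))"
        by (simp add: char_def r_def)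
      also have "\<dots> = (CLINT x|L. (1 / m) *\<^sub>R iexp (t * x))"
        using mp L measurable_cong_sets[OF L refl, of borel] by (subst integral_density) auto
      also have "\<dots> = char L t / m" by (simp add: char_def scaleR_conv_of_real divide_inverse)
      finally show ?thesis .
    qed
    have "scale_measure r P = scale_measure r Q"
      using P Q sp m charL char
      by (intro Levy_uniqueness real ext) (auto simp: m_def)
    then have "emeasure (scale_measure r P) A = emeasure (scale_measure r Q) A" for A by simp
    then have "r * emeasure P A = r * emeasure Q A" for A by simp
    moreover have "r \<noteq> 0" "r \<noteq> \<top>" using mp by (auto simp: r_def)
    ultimately show ?thesis using P(2) Q(2)
      by (intro measure_eqI) (auto simp: ennreal_mult_cancel_left)
  qed
qed

text \<open>The image under \<open>A\<close> of the measure with density \<open>w\<close> is finite,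
  and its characteristic function is the left-hand integral in \<open>eq\<close>; likewise for
  \<open>B\<close> and \<open>v\<close>. Uniqueness identifies the two images. The weights are what
  carries information about further coordinates.\<close>

lemma indicator_integral_eqI_char:
  fixes A :: "'a \<Rightarrow> real" and B :: "'b \<Rightarrow> real"
  assumes "finite_measure P" "finite_measure Q"
    and [measurable]: "A \<in> borel_measurable P" "B \<in> borel_measurable Q"
      "w \<in> borel_measurable P" "v \<in> borel_measurable Q"
    and w: "\<And>x. 0 \<le> w x" "\<And>x. w x \<le> c" and v: "\<And>x. 0 \<le> v x" "\<And>x. v x \<le> c"
    and eq: "\<And>t. (CLINT x|P. w x *\<^sub>R iexp (t * A x)) = (CLINT x|Q. v x *\<^sub>R iexp (t * B x))"
    and S[measurable]: "S \<in> sets borel"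
  shows "(LINT x|P. w x * indicator S (A x)) = (LINT x|Q. v x * indicator S (B x))"
proof -
  have key: "finite_measure (distr (density M f) borel U)
      \<and> (\<forall>t. char (distr (density M f) borel U) t = (CLINT x|M. f x *\<^sub>R iexp (t * U x)))
      \<and> measure (distr (density M f) borel U) S = (LINT x|M. f x * indicator S (U x))"
    if "finite_measure M" and [measurable]: "U \<in> borel_measurable M" "f \<in> borel_measurable M"
      and f: "\<And>x. 0 \<le> f x" "\<And>x. f x \<le> c"
    for M :: "'c measure" and f U :: "'c \<Rightarrow> real"
  proof -
    interpret finite_measure M by fact
    have "emeasure (density M f) (space M) = (\<integral>\<^sup>+x. f x \<partial>M)"
      by (auto simp: emeasure_density intro!: nn_integral_cong)
    also have "\<dots> \<le> (\<integral>\<^sup>+x. ennreal c \<partial>M)" using f by (intro nn_integral_mono) (auto intro: ennreal_leI)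
    also have "\<dots> < \<infinity>" by (simp add: emeasure_eq_measure ennreal_mult_less_top)
    finally have "finite_measure (density M f)"
      by (intro finite_measureI) auto
    then interpret D: finite_measure "density M f" .
    have fin: "finite_measure (distr (density M f) borel U)"
      by (rule D.finite_measure_distr) simp
    have "measure (distr (density M f) borel U) S = (LINT x|distr (density M f) borel U. indicator S x)"
      by simp
    also have "\<dots> = (LINT x|density M f. indicator S (U x))"
      by (rule integral_distr) auto
    also have "\<dots> = (LINT x|M. f x * indicator S (U x))"
      using f by (subst integral_density) auto
    finally show ?thesis
      using fin f by (auto simp: char_def integral_distr integral_density)
  qed
  have "distr (density P w) borel A = distr (density Q v) borel B"
    using key[of P A w] key[of Q B v] assms
    by (intro finite_measure_eqI_char) auto
  then show ?thesis using key[of P A w] key[of Q B v] assms by auto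
qed

text \<open>The induction fixes the coordinates to their sets one at a time: the weights \<open>2 + cos (C + a)\<close>
  are nonnegative, so one-dimensional uniqueness applies to the law of the next coordinate under them.\<close>

lemma rectangle_prob_eqI_char:
  fixes A :: "'i \<Rightarrow> 'a \<Rightarrow> real" and B :: "'i \<Rightarrow> 'b \<Rightarrow> real"
  assumes "finite J" "finite_measure P" "finite_measure Q"
    and "\<And>j. j \<in> J \<Longrightarrow> A j \<in> borel_measurable P" "\<And>j. j \<in> J \<Longrightarrow> B j \<in> borel_measurable Q"
    and "\<And>\<theta>. (CLINT x|P. iexp (\<Sum>j\<in>J. \<theta> j * A j x)) = (CLINT x|Q. iexp (\<Sum>j\<in>J. \<theta> j * B j x))"
    and "\<And>j. j \<in> J \<Longrightarrow> S j \<in> sets borel"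
  shows "measure P {x\<in>space P. \<forall>j\<in>J. A j x \<in> S j} = measure Q {x\<in>space Q. \<forall>j\<in>J. B j x \<in> S j}"
  using assms
proof (induction J arbitrary: P Q rule: finite_induct)
  case empty
  then interpret P: finite_measure P by simp
  interpret Q: finite_measure Q by fact
  show ?case using empty.prems(5)[of "\<lambda>_. 0"] by simp
next
  case (insert k J)
  interpret P: finite_measure P by fact
  interpret Q: finite_measure Q by fact
  have [measurable]: "A k \<in> borel_measurable P" "B k \<in> borel_measurable Q" "S k \<in> sets borel"
    using insert.prems by auto
  define PS where "PS = {x\<in>space P. A k x \<in> S k}"
  define QS where "QS = {x\<in>space Q. B k x \<in> S k}"
  have [measurable]: "PS \<in> sets P" "QS \<in> sets Q" unfolding PS_def QS_def by measurable
  have dens: "finite_measure (density M (indicator X))" if "finite_measure M" "X \<in> sets M"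
    for M :: "'c measure" and X
    using that finite_measure.emeasure_finite
    by (intro finite_measureI) (auto simp: emeasure_restricted)
  \<comment> \<open>The induction hypothesis is applied to \<open>P\<close> and \<open>Q\<close>
    restricted to the event on coordinate \<open>k\<close>. Restrictions have smaller total mass,
    hence the setting of finite measures.\<close>
  have ch: "(CLINT x|density P (indicator PS). iexp (\<Sum>j\<in>J. \<theta> j * A j x)) =
    (CLINT x|density Q (indicator QS). iexp (\<Sum>j\<in>J. \<theta> j * B j x))" for \<theta>
  proof -
    define C where "C x = (\<Sum>j\<in>J. \<theta> j * A j x)" for x
    define D where "D x = (\<Sum>j\<in>J. \<theta> j * B j x)" for x
    have [measurable]: "C \<in> borel_measurable P" "D \<in> borel_measurable Q"
      unfolding C_def D_def using insert.prems by (auto intro!: borel_measurable_sum borel_measurable_times)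
    have E: "(CLINT x|P. iexp (s * C x + t * A k x)) = (CLINT x|Q. iexp (s * D x + t * B k x))" for s t
    proof -
      have *: "(\<Sum>j\<in>insert k J. (if j = k then t else s * \<theta> j) * F j) = s * (\<Sum>j\<in>J. \<theta> j * F j) + t * F k"
        for F :: "'i \<Rightarrow> real"
      proof -
        have "(\<Sum>j\<in>J. (if j = k then t else s * \<theta> j) * F j) = (\<Sum>j\<in>J. s * (\<theta> j * F j))"
          using insert.hyps by (intro sum.cong) auto
        then show ?thesis using insert.hyps by (simp add: sum_distrib_left)
      qed
      show ?thesis
        using insert.prems(5)[of "\<lambda>j. if j = k then t else s * \<theta> j"]
        unfolding * C_def D_def .
    qed
    have int: "integrable M (\<lambda>x. iexp (f x))" if "finite_measure M" "f \<in> borel_measurable M"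
      for M :: "'c measure" and f
      using that by (intro finite_measure.integrable_const_bound[where B=1]) auto
    have intb: "integrable M (\<lambda>x. f x * g x)" if "finite_measure M" "f \<in> borel_measurable M"
      "g \<in> borel_measurable M" "\<And>x. \<bar>f x\<bar> \<le> 2" "\<And>x. \<bar>g x\<bar> \<le> 1" for M :: "'c measure" and f g :: "'c \<Rightarrow> real"
    proof -
      have "\<bar>f x * g x\<bar> \<le> 2 * 1" for x unfolding abs_mult using that by (intro mult_mono) auto
      then show ?thesis using that by (intro finite_measure.integrable_const_bound[where B="2 * 1"]) auto
    qed
    have trig: "(LINT x|P. (2 + cos (C x + a)) * indicator (S k) (A k x)) =
        (LINT x|Q. (2 + cos (D x + a)) * indicator (S k) (B k x))" for a
    proof (rule indicator_integral_eqI_char[where c=3])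
      fix t
      \<comment> \<open>Splitting the cosine into exponentials expresses the weighted characteristic
        function of coordinate \<open>k\<close> by joint ones, which \<open>E\<close> equates for s
        = 0, 1 and -1.\<close>
      have cosE: "(2 + cos (u + a)) *\<^sub>R iexp b =
          2 * iexp b + (iexp a / 2) * iexp (u + b) + (iexp (-a) / 2) * iexp (- u + b)" for u b
        by (simp add: scaleR_conv_of_real cos_exp_eq cos_of_real[symmetric] ring_distribs exp_add exp_diff exp_minus
            divide_simps add_ac mult_ac del: cos_of_real)
      have cosI: "(CLINT x|M. 2 * iexp (t * U x) + (iexp a / 2) * iexp (F x + t * U x) + (iexp (-a) / 2) * iexp (- F x + t * U x)) =
          2 * (CLINT x|M. iexp (t * U x)) + (iexp a / 2) * (CLINT x|M. iexp (F x + t * U x))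
          + (iexp (-a) / 2) * (CLINT x|M. iexp (- F x + t * U x))"
        if "finite_measure M" and [measurable]: "F \<in> borel_measurable M" "U \<in> borel_measurable M" for M :: "'c measure" and F U
      proof -
        have i: "integrable M (\<lambda>x. iexp (t * U x))" "integrable M (\<lambda>x. iexp (F x + t * U x))"
          "integrable M (\<lambda>x. iexp (- F x + t * U x))"
          by (rule int[OF that(1)], measurable)+
        show ?thesis
          by (subst Bochner_Integration.integral_add
              | intro Bochner_Integration.integrable_add integrable_mult_right i)+
            (simp only: integral_mult_right_zero)
      qed
      show "(CLINT x|P. (2 + cos (C x + a)) *\<^sub>R iexp (t * A k x)) = (CLINT x|Q. (2 + cos (D x + a)) *\<^sub>R iexp (t * B k x))"
        unfolding cosE cosI[OF P.finite_measure_axioms \<open>C \<in> borel_measurable P\<close> \<open>A k \<in> borel_measurable P\<close>]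
          cosI[OF Q.finite_measure_axioms \<open>D \<in> borel_measurable Q\<close> \<open>B k \<in> borel_measurable Q\<close>] using E[of 0 t] E[of 1 t] E[of "-1" t]
        by (simp add: mult.assoc)
    next
      have "2 + cos y \<le> 3" "0 \<le> 2 + cos y" for y :: real
        using cos_le_one[of y] cos_ge_minus_one[of y] by linarith+
      then show "2 + cos (C x + a) \<le> 3" "0 \<le> 2 + cos (C x + a)" "2 + cos (D y + a) \<le> 3" "0 \<le> 2 + cos (D y + a)" for x y
        by blast+
    qed (use P.finite_measure_axioms Q.finite_measure_axioms in measurable)
    \<comment> \<open>The constant weight 2, added for nonnegativity, satisfies the same identity
      and is subtracted again.\<close>
    have cosi: "(LINT x|P. cos (C x + a) * indicator (S k) (A k x)) =
        (LINT x|Q. cos (D x + a) * indicator (S k) (B k x))" for a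
    proof -
      have "(LINT x|P. 2 * indicator (S k) (A k x)) = (LINT x|Q. 2 * indicator (S k) (B k x) :: real)"
        using E[of 0] P.finite_measure_axioms Q.finite_measure_axioms
        by (intro indicator_integral_eqI_char[where c=2])
           (auto simp: scaleR_conv_of_real)
      moreover have "integrable P (\<lambda>x. 2 * indicator (S k) (A k x) :: real)"
          "integrable P (\<lambda>x. cos (C x + a) * indicator (S k) (A k x))"
          "integrable Q (\<lambda>x. 2 * indicator (S k) (B k x) :: real)"
          "integrable Q (\<lambda>x. cos (D x + a) * indicator (S k) (B k x))"
        by (rule intb[OF P.finite_measure_axioms] intb[OF Q.finite_measure_axioms];
            auto simp: indicator_def intro: order_trans[OF abs_cos_le_one])+
      ultimately show ?thesis using trig[of a] by (simp add: ring_distribs)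
    qed
    \<comment> \<open>The phases 0 and -pi/2 give the cosine and the sine, that is, the real and the
      imaginary part.\<close>
    have dI: "(CLINT x|density M (indicator X). iexp (f x)) =
        complex_of_real (LINT x|M. cos (f x + 0) * indicator T (g x)) + \<i> * complex_of_real (LINT x|M. cos (f x + (-pi/2)) * indicator T (g x))"
      if "finite_measure M" and [measurable]: "f \<in> borel_measurable M" "g \<in> borel_measurable M" "T \<in> sets borel"
        and X: "X = {x\<in>space M. g x \<in> T}"
      for M :: "'c measure" and X f g T
    proof -
      have [measurable]: "X \<in> sets M" unfolding X by measurable
      have "(CLINT x|density M (indicator X). iexp (f x)) = (CLINT x|density M (\<lambda>x. ennreal (indicator X x)). iexp (f x))"
        by (simp add: ennreal_indicator)
      also have "\<dots> = (CLINT x|M. indicator X x *\<^sub>R iexp (f x))"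
        by (subst integral_density) auto
      also have "\<dots> = (CLINT x|M. complex_of_real (cos (f x + 0) * indicator T (g x)) + \<i> * complex_of_real (cos (f x + (-pi/2)) * indicator T (g x)))"
        unfolding X
        by (intro Bochner_Integration.integral_cong refl)
          (auto simp: indicator_def exp_Euler cos_of_real sin_of_real cos_add cos_diff)
      also have "\<dots> = (CLINT x|M. complex_of_real (cos (f x + 0) * indicator T (g x))) + (CLINT x|M. \<i> * complex_of_real (cos (f x + (-pi/2)) * indicator T (g x)))"
        using that(1) by (intro Bochner_Integration.integral_add integrable_mult_right integrable_of_real intb)
          (auto simp: indicator_def order_trans[OF abs_cos_le_one])
      finally show ?thesis unfolding integral_mult_right_zero integral_complex_of_real .
    qed
    show ?thesis
      using dI[of P C "A k" "S k" PS] dI[of Q D "B k" "S k" QS] cosi[of 0] cosi[of "-pi/2"]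
        P.finite_measure_axioms Q.finite_measure_axioms
      by (simp add: PS_def QS_def C_def[symmetric] D_def[symmetric] del: add_0_right)
  qed
  have "measure (density P (indicator PS)) {x \<in> space (density P (indicator PS)). \<forall>j\<in>J. A j x \<in> S j} =
        measure (density Q (indicator QS)) {x \<in> space (density Q (indicator QS)). \<forall>j\<in>J. B j x \<in> S j}"
    using insert.prems insert.hyps ch dens[OF insert.prems(1) \<open>PS \<in> sets P\<close>] dens[OF insert.prems(2) \<open>QS \<in> sets Q\<close>]
    by (intro insert.IH) (simp_all del: of_real_sum of_real_mult)
  moreover have restr: "measure (density M (indicator X)) {x \<in> space M. \<forall>j\<in>J. F j x \<in> S j} = measure M {x\<in>space M. \<forall>j\<in>insert k J. F j x \<in> S j}"
    if X: "X = {x\<in>space M. F k x \<in> S k}" and m: "\<And>j. j \<in> insert k J \<Longrightarrow> F j \<in> borel_measurable M" for M :: "'c measure" and X F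
  proof -
    have s: "{x \<in> space M. F j x \<in> S j} \<in> sets M" if "j \<in> insert k J" for j
      using measurable_sets[OF m[OF that] insert.prems(6)[OF that]] by (simp add: vimage_def Int_def conj_commute)
    have XM: "X \<in> sets M" unfolding X using s by simp
    have Y: "{x \<in> space M. \<forall>j\<in>J. F j x \<in> S j} \<in> sets M"
      using s insert.hyps by (intro sets.sets_Collect_finite_All) auto
    have "X \<inter> {x \<in> space M. \<forall>j\<in>J. F j x \<in> S j} = {x\<in>space M. \<forall>j\<in>insert k J. F j x \<in> S j}"
      unfolding X by auto
    then show ?thesis using emeasure_restricted[OF XM Y] by (simp add: measure_def)
  qed
  ultimately show ?case
    using restr[of PS P A, OF PS_def insert.prems(3)] restr[of QS Q B, OF QS_def insert.prems(4)] by simp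
qed

section \<open>Gaussian variables and Fernique's inequality\<close>

interpretation std_normal: real_distribution std_normal_distribution
  by (rule real_dist_normal_dist)

lemma std_normal_scale:
  assumes "0 < \<sigma>"
  shows "distr std_normal_distribution borel (\<lambda>x. \<sigma> * x) = density lborel (normal_density 0 \<sigma>)"
proof -
  have "distributed std_normal_distribution lborel (\<lambda>x. x) std_normal_density"
    by (auto simp: distributed_def intro!: measure_eqI simp: emeasure_distr)
  from std_normal.normal_density_affine[OF this, of \<sigma> 0] assms
  have "distr std_normal_distribution lborel (\<lambda>x. \<sigma> * x) = density lborel (normal_density 0 \<sigma>)"
    by (simp add: distributed_def)
  moreover have "distr std_normal_distribution lborel (\<lambda>x. \<sigma> * x) = distr std_normal_distribution borel (\<lambda>x. \<sigma> * x)"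
    by (rule distr_cong) auto
  ultimately show ?thesis by simp
qed

text \<open>One formula for both disjuncts of \<open>centered_gaussian\<close>, with \<sigma> = 0
  for the degenerate law. Moments then reduce to the standard normal law without a case
  distinction.\<close>

lemma (in prob_space) centered_gaussian_distr:
  assumes "centered_gaussian M V"
  obtains \<sigma> where "\<sigma> \<ge> 0" "distr M borel V = distr std_normal_distribution borel (\<lambda>x. \<sigma> * x)"
proof -
  have [measurable]: "V \<in> borel_measurable M" using assms by (simp add: centered_gaussian_def)
  consider \<sigma> where "\<sigma> > 0" "distributed M lborel V (normal_density 0 \<sigma>)" | "AE x in M. V x = 0"
    using assms by (auto simp: centered_gaussian_def)
  then show ?thesis
  proof cases
    case 1
    have "distr M borel V = distr M lborel V" by (rule distr_cong) auto
    then show ?thesis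
      using 1 that[of \<sigma>] std_normal_scale[of \<sigma>] by (simp add: distributed_def)
  next
    case 2
    have "distr M borel V = distr M borel (\<lambda>_. 0)"
      using 2 by (intro distr_cong_AE) auto
    then show ?thesis using that[of 0] by (simp add: distr_const std_normal.distr_const)
  qed
qed

lemma (in prob_space) centered_gaussianI_distr:
  assumes [measurable]: "V \<in> borel_measurable M" and "\<sigma> \<ge> 0"
    and eq: "distr M borel V = distr std_normal_distribution borel (\<lambda>x. \<sigma> * x)"
  shows "centered_gaussian M V"
proof (cases "\<sigma> = 0")
  case True
  then have "AE x in distr M borel V. x = 0"
    unfolding eq by (simp add: AE_distr_iff)
  then have "AE x in M. V x = 0" by (simp add: AE_distr_iff)
  then show ?thesis by (simp add: centered_gaussian_def)
next
  case False
  have "distr M borel V = distr M lborel V" by (rule distr_cong) auto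
  then have "distributed M lborel V (normal_density 0 \<sigma>)"
    using eq False assms(2) std_normal_scale[of \<sigma>] by (simp add: distributed_def)
  then show ?thesis using False assms by (auto simp: centered_gaussian_def intro!: exI[of _ \<sigma>])
qed

lemma std_normal_mgf:
  shows "integrable std_normal_distribution (\<lambda>x. exp (\<sigma> * x))"
    and "(LINT x|std_normal_distribution. exp (\<sigma> * x)) = exp (\<sigma>^2 / 2)"
proof -
  \<comment> \<open>Completing the square: the exponential weight shifts the mean to
    \<sigma>.\<close>
  have eq: "std_normal_density x * exp (\<sigma> * x) = exp (\<sigma>^2 / 2) * normal_density \<sigma> 1 x" for x
    by (simp add: normal_density_def exp_add[symmetric] power2_eq_square field_simps)
  show "integrable std_normal_distribution (\<lambda>x. exp (\<sigma> * x))"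
    by (subst integrable_density) (auto simp: eq)
  show "(LINT x|std_normal_distribution. exp (\<sigma> * x)) = exp (\<sigma>^2 / 2)"
    by (subst integral_density) (auto simp: eq)
qed

lemma (in prob_space) centered_gaussian_moments:
  assumes "centered_gaussian M V"
  shows centered_gaussian_square_integrable: "integrable M (\<lambda>x. (V x)^2)"
    and centered_gaussian_char: "(CLINT x|M. iexp (V x)) = exp (- (LINT x|M. (V x)^2) / 2)"
    and centered_gaussian_exp_integrable: "integrable M (\<lambda>x. exp (V x))"
    and centered_gaussian_mgf: "(LINT x|M. exp (V x)) = exp ((LINT x|M. (V x)^2) / 2)"
proof -
  have [measurable]: "V \<in> borel_measurable M" using assms by (simp add: centered_gaussian_def)
  obtain \<sigma> where \<sigma>: "\<sigma> \<ge> 0" "distr M borel V = distr std_normal_distribution borel (\<lambda>x. \<sigma> * x)"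
    using centered_gaussian_distr[OF assms] .
  have I: "(LINT x|M. f (V x)) = (LINT x|std_normal_distribution. f (\<sigma> * x))"
    if [measurable]: "f \<in> borel_measurable borel" for f :: "real \<Rightarrow> 'c::{banach, second_countable_topology}"
    using arg_cong[OF \<sigma>(2), of "\<lambda>m. integral\<^sup>L m f"] by (simp add: integral_distr)
  have J: "integrable M (\<lambda>x. f (V x)) = integrable std_normal_distribution (\<lambda>x. f (\<sigma> * x))"
    if [measurable]: "f \<in> borel_measurable borel" for f :: "real \<Rightarrow> real"
    using arg_cong[OF \<sigma>(2), of "\<lambda>m. integrable m f"] by (simp add: integrable_distr_eq)
  show "integrable M (\<lambda>x. (V x)^2)"
    using integrable_std_normal_distribution_moment[of 2]
    by (subst J) (auto simp: power_mult_distrib)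
  have v: "(LINT x|M. (V x)^2) = \<sigma>^2"
    using std_normal_distribution_even_moments(1)[of 1]
    by (subst I) (auto simp: power_mult_distrib)
  show "(CLINT x|M. iexp (V x)) = exp (- (LINT x|M. (V x)^2) / 2)"
    unfolding v using fun_cong[OF char_std_normal_distribution, of \<sigma>]
    by (subst I) (simp_all add: char_def)
  show "integrable M (\<lambda>x. exp (V x))"
    using std_normal_mgf(1) by (subst J) auto
  show "(LINT x|M. exp (V x)) = exp ((LINT x|M. (V x)^2) / 2)"
    unfolding v using std_normal_mgf(2) by (subst I) auto
qed

section \<open>Rotation invariance and Gaussian tails of finite suprema\<close>

lemma (in prob_space) integral_pair_mult:
  fixes f g :: "'a \<Rightarrow> complex"
  assumes [measurable]: "f \<in> borel_measurable M" "g \<in> borel_measurable M"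
    and "\<And>x. norm (f x) \<le> 1" "\<And>x. norm (g x) \<le> 1"
  shows "(CLINT z|M \<Otimes>\<^sub>M M. f (fst z) * g (snd z)) = (CLINT x|M. f x) * (CLINT x|M. g x)"
proof -
  interpret P: pair_prob_space M M ..
  have "norm (f x * g y) \<le> 1" for x y
    using mult_mono[of "norm (f x)" 1 "norm (g y)" 1] assms by (simp add: norm_mult)
  then have "integrable (M \<Otimes>\<^sub>M M) (\<lambda>z. f (fst z) * g (snd z))"
    by (intro P.P.integrable_const_bound[where B=1]) auto
  from P.integral_fst'[OF this] show ?thesis by simp
qed

text \<open>The characteristic function of two independent copies at (\<theta>, \<eta>) depends only
  on q \<theta> + q \<eta>, where q is the quadratic form of variances. Rotation by 45 degrees acts
  on the coefficients, and the parallelogram law leaves this sum unchanged.\<close>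

lemma (in prob_space) gaussian_family_rotation:
  fixes U :: "'i \<Rightarrow> 'a \<Rightarrow> real"
  assumes J: "finite J"
    and G: "\<And>\<theta>. centered_gaussian M (\<lambda>x. \<Sum>j\<in>J. \<theta> j * U j x)"
    and U: "\<And>j. j \<in> J \<Longrightarrow> U j \<in> borel_measurable M"
  shows "measure (M \<Otimes>\<^sub>M M) {z\<in>space (M \<Otimes>\<^sub>M M). \<forall>j\<in>J. \<bar>U j (fst z)\<bar> \<le> s \<and> \<bar>U j (snd z)\<bar> \<le> t} =
    measure (M \<Otimes>\<^sub>M M) {z\<in>space (M \<Otimes>\<^sub>M M). \<forall>j\<in>J. \<bar>(U j (fst z) - U j (snd z)) / sqrt 2\<bar> \<le> s
       \<and> \<bar>(U j (fst z) + U j (snd z)) / sqrt 2\<bar> \<le> t}"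
proof -
  interpret P: pair_prob_space M M ..
  define q where "q \<theta> = (LINT x|M. (\<Sum>j\<in>J. \<theta> j * U j x)^2)" for \<theta>
  \<comment> \<open>The Boolean tag selects the copy: \<open>A\<close> lists both copies as one
    family over pairs, \<open>B\<close> lists their rotations.\<close>
  define A where "A p z = (if snd p then U (fst p) (snd z) else U (fst p) (fst z))" for p :: "'i \<times> bool" and z :: "'a \<times> 'a"
  define B where "B p z = (if snd p then (U (fst p) (fst z) + U (fst p) (snd z)) / sqrt 2
    else (U (fst p) (fst z) - U (fst p) (snd z)) / sqrt 2)" for p :: "'i \<times> bool" and z :: "'a \<times> 'a"
  define S where "S p = (if snd p then {-t..t} else {-s..s})" for p :: "'i \<times> bool"
  have meas: "(\<lambda>x. \<Sum>j\<in>J. \<theta> j * U j x) \<in> borel_measurable M" for \<theta>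
    using G[of \<theta>] by (simp add: centered_gaussian_def)
  have char: "(CLINT z|M \<Otimes>\<^sub>M M. iexp ((\<Sum>j\<in>J. \<theta> j * U j (fst z)) + (\<Sum>j\<in>J. \<eta> j * U j (snd z))))
     = exp (- (q \<theta> + q \<eta>) / 2)" for \<theta> \<eta>
  proof -
    have "(CLINT z|M \<Otimes>\<^sub>M M. iexp ((\<Sum>j\<in>J. \<theta> j * U j (fst z)) + (\<Sum>j\<in>J. \<eta> j * U j (snd z))))
     = (CLINT z|M \<Otimes>\<^sub>M M. iexp (\<Sum>j\<in>J. \<theta> j * U j (fst z)) * iexp (\<Sum>j\<in>J. \<eta> j * U j (snd z)))"
      by (simp only: of_real_add ring_distribs exp_add)
    also have "\<dots> = (CLINT x|M. iexp (\<Sum>j\<in>J. \<theta> j * U j x)) * (CLINT x|M. iexp (\<Sum>j\<in>J. \<eta> j * U j x))"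
      using meas[of \<theta>] meas[of \<eta>]
      by (intro integral_pair_mult norm_exp_i_times[THEN eq_refl]) (simp_all del: of_real_sum of_real_mult)
    also have "\<dots> = exp (- (q \<theta> + q \<eta>) / 2)"
      unfolding centered_gaussian_char[OF G] q_def[symmetric]
      by (simp add: exp_of_real[symmetric] exp_add[symmetric] add_divide_distrib diff_divide_distrib)
    finally show ?thesis .
  qed
  have par: "q (\<lambda>j. (\<theta> j + \<eta> j) / sqrt 2) + q (\<lambda>j. (\<eta> j - \<theta> j) / sqrt 2) = q \<theta> + q \<eta>" for \<theta> \<eta>
  proof -
    note I = centered_gaussian_square_integrable[OF G]
    have "q (\<lambda>j. (\<theta> j + \<eta> j) / sqrt 2) + q (\<lambda>j. (\<eta> j - \<theta> j) / sqrt 2) =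
      (LINT x|M. (\<Sum>j\<in>J. ((\<theta> j + \<eta> j) / sqrt 2) * U j x)^2 + (\<Sum>j\<in>J. ((\<eta> j - \<theta> j) / sqrt 2) * U j x)^2)"
      unfolding q_def by (intro Bochner_Integration.integral_add[symmetric] I)
    also have "\<dots> = (LINT x|M. (\<Sum>j\<in>J. \<theta> j * U j x)^2 + (\<Sum>j\<in>J. \<eta> j * U j x)^2)"
    proof (rule Bochner_Integration.integral_cong[OF refl])
      fix x
      define a where "a = (\<Sum>j\<in>J. \<theta> j * U j x)"
      define b where "b = (\<Sum>j\<in>J. \<eta> j * U j x)"
      have ab: "(\<Sum>j\<in>J. ((\<theta> j + \<eta> j) / sqrt 2) * U j x) = (a + b) / sqrt 2"
        unfolding a_def b_def sum.distrib[symmetric] sum_divide_distrib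
        by (intro sum.cong) (auto simp: field_simps)
      have ba: "(\<Sum>j\<in>J. ((\<eta> j - \<theta> j) / sqrt 2) * U j x) = (b - a) / sqrt 2"
        unfolding a_def b_def sum_subtractf[symmetric] sum_divide_distrib
        by (intro sum.cong) (auto simp: field_simps)
      show "(\<Sum>j\<in>J. ((\<theta> j + \<eta> j) / sqrt 2) * U j x)^2 + (\<Sum>j\<in>J. ((\<eta> j - \<theta> j) / sqrt 2) * U j x)^2 =
        (\<Sum>j\<in>J. \<theta> j * U j x)^2 + (\<Sum>j\<in>J. \<eta> j * U j x)^2"
        unfolding ab ba a_def[symmetric] b_def[symmetric]
        by (simp add: power_divide power2_eq_square field_simps)
    qed
    also have "\<dots> = q \<theta> + q \<eta>"
      unfolding q_def by (intro Bochner_Integration.integral_add I)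
    finally show ?thesis .
  qed
  have sumJ: "(\<Sum>p\<in>J \<times> (UNIV :: bool set). f p) = (\<Sum>j\<in>J. f (j, False)) + (\<Sum>j\<in>J. f (j, True))" for f :: "'i \<times> bool \<Rightarrow> real"
    unfolding sum.cartesian_product[symmetric, of "\<lambda>j b. f (j, b)", simplified]
    by (simp add: UNIV_bool sum.distrib)
  have "measure (M \<Otimes>\<^sub>M M) {z\<in>space (M \<Otimes>\<^sub>M M). \<forall>p\<in>J \<times> UNIV. A p z \<in> S p} =
      measure (M \<Otimes>\<^sub>M M) {z\<in>space (M \<Otimes>\<^sub>M M). \<forall>p\<in>J \<times> UNIV. B p z \<in> S p}"
  proof (rule rectangle_prob_eqI_char)
    fix \<theta> :: "'i \<times> bool \<Rightarrow> real"
    have a: "(\<Sum>p\<in>J \<times> UNIV. \<theta> p * A p z) = (\<Sum>j\<in>J. \<theta> (j, False) * U j (fst z)) + (\<Sum>j\<in>J. \<theta> (j, True) * U j (snd z))" for z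
      by (simp add: sumJ A_def)
    have b: "(\<Sum>p\<in>J \<times> UNIV. \<theta> p * B p z) = (\<Sum>j\<in>J. ((\<theta> (j, False) + \<theta> (j, True)) / sqrt 2) * U j (fst z))
        + (\<Sum>j\<in>J. ((\<theta> (j, True) - \<theta> (j, False)) / sqrt 2) * U j (snd z))" for z
      unfolding sumJ sum.distrib[symmetric] by (intro sum.cong) (auto simp: B_def field_simps)
    show "(CLINT z|M \<Otimes>\<^sub>M M. iexp (\<Sum>p\<in>J \<times> UNIV. \<theta> p * A p z)) =
          (CLINT z|M \<Otimes>\<^sub>M M. iexp (\<Sum>p\<in>J \<times> UNIV. \<theta> p * B p z))"
      unfolding a b char par ..
  next
    fix p :: "'i \<times> bool" assume "p \<in> J \<times> UNIV"
    then have [measurable]: "U (fst p) \<in> borel_measurable M" using U by auto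
    show "A p \<in> borel_measurable (M \<Otimes>\<^sub>M M)" "B p \<in> borel_measurable (M \<Otimes>\<^sub>M M)"
      unfolding A_def B_def by measurable
    show "S p \<in> sets borel" by (simp add: S_def)
  qed (use J P.P.finite_measure_axioms in auto)
  moreover have "(\<forall>p\<in>J \<times> UNIV. A p z \<in> S p) \<longleftrightarrow> (\<forall>j\<in>J. \<bar>U j (fst z)\<bar> \<le> s \<and> \<bar>U j (snd z)\<bar> \<le> t)" for z
    unfolding A_def S_def by (auto simp: UNIV_bool abs_le_iff)
  moreover have "(\<forall>p\<in>J \<times> UNIV. B p z \<in> S p) \<longleftrightarrow> (\<forall>j\<in>J. \<bar>(U j (fst z) - U j (snd z)) / sqrt 2\<bar> \<le> s
       \<and> \<bar>(U j (fst z) + U j (snd z)) / sqrt 2\<bar> \<le> t)" for z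
    unfolding B_def S_def by (auto simp: UNIV_bool abs_le_iff simp del: abs_divide)
  ultimately show ?thesis by simp
qed

text \<open>For independent copies x and y, the left side is the probability that all |x j| are at
  most s and some |y j| exceeds t. After rotation this reads |x j - y j| \<le> sqrt 2 * s for all j
  and |x j + y j| > sqrt 2 * t for some j. At that j both |x j| and |y j| exceed (t - s) / sqrt 2,
  and independence produces the square.\<close>

lemma (in prob_space) fernique_step:
  fixes U :: "'i \<Rightarrow> 'a \<Rightarrow> real"
  assumes J: "finite J"
    and G: "\<And>\<theta>. centered_gaussian M (\<lambda>x. \<Sum>j\<in>J. \<theta> j * U j x)"
    and U: "\<And>j. j \<in> J \<Longrightarrow> U j \<in> borel_measurable M"
  shows "prob {x\<in>space M. \<forall>j\<in>J. \<bar>U j x\<bar> \<le> s} * prob {x\<in>space M. \<exists>j\<in>J. \<bar>U j x\<bar> > t}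
    \<le> (prob {x\<in>space M. \<exists>j\<in>J. \<bar>U j x\<bar> > (t - s) / sqrt 2})^2"
proof -
  interpret P: pair_prob_space M M ..
  let ?PP = "M \<Otimes>\<^sub>M M"
  define A where "A r = {x\<in>space M. \<forall>j\<in>J. \<bar>U j x\<bar> \<le> r}" for r
  define B where "B r = {x\<in>space M. \<exists>j\<in>J. \<bar>U j x\<bar> > r}" for r
  have m: "A r \<in> sets M" "B r \<in> sets M" for r
  proof -
    have "{x\<in>space M. \<bar>U j x\<bar> \<le> r} \<in> sets M" "{x\<in>space M. \<bar>U j x\<bar> > r} \<in> sets M" if "j \<in> J" for j
      using U[OF that] by measurable
    then show "A r \<in> sets M" "B r \<in> sets M"
      unfolding A_def B_def using J by (auto intro!: sets.sets_Collect_finite_All sets.sets_Collect_finite_Ex)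
  qed
  have prod: "measure ?PP (X \<times> Y) = prob X * prob Y" if "X \<in> sets M" "Y \<in> sets M" for X Y
    using that by (simp add: measure_def emeasure_pair_measure_Times enn2real_mult)
  define R where "R r = {z\<in>space ?PP. \<forall>j\<in>J. \<bar>(U j (fst z) - U j (snd z)) / sqrt 2\<bar> \<le> s
       \<and> \<bar>(U j (fst z) + U j (snd z)) / sqrt 2\<bar> \<le> r}" for r
  define Rs where "Rs = {z\<in>space ?PP. \<forall>j\<in>J. \<bar>(U j (fst z) - U j (snd z)) / sqrt 2\<bar> \<le> s}"
  have Rm: "R r \<in> sets ?PP" "Rs \<in> sets ?PP" for r
  proof -
    have "{z\<in>space ?PP. \<bar>(U j (fst z) - U j (snd z)) / sqrt 2\<bar> \<le> s
       \<and> \<bar>(U j (fst z) + U j (snd z)) / sqrt 2\<bar> \<le> r} \<in> sets ?PP"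
      "{z\<in>space ?PP. \<bar>(U j (fst z) - U j (snd z)) / sqrt 2\<bar> \<le> s} \<in> sets ?PP" if "j \<in> J" for j
    proof -
      have [measurable]: "U j \<in> borel_measurable M" by (rule U[OF that])
      show "{z\<in>space ?PP. \<bar>(U j (fst z) - U j (snd z)) / sqrt 2\<bar> \<le> s
       \<and> \<bar>(U j (fst z) + U j (snd z)) / sqrt 2\<bar> \<le> r} \<in> sets ?PP"
      "{z\<in>space ?PP. \<bar>(U j (fst z) - U j (snd z)) / sqrt 2\<bar> \<le> s} \<in> sets ?PP" by measurable
    qed
    then show "R r \<in> sets ?PP" "Rs \<in> sets ?PP"
      unfolding R_def Rs_def using J by (auto intro!: sets.sets_Collect_finite_All)
  qed
  have rot: "prob (A s) * prob (A r) = measure ?PP (R r)" for r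
  proof -
    have "A s \<times> A r = {z\<in>space ?PP. \<forall>j\<in>J. \<bar>U j (fst z)\<bar> \<le> s \<and> \<bar>U j (snd z)\<bar> \<le> r}"
      by (auto simp: A_def space_pair_measure)
    then show ?thesis unfolding R_def
      using gaussian_family_rotation[OF J G U, of s r] prod[OF m(1) m(1), of s r] by simp
  qed
  \<comment> \<open>Sending the level of the second copy to infinity removes its constraint, so
    \<open>rot\<close> gives P(A s) as the probability of \<open>Rs\<close>. Subtracting
    \<open>rot\<close> at level t leaves the event that the second copy exceeds t.\<close>
  have lim: "(\<lambda>n. prob (A (real n))) \<longlonglongrightarrow> 1" "(\<lambda>n. measure ?PP (R (real n))) \<longlonglongrightarrow> measure ?PP Rs"
  proof -
    have bnd: "\<exists>n. \<forall>j\<in>J. f j \<le> real n" for f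
    proof -
      obtain n where n: "Max (insert 0 (f ` J)) \<le> real n" using real_arch_simple by blast
      then have "\<forall>j\<in>J. f j \<le> real n" using J by (simp add: Max_le_iff)
      then show ?thesis ..
    qed
    have "(\<lambda>n. prob (A (real n))) \<longlonglongrightarrow> prob (\<Union>n. A (real n))"
      using m by (intro finite_Lim_measure_incseq) (auto simp: incseq_def A_def intro: order_trans)
    also have "(\<Union>n. A (real n)) = space M"
      using bnd[of "\<lambda>j. \<bar>U j x\<bar>" for x] by (auto simp: A_def)
    finally show "(\<lambda>n. prob (A (real n))) \<longlonglongrightarrow> 1" by (simp add: prob_space)
    have "(\<lambda>n. measure ?PP (R (real n))) \<longlonglongrightarrow> measure ?PP (\<Union>n. R (real n))"
    proof (rule P.P.finite_Lim_measure_incseq)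
      show "incseq (\<lambda>n. R (real n))"
        unfolding incseq_def R_def using of_nat_mono order_trans by blast
    qed (use Rm in auto)
    also have "(\<Union>n. R (real n)) = Rs"
    proof
      show "Rs \<subseteq> (\<Union>n. R (real n))"
      proof
        fix z assume z: "z \<in> Rs"
        obtain n where "\<forall>j\<in>J. \<bar>(U j (fst z) + U j (snd z)) / sqrt 2\<bar> \<le> real n"
          using bnd[of "\<lambda>j. \<bar>(U j (fst z) + U j (snd z)) / sqrt 2\<bar>"] by blast
        then have "z \<in> R (real n)" using z unfolding R_def Rs_def mem_Collect_eq by metis
        then show "z \<in> (\<Union>n. R (real n))" by blast
      qed
      show "(\<Union>n. R (real n)) \<subseteq> Rs" unfolding R_def Rs_def by blast
    qed
    finally show "(\<lambda>n. measure ?PP (R (real n))) \<longlonglongrightarrow> measure ?PP Rs" .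
  qed
  have As: "prob (A s) = measure ?PP Rs"
  proof (rule LIMSEQ_unique[OF _ lim(2)])
    show "(\<lambda>n. measure ?PP (R (real n))) \<longlonglongrightarrow> prob (A s)"
      using tendsto_mult[OF tendsto_const lim(1), of "prob (A s)"] by (simp add: rot)
  qed
  have Bt: "prob (B t) = 1 - prob (A t)"
  proof -
    have "B t = space M - A t" unfolding A_def B_def not_le[symmetric] by blast
    then show ?thesis using prob_compl[OF m(1)] by simp
  qed
  have "prob (A s) * prob (B t) = measure ?PP Rs - measure ?PP (R t)"
    unfolding Bt using rot[of t] As by (simp add: right_diff_distrib)
  also have "\<dots> = measure ?PP (Rs - R t)"
    using Rm by (intro P.P.finite_measure_Diff[symmetric]) (auto simp: R_def Rs_def)
  also have "\<dots> \<le> measure ?PP (B ((t - s) / sqrt 2) \<times> B ((t - s) / sqrt 2))"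
  proof (rule P.P.finite_measure_mono)
    show "Rs - R t \<subseteq> B ((t - s) / sqrt 2) \<times> B ((t - s) / sqrt 2)"
    proof
      fix z assume z: "z \<in> Rs - R t"
      then have sp: "fst z \<in> space M" "snd z \<in> space M" by (auto simp: Rs_def space_pair_measure)
      from z obtain j where j: "j \<in> J" and 1: "\<bar>(U j (fst z) - U j (snd z)) / sqrt 2\<bar> \<le> s"
        and 2: "\<bar>(U j (fst z) + U j (snd z)) / sqrt 2\<bar> > t" unfolding Rs_def R_def by force
      have 1: "\<bar>U j (fst z) - U j (snd z)\<bar> \<le> sqrt 2 * s" using 1 by (simp add: divide_le_eq mult.commute)
      have 2: "\<bar>U j (fst z) + U j (snd z)\<bar> > sqrt 2 * t" using 2 by (simp add: less_divide_eq mult.commute)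
      have tri: "\<bar>x + y\<bar> \<le> 2 * \<bar>x\<bar> + \<bar>x - y\<bar>" "\<bar>x + y\<bar> \<le> 2 * \<bar>y\<bar> + \<bar>x - y\<bar>" for x y :: real
        by (auto simp: abs_if)
      have e: "(t - s) / sqrt 2 = (sqrt 2 * t - sqrt 2 * s) / 2"
        by (simp add: field_simps)
      have "\<bar>U j (fst z)\<bar> > (t - s) / sqrt 2" "\<bar>U j (snd z)\<bar> > (t - s) / sqrt 2"
        unfolding e using 1 2 tri[of "U j (fst z)" "U j (snd z)"] by auto
      then have "fst z \<in> B ((t - s) / sqrt 2)" "snd z \<in> B ((t - s) / sqrt 2)"
        unfolding B_def using j sp by auto
      then show "z \<in> B ((t - s) / sqrt 2) \<times> B ((t - s) / sqrt 2)" by (simp add: mem_Times_iff)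
    qed
  qed (use m in auto)
  also have "\<dots> = (prob (B ((t - s) / sqrt 2)))^2" using m by (simp add: prod power2_eq_square)
  finally show ?thesis by (simp add: A_def B_def)
qed

text \<open>Along levels with T (n + 1) = s + sqrt 2 * T n the one-step inequality squares the ratio
  b / a at each step. The level 1/4 makes the initial ratio at most (1/4) / (3/4) = 1/3. The ratio
  is thus at most (1/3)^(2^n) while T n grows like (sqrt 2)^n, and 2^n is of the order of the square
  of T n: a Gaussian tail.\<close>

lemma (in prob_space) fernique_tail:
  fixes U :: "'i \<Rightarrow> 'a \<Rightarrow> real"
  assumes J: "finite J"
    and G: "\<And>\<theta>. centered_gaussian M (\<lambda>x. \<Sum>j\<in>J. \<theta> j * U j x)"
    and U: "\<And>j. j \<in> J \<Longrightarrow> U j \<in> borel_measurable M"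
    and s: "0 < s" "prob {x\<in>space M. \<exists>j\<in>J. \<bar>U j x\<bar> > s} \<le> 1 / 4"
    and t: "4 * s \<le> t"
  shows "prob {x\<in>space M. \<exists>j\<in>J. \<bar>U j x\<bar> > t} \<le> exp (- t\<^sup>2 / (32 * s^2))"
proof -
  define b where "b r = prob {x\<in>space M. \<exists>j\<in>J. \<bar>U j x\<bar> > r}" for r
  define a where "a = prob {x\<in>space M. \<forall>j\<in>J. \<bar>U j x\<bar> \<le> s}"
  define T where "T = rec_nat s (\<lambda>_ x. s + sqrt 2 * x)"
  have T: "T 0 = s" "T (Suc n) = s + sqrt 2 * T n" for n by (simp_all add: T_def)
  have m: "{x\<in>space M. \<exists>j\<in>J. \<bar>U j x\<bar> > r} \<in> sets M" for r
  proof -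
    have "{x\<in>space M. \<bar>U j x\<bar> > r} \<in> sets M" if "j \<in> J" for j
      using U[OF that] by measurable
    then show ?thesis using J by (auto intro!: sets.sets_Collect_finite_Ex)
  qed
  have "a = 1 - b s"
  proof -
    have "{x\<in>space M. \<forall>j\<in>J. \<bar>U j x\<bar> \<le> s} = space M - {x\<in>space M. \<exists>j\<in>J. \<bar>U j x\<bar> > s}"
      unfolding not_le[symmetric] by blast
    then show ?thesis using prob_compl[OF m] by (simp add: a_def b_def)
  qed
  then have a: "3 / 4 \<le> a" "a \<le> 1" using s(2) by (simp_all add: b_def)
  have decay: "b (T n) \<le> a * (1 / 3) ^ (2 ^ n)" for n
  proof (induction n)
    case 0
    then show ?case using a s(2) by (simp add: T b_def)
  next
    case (Suc n)
    have "a * b (T (Suc n)) \<le> (b (T n))^2"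
      using fernique_step[OF J G U, of s "T (Suc n)"] by (simp add: a_def b_def T)
    also have "\<dots> \<le> (a * (1 / 3) ^ (2 ^ n))^2"
      using Suc by (intro power_mono) (auto simp: b_def)
    also have "\<dots> = a * (a * (1 / 3) ^ (2 ^ Suc n))"
      by (simp add: power_mult_distrib power_add[symmetric] mult_2 power2_eq_square)
    finally show ?case using a by (simp add: mult_le_cancel_left)
  qed
  \<comment> \<open>The shift is minus the fixed point of x = s + sqrt 2 * x, which makes the
    recursion geometric.\<close>
  have "T n + (sqrt 2 + 1) * s = sqrt 2 ^ n * (2 + sqrt 2) * s" for n
  proof (induction n)
    case (Suc n)
    have "T (Suc n) + (sqrt 2 + 1) * s = sqrt 2 * (T n + (sqrt 2 + 1) * s)"
      by (simp add: T algebra_simps)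
    then show ?case by (simp add: Suc)
  qed (simp add: T algebra_simps)
  then have T_eq: "T n = sqrt 2 ^ n * (2 + sqrt 2) * s - (sqrt 2 + 1) * s" for n
    by (simp add: eq_diff_eq)
  have T_le: "T n \<le> 4 * s * sqrt 2 ^ n" for n
  proof -
    have "sqrt 2 \<le> 2" by (rule real_le_lsqrt) auto
    then have "sqrt 2 ^ n * (2 + sqrt 2) * s \<le> sqrt 2 ^ n * 4 * s"
      using s(1) by (intro mult_right_mono mult_left_mono) auto
    moreover have "0 \<le> (sqrt 2 + 1) * s" using s(1) by simp
    ultimately show ?thesis unfolding T_eq by (simp add: mult_ac)
  qed
  \<comment> \<open>The largest n with 4 s (sqrt 2)^n \<le> t. The first inequality gives T n \<le>
    t, the second t^2 < 32 s^2 2^n, which is the origin of the constant 32.\<close>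
  obtain n where n: "4 * s * sqrt 2 ^ n \<le> t" "t < 4 * s * sqrt 2 ^ Suc n"
  proof -
    obtain k0 where "t / (4 * s) < sqrt 2 ^ k0" using real_arch_pow[of "sqrt 2"] by auto
    then have ex: "t < 4 * s * sqrt 2 ^ k0" using s(1) by (simp add: divide_less_eq mult.commute)
    define k where "k = (LEAST k. t < 4 * s * sqrt 2 ^ k)"
    have k: "t < 4 * s * sqrt 2 ^ k" unfolding k_def using ex by (rule LeastI)
    have "k \<noteq> 0" using k t by (intro notI) simp
    then obtain l where l: "k = Suc l" by (cases k) auto
    have "\<not> t < 4 * s * sqrt 2 ^ l" using not_less_Least[of l "\<lambda>k. t < 4 * s * sqrt 2 ^ k"] l by (simp add: k_def)
    then show ?thesis using that[of l] k l by simp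
  qed
  have "b t \<le> b (T n)"
    unfolding b_def
  proof (intro finite_measure_mono m subsetI)
    fix x assume "x \<in> {x\<in>space M. \<exists>j\<in>J. \<bar>U j x\<bar> > t}"
    then obtain j where "x \<in> space M" "j \<in> J" "\<bar>U j x\<bar> > t" by blast
    moreover from this have "\<bar>U j x\<bar> > T n" using T_le[of n] n(1) by linarith
    ultimately show "x \<in> {x\<in>space M. \<exists>j\<in>J. \<bar>U j x\<bar> > T n}" by blast
  qed
  also have "\<dots> \<le> 1 * (1 / 3) ^ (2 ^ n)"
    by (rule order_trans[OF decay mult_right_mono[OF a(2)]]) simp
  also have "\<dots> \<le> exp (-1) ^ (2 ^ n)"
  proof -
    have "1 / 3 \<le> exp (-1 :: real)" using exp_le by (simp add: exp_minus field_simps)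
    then show ?thesis by (simp add: power_mono)
  qed
  also have "\<dots> = exp (- (2 ^ n))" by (simp add: exp_of_nat_mult[symmetric])
  also have "\<dots> \<le> exp (- t\<^sup>2 / (32 * s^2))"
  proof -
    have "t\<^sup>2 \<le> (4 * s * sqrt 2 ^ Suc n)^2" using n t s by (intro power_mono) auto
    also have "\<dots> = 32 * s^2 * 2 ^ n"
      by (simp add: power_mult_distrib power_mult[symmetric] mult.commute[of _ 2] power_mult del: power_Suc)
         (simp add: power_mult)
    finally show ?thesis using s(1) by (simp add: divide_le_eq mult.commute)
  qed
  finally show ?thesis by (simp add: b_def)
qed

section \<open>Reduction of uncountable families of open events to finite ones\<close>

lemma countable_open_subcover:
  fixes U :: "'i \<Rightarrow> 'b::second_countable_topology set"
  assumes "\<And>i. i \<in> I \<Longrightarrow> open (U i)"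
  obtains C where "countable C" "C \<subseteq> I" "\<forall>x. (\<exists>i\<in>I. x \<in> U i) \<longleftrightarrow> (\<exists>i\<in>C. x \<in> U i)"
proof -
  obtain F where "F \<subseteq> U ` I" "countable F" and F: "\<Union>F = \<Union>(U ` I)"
    using Lindelof[of "U ` I"] assms by blast
  then obtain C where "countable C" "C \<subseteq> I" "F = U ` C"
    by (metis countable_subset_image)
  moreover from this have "(\<exists>i\<in>I. x \<in> U i) \<longleftrightarrow> (\<exists>i\<in>C. x \<in> U i)" for x
    using F by (metis UN_iff)
  ultimately show ?thesis using that by blast
qed

text \<open>By Lindelof the union is a countable one, and continuity from below reduces it to finite
  unions. This extends bounds on finite suprema to the norm and the oscillation, which are suprema
  over uncountably many evaluations.\<close>

lemma (in finite_measure) measure_Union_open_le: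
  fixes Z :: "'a \<Rightarrow> 'b::second_countable_topology"
  assumes [measurable]: "Z \<in> borel_measurable M"
    and U: "\<And>i. i \<in> I \<Longrightarrow> open (U i)"
    and b: "\<And>K. finite K \<Longrightarrow> K \<subseteq> I \<Longrightarrow> measure M {x\<in>space M. \<exists>i\<in>K. Z x \<in> U i} \<le> b"
  shows "measure M {x\<in>space M. \<exists>i\<in>I. Z x \<in> U i} \<le> b"
proof -
  obtain C where C: "countable C" "C \<subseteq> I" "\<forall>x. (\<exists>i\<in>I. x \<in> U i) \<longleftrightarrow> (\<exists>i\<in>C. x \<in> U i)"
    by (rule countable_open_subcover[of I U, OF U])
  show ?thesis
  proof (cases "C = {}")
    case True
    then show ?thesis using b[of "{}"] C(3) by simp
  next
    case False
    define B where "B n = {x\<in>space M. \<exists>i\<in>from_nat_into C ` {..n}. Z x \<in> U i}" for n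
    have sub: "from_nat_into C ` {..n} \<subseteq> I" for n
      using from_nat_into[OF False] C(2) by blast
    have Bm: "B n \<in> sets M" for n
    proof -
      have "{x\<in>space M. Z x \<in> U i} \<in> sets M" if "i \<in> I" for i
        using measurable_sets[OF assms(1) borel_open[OF U[OF that]]]
        by (simp add: vimage_def Int_def conj_commute)
      then show ?thesis unfolding B_def using sub by (intro sets.sets_Collect_finite_Ex) auto
    qed
    have "(\<lambda>n. measure M (B n)) \<longlonglongrightarrow> measure M (\<Union>n. B n)"
      using Bm by (intro finite_Lim_measure_incseq) (auto simp: incseq_def B_def)
    moreover have "measure M (B n) \<le> b" for n unfolding B_def using sub by (intro b) auto
    ultimately have "measure M (\<Union>n. B n) \<le> b" by (intro LIMSEQ_le_const2) auto
    moreover have "(\<Union>n. B n) = {x\<in>space M. \<exists>i\<in>I. Z x \<in> U i}"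
    proof -
      have "(\<exists>i\<in>C. Z x \<in> U i) \<longleftrightarrow> (\<exists>n. \<exists>i\<in>from_nat_into C ` {..n}. Z x \<in> U i)" for x
        using range_from_nat_into[OF False C(1)] by (metis atMost_iff image_eqI imageE le_refl rangeE rangeI)
      then show ?thesis unfolding C(3)[rule_format] B_def by blast
    qed
    ultimately show ?thesis by simp
  qed
qed

lemma continuous_on_eval:
  "continuous_on UNIV (\<lambda>f :: 'a::topological_space \<Rightarrow>\<^sub>C 'b::metric_space. apply_bcontfun f s)"
  unfolding continuous_on_iff by (metis UNIV_I dist_bounded le_less_trans)

lemma open_eval: "open S \<Longrightarrow> open {f :: 'a::topological_space \<Rightarrow>\<^sub>C 'b::metric_space. apply_bcontfun f s \<in> S}"
  by (rule open_vimage[of S "\<lambda>f. apply_bcontfun f s", unfolded vimage_def])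
     (auto intro: continuous_on_eval)

text \<open>A closed ball is an intersection of conditions on single values, of which countably many
  suffice by Lindelof; an open set is a countable union of closed balls.\<close>

lemma borel_measurable_bcontfunI:
  fixes W :: "'w \<Rightarrow> ('a::compact_metric_space \<Rightarrow>\<^sub>C real)"
  assumes W[measurable]: "\<And>s. (\<lambda>x. apply_bcontfun (W x) s) \<in> borel_measurable M"
  shows "W \<in> borel_measurable M"
proof (rule borel_measurableI)
  fix S :: "('a \<Rightarrow>\<^sub>C real) set" assume S: "open S"
  have cb: "{x\<in>space M. W x \<in> cball f r} \<in> sets M" for f r
  proof -
    define U where "U s = {h :: 'a \<Rightarrow>\<^sub>C real. r < \<bar>apply_bcontfun h s - apply_bcontfun f s\<bar>}" for s
    have "open (U s)" for s
      using open_eval[of "{y. r < \<bar>y - apply_bcontfun f s\<bar>}" s]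
      unfolding U_def by (simp add: open_Collect_less continuous_intros)
    then obtain C where C: "countable C" "\<forall>x. (\<exists>i\<in>UNIV. x \<in> U i) \<longleftrightarrow> (\<exists>i\<in>C. x \<in> U i)"
      by (rule countable_open_subcover[of UNIV U]) blast
    have [measurable]: "{x\<in>space M. \<exists>i\<in>C. W x \<in> U i} \<in> sets M"
      unfolding U_def mem_Collect_eq using C(1) by measurable
    have "W x \<in> cball f r \<longleftrightarrow> \<not> (\<exists>i\<in>C. W x \<in> U i)" for x
      unfolding C(2)[rule_format, symmetric] unfolding U_def
      by (auto simp: not_less dist_real_def dist_commute abs_minus_commute intro!: dist_bound
          intro: order_trans[OF dist_bounded, of f "W x", unfolded dist_real_def])
    then have "{x\<in>space M. W x \<in> cball f r} = space M - {x\<in>space M. \<exists>i\<in>C. W x \<in> U i}" by auto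
    then show ?thesis by simp
  qed
  have "\<exists>r>0. cball h r \<subseteq> S" if "h \<in> S" for h using S that open_contains_cball by blast
  then obtain r where r: "\<And>h. h \<in> S \<Longrightarrow> 0 < r h" "\<And>h. h \<in> S \<Longrightarrow> cball h (r h) \<subseteq> S" by metis
  obtain C where C: "countable C" "C \<subseteq> S" "\<forall>y. (\<exists>h\<in>S. y \<in> ball h (r h)) \<longleftrightarrow> (\<exists>h\<in>C. y \<in> ball h (r h))"
    by (rule countable_open_subcover[of S "\<lambda>h. ball h (r h)"]) (rule open_ball)
  have "S = (\<Union>h\<in>C. cball h (r h))"
  proof
    show "S \<subseteq> (\<Union>h\<in>C. cball h (r h))"
    proof
      fix y assume "y \<in> S"
      then have "\<exists>h\<in>S. y \<in> ball h (r h)" using r(1) by (intro bexI[of _ y]) auto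
      then show "y \<in> (\<Union>h\<in>C. cball h (r h))" unfolding C(3)[rule_format] by force
    qed
  qed (use r C in blast)
  then have "W -` S \<inter> space M = (\<Union>h\<in>C. {x\<in>space M. W x \<in> cball h (r h)})" by auto
  then show "W -` S \<inter> space M \<in> sets M" using cb C(1) by (auto intro!: sets.countable_UN')
qed

section \<open>Riesz representation in \<open>L\<^sup>2\<close>\<close>

lemma LIMSEQ_ex_less: "X \<longlonglongrightarrow> a \<Longrightarrow> a < b \<Longrightarrow> \<exists>n. X n < (b :: real)"
  using eventually_happens'[OF sequentially_bot order_tendstoD(2)] by blast

context prob_space begin

lemma square_integrable_mult_integrable:
  assumes "square_integrable M u" "square_integrable M v"
  shows "integrable M (\<lambda>x. u x * v x)"
proof (rule Bochner_Integration.integrable_bound[where f="\<lambda>x. (u x)^2 + (v x)^2"])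
  show "AE x in M. norm (u x * v x) \<le> norm ((u x)^2 + (v x)^2)"
  proof (rule AE_I2)
    fix x
    have "2 * \<bar>u x * v x\<bar> \<le> (u x)^2 + (v x)^2"
      using sum_squares_bound[of "\<bar>u x\<bar>" "\<bar>v x\<bar>"] by (simp add: abs_mult mult.assoc)
    then show "norm (u x * v x) \<le> norm ((u x)^2 + (v x)^2)" by simp
  qed
qed (use assms in \<open>auto simp: square_integrable_def\<close>)

lemma square_integrable_integrable:
  assumes "square_integrable M u"
  shows "integrable M u"
  using square_integrable_mult_integrable[OF assms, of "\<lambda>_. 1"] by (simp add: square_integrable_def)

lemma square_integrable_lincomb:
  assumes u: "square_integrable M u" and v: "square_integrable M v"
  shows "square_integrable M (\<lambda>x. u x + k * v x)"
    and "(LINT x|M. (u x + k * v x)^2) =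
      (LINT x|M. (u x)^2) + 2 * k * (LINT x|M. u x * v x) + k^2 * (LINT x|M. (v x)^2)"
proof -
  have e: "(u x + k * v x)^2 = (u x)^2 + 2 * k * (u x * v x) + k^2 * (v x)^2" for x
    by (simp add: power2_eq_square algebra_simps)
  have i: "integrable M (\<lambda>x. (u x)^2)" "integrable M (\<lambda>x. (v x)^2)"
    "integrable M (\<lambda>x. u x * v x)"
    using u v square_integrable_mult_integrable[OF u v] by (auto simp: square_integrable_def)
  show "square_integrable M (\<lambda>x. u x + k * v x)"
    unfolding square_integrable_def e using u v i by (auto simp: square_integrable_def)
  show "(LINT x|M. (u x + k * v x)^2) =
      (LINT x|M. (u x)^2) + 2 * k * (LINT x|M. u x * v x) + k^2 * (LINT x|M. (v x)^2)"
    unfolding e using i by simp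
qed

text \<open>The squared norm of u + k v is nonnegative for every k. The choice k = -B / C minimises
  it; for C = 0 it is affine in k, which forces B = 0.\<close>

lemma L2_Cauchy_Schwarz:
  assumes u: "square_integrable M u" and v: "square_integrable M v"
  shows "(LINT x|M. u x * v x)^2 \<le> (LINT x|M. (u x)^2) * (LINT x|M. (v x)^2)"
    (is "?B\<^sup>2 \<le> ?A * ?C")
proof -
  have q: "0 \<le> ?A + 2 * k * ?B + k^2 * ?C" for k
    unfolding square_integrable_lincomb(2)[OF u v, symmetric] by simp
  have C: "0 \<le> ?C" by simp
  show ?thesis
  proof (cases "?C = 0")
    case True
    have "?B = 0"
    proof (rule ccontr)
      assume "?B \<noteq> 0"
      then show False using q[of "- (?A + 1) / (2 * ?B)"] True by (simp add: field_simps)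
    qed
    then show ?thesis using True by simp
  next
    case False
    then have "0 < ?C" using C by linarith
    moreover have "?A + 2 * (- ?B / ?C) * ?B + (- ?B / ?C)^2 * ?C = (?A * ?C - ?B\<^sup>2) / ?C"
      using False by (simp add: field_simps power2_eq_square)
    ultimately show ?thesis using q[of "- ?B / ?C"] by (simp add: zero_le_divide_iff)
  qed
qed

lemma L2_norm_of_nonneg: "0 \<le> L2_norm_of M u"
  by (simp add: L2_norm_of_def)

lemma L2_norm_of_power2: "(L2_norm_of M u)^2 = (LINT x|M. (u x)^2)"
  by (simp add: L2_norm_of_def)

lemma L2_abs_inner_le:
  assumes u: "square_integrable M u" and v: "square_integrable M v"
  shows "\<bar>LINT x|M. u x * v x\<bar> \<le> L2_norm_of M u * L2_norm_of M v"
  using real_sqrt_le_mono[OF L2_Cauchy_Schwarz[OF u v]]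
  by (simp add: L2_norm_of_def real_sqrt_mult)

text \<open>Riesz-Fischer: a fast subsequence has absolutely summable increments almost surely,
  hence a pointwise limit, and Fatou's lemma carries the Cauchy estimate over to that limit.\<close>

lemma L2_Cauchy_convergent:
  fixes v :: "nat \<Rightarrow> 'a \<Rightarrow> real"
  assumes v: "\<And>n. square_integrable M (v n)"
    and C: "\<And>e. e > 0 \<Longrightarrow> \<exists>N. \<forall>m\<ge>N. \<forall>n\<ge>N. (LINT x|M. (v m x - v n x)^2) < e"
  obtains \<xi> where "square_integrable M \<xi>" "(\<lambda>n. LINT x|M. (\<xi> x - v n x)^2) \<longlonglongrightarrow> 0"
proof -
  have [measurable]: "v n \<in> borel_measurable M" for n using v by (simp add: square_integrable_def)
  have d: "square_integrable M (\<lambda>x. v m x - v n x)" for m n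
    using square_integrable_lincomb(1)[OF v v, of m "-1" n] by simp
  \<comment> \<open>A squared distance below (1/4)^k gives an L1 distance of at most (1/2)^k by
    Cauchy-Schwarz against the constant 1, which is summable in k.\<close>
  have "\<exists>N. \<forall>m\<ge>N. \<forall>n\<ge>N. (LINT x|M. (v m x - v n x)^2) < (1 / 4) ^ k" for k :: nat
    by (rule C) simp
  then obtain N where N: "\<And>k m n. N k \<le> m \<Longrightarrow> N k \<le> n \<Longrightarrow> (LINT x|M. (v m x - v n x)^2) < (1 / 4) ^ k"
    by metis
  \<comment> \<open>Partial sums turn the thresholds \<open>N k\<close> into increasing indices; the
    summand 1 ensures that \<open>r k\<close> is at least k, so the subsequence passes every
    index.\<close>
  define r where "r k = (\<Sum>i\<le>k. N i + 1)" for k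
  have r: "N k \<le> r k" "r k \<le> r (Suc k)" "k \<le> r k" for k
  proof -
    show "N k \<le> r k" unfolding r_def by (rule order_trans[OF _ member_le_sum[of k]]) auto
    show "r k \<le> r (Suc k)" by (simp add: r_def)
    have "(\<Sum>i\<le>k. 1) \<le> (\<Sum>i\<le>k. N i + 1)" by (rule sum_mono) auto
    then show "k \<le> r k" by (simp add: r_def)
  qed
  define D where "D k x = \<bar>v (r (Suc k)) x - v (r k) x\<bar>" for k x
  have D0: "0 \<le> D k x" for k x by (simp add: D_def)
  have D: "square_integrable M (D k)" for k
    using d[of "r (Suc k)" "r k"] by (simp add: square_integrable_def D_def[abs_def])
  then have [measurable]: "D k \<in> borel_measurable M" for k by (simp add: square_integrable_def)
  have E: "(\<integral>\<^sup>+x. ennreal (D k x) \<partial>M) \<le> ennreal ((1 / 2) ^ k)" for k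
  proof -
    have "(LINT x|M. D k x * 1)^2 \<le> (LINT x|M. (D k x)^2) * (LINT x|M. 1\<^sup>2)"
      using D by (intro L2_Cauchy_Schwarz) (auto simp: square_integrable_def)
    also have "\<dots> \<le> (1 / 4) ^ k"
      using less_imp_le[OF N[OF order_trans[OF r(1,2)] r(1)], of k] by (simp add: prob_space D_def)
    also have "(1 / 4) ^ k = ((1 / 2) ^ k :: real)^2" by (simp add: power2_eq_square flip: power_mult_distrib)
    finally have "(LINT x|M. D k x)^2 \<le> ((1 / 2) ^ k)^2"
      unfolding mult_1_right .
    then have "(LINT x|M. D k x) \<le> (1 / 2) ^ k"
      by (rule power2_le_imp_le) simp
    then show ?thesis by (subst nn_integral_eq_integral[OF square_integrable_integrable[OF D]]) (auto simp: D0 intro!: ennreal_leI)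
  qed
  have "(\<integral>\<^sup>+x. (\<Sum>k. ennreal (D k x)) \<partial>M) =
    (\<Sum>k. \<integral>\<^sup>+x. ennreal (D k x) \<partial>M)"
    by (intro nn_integral_suminf) auto
  also have "\<dots> \<le> (\<Sum>k. ennreal ((1 / 2) ^ k))"
    by (intro suminf_le E) auto
  also have "\<dots> = ennreal (\<Sum>k. (1 / 2) ^ k)" by (intro suminf_ennreal2 summable_geometric) auto
  finally have "(\<integral>\<^sup>+x. (\<Sum>k. ennreal (D k x)) \<partial>M) \<noteq> \<infinity>"
    unfolding infinity_ennreal_def by (rule neq_top_trans[OF ennreal_neq_top])
  then have "AE x in M. (\<Sum>k. ennreal (D k x)) \<noteq> \<infinity>"
    by (intro nn_integral_noteq_infinite) auto
  then have conv: "AE x in M. (\<lambda>k. v (r k) x) \<longlonglongrightarrow> lim (\<lambda>k. v (r k) x)"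
  proof eventually_elim
    case (elim x)
    then have "summable (\<lambda>k. D k x)"
      by (intro summable_suminf_not_top) (auto simp: D_def)
    then have "summable (\<lambda>k. v (r (Suc k)) x - v (r k) x)" unfolding D_def by (rule summable_rabs_cancel)
    then have "convergent (\<lambda>n. \<Sum>k<n. v (r (Suc k)) x - v (r k) x)" by (simp add: summable_iff_convergent)
    then have "convergent (\<lambda>n. v (r n) x - v (r 0) x)"
      by (simp add: sum_lessThan_telescope[of "\<lambda>k. v (r k) x"])
    then have "convergent (\<lambda>n. v (r n) x)" by (simp add: convergent_diff_const_right_iff)
    then show ?case by (simp add: convergent_LIMSEQ_iff)
  qed
  define \<xi> where "\<xi> x = lim (\<lambda>k. v (r k) x)" for x
  have [measurable]: "\<xi> \<in> borel_measurable M" unfolding \<xi>_def by measurable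
  have F: "(\<integral>\<^sup>+x. ennreal ((\<xi> x - v n x)^2) \<partial>M) \<le> ennreal e"
    if e: "\<And>m n. K \<le> m \<Longrightarrow> K \<le> n \<Longrightarrow> (LINT x|M. (v m x - v n x)^2) \<le> e" and n: "K \<le> n" for e K n
  proof -
    \<comment> \<open>Almost sure convergence of the subsequence rewrites the integrand as a lower
      limit, the form in which Fatou's lemma applies.\<close>
    have "(\<integral>\<^sup>+x. ennreal ((\<xi> x - v n x)^2) \<partial>M) = (\<integral>\<^sup>+x. liminf (\<lambda>k. ennreal ((v (r k) x - v n x)^2)) \<partial>M)"
    proof (rule nn_integral_cong_AE, use conv in eventually_elim)
      case (elim x)
      then have "(\<lambda>k. ennreal ((v (r k) x - v n x)^2)) \<longlonglongrightarrow> ennreal ((\<xi> x - v n x)^2)"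
        unfolding \<xi>_def by (intro tendsto_intros)
      then show ?case by (rule sym[OF lim_imp_Liminf[OF sequentially_bot]])
    qed
    also have "\<dots> \<le> liminf (\<lambda>k. \<integral>\<^sup>+x. ennreal ((v (r k) x - v n x)^2) \<partial>M)"
      by (intro nn_integral_liminf) auto
    also have "\<dots> \<le> liminf (\<lambda>k. ennreal e)"
    proof (rule Liminf_mono)
      show "\<forall>\<^sub>F k in sequentially. (\<integral>\<^sup>+x. ennreal ((v (r k) x - v n x)^2) \<partial>M) \<le> ennreal e"
      proof (rule eventually_sequentiallyI[of K])
        fix k assume "K \<le> k"
        then have "K \<le> r k" using r(3)[of k] by simp
        then show "(\<integral>\<^sup>+x. ennreal ((v (r k) x - v n x)^2) \<partial>M) \<le> ennreal e"
          using d[of "r k" n] e n by (subst nn_integral_eq_integral) (auto simp: square_integrable_def intro!: ennreal_leI)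
      qed
    qed
    finally show ?thesis by (simp add: Liminf_const)
  qed
  have sqd: "square_integrable M (\<lambda>x. \<xi> x - v n x)" and Fd: "(LINT x|M. (\<xi> x - v n x)^2) \<le> e"
    if e: "\<And>m n. K \<le> m \<Longrightarrow> K \<le> n \<Longrightarrow> (LINT x|M. (v m x - v n x)^2) \<le> e" and n: "K \<le> n" for e K n
  proof -
    have e0: "0 \<le> e" using e[of K K] by simp
    show "square_integrable M (\<lambda>x. \<xi> x - v n x)"
      unfolding square_integrable_def
      using F[of K e n] that
      by (auto intro!: integrableI_nonneg intro: le_less_trans)
    then have "ennreal (LINT x|M. (\<xi> x - v n x)^2) \<le> ennreal e"
      using F[of K e n] that by (subst nn_integral_eq_integral[symmetric]) (auto simp: square_integrable_def)
    then show "(LINT x|M. (\<xi> x - v n x)^2) \<le> e" using e0 by simp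
  qed
  have "square_integrable M (\<lambda>x. \<xi> x - v (N 0) x)"
    using N[of 0] by (intro sqd[of "N 0" 1]) (auto intro: less_imp_le)
  from square_integrable_lincomb(1)[OF this v, of 1 "N 0"] have "square_integrable M \<xi>" by simp
  moreover have "(\<lambda>n. LINT x|M. (\<xi> x - v n x)^2) \<longlonglongrightarrow> 0"
  proof (rule LIMSEQ_I)
    fix e :: real assume "0 < e"
    then obtain K where K: "\<forall>m\<ge>K. \<forall>n\<ge>K. (LINT x|M. (v m x - v n x)^2) < e / 2" using C[of "e / 2"] by auto
    show "\<exists>no. \<forall>n\<ge>no. norm ((LINT x|M. (\<xi> x - v n x)^2) - 0) < e"
    proof (intro exI[of _ K] allI impI)
      fix n assume "K \<le> n"
      then have "(LINT x|M. (\<xi> x - v n x)^2) \<le> e / 2"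
        using K by (intro Fd[of K "e / 2"]) (auto intro: less_imp_le)
      then show "norm ((LINT x|M. (\<xi> x - v n x)^2) - 0) < e" using \<open>0 < e\<close> by simp
    qed
  qed
  ultimately show ?thesis using that by blast
qed

text \<open>A bounded linear functional is given by its graph \<open>G\<close>. The representing element is the limit
  of a minimizing sequence of \<open>\<parallel>v\<parallel>\<^sup>2 - 2 a\<close> over the pairs \<open>(v, a)\<close> in \<open>G\<close>.\<close>

lemma L2_Riesz_representation:
  fixes G :: "(('a \<Rightarrow> real) \<times> real) set"
  assumes r: "0 \<le> r" and zero: "((\<lambda>_. 0), 0) \<in> G"
    and lin: "\<And>v a w b k. (v, a) \<in> G \<Longrightarrow> (w, b) \<in> G \<Longrightarrow> (\<lambda>x. v x + k * w x, a + k * b) \<in> G"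
    and sq: "\<And>v a. (v, a) \<in> G \<Longrightarrow> square_integrable M v"
    and bnd: "\<And>v a. (v, a) \<in> G \<Longrightarrow> a \<le> r * L2_norm_of M v"
  obtains \<xi> where "square_integrable M \<xi>" "L2_norm_of M \<xi> \<le> r"
    "\<forall>(v, a)\<in>G. (LINT x|M. \<xi> x * v x) = a"
    "\<forall>\<delta>>0. \<exists>(v, a)\<in>G. L2_norm_of M (\<lambda>x. \<xi> x - v x) < \<delta>"
proof -
  define J where "J p = (LINT x|M. (fst p x)^2) - 2 * snd p" for p :: "('a \<Rightarrow> real) \<times> real"
  define m where "m = Inf (J ` G)"
  \<comment> \<open>From a \<le> r * norm v, J is at least (norm v - r)^2 - r^2, so the infimum is
    finite.\<close>
  have low: "- r\<^sup>2 \<le> J p" if "p \<in> G" for p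
  proof -
    have "snd p \<le> r * L2_norm_of M (fst p)" using bnd[of "fst p" "snd p"] that by simp
    moreover have "0 \<le> (L2_norm_of M (fst p) - r)^2" by simp
    ultimately show ?thesis
      by (simp add: J_def L2_norm_of_power2[symmetric] power2_diff algebra_simps)
  qed
  then have bb: "bdd_below (J ` G)" by (intro bdd_belowI2[of _ "- r\<^sup>2"])
  have mle: "m \<le> J p" if "p \<in> G" for p
    unfolding m_def using that bb by (intro cInf_lower) auto
  have "\<exists>p\<in>G. J p < m + 1 / Suc n" for n
  proof -
    have "J ` G \<noteq> {}" using zero by blast
    then have "\<exists>x\<in>J ` G. x < m + 1 / Suc n"
      unfolding m_def using bb by (subst cInf_less_iff[symmetric]) auto
    then show ?thesis by auto
  qed
  then obtain p where p: "\<And>n. p n \<in> G" "\<And>n. J (p n) < m + 1 / Suc n" by metis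
  define v where "v n = fst (p n)" for n
  define a where "a n = snd (p n)" for n
  have va: "(v n, a n) \<in> G" for n using p(1)[of n] by (simp add: v_def a_def)
  have Jva: "(LINT x|M. (v n x)^2) - 2 * a n < m + 1 / Suc n" for n
    using p(2)[of n] by (simp add: J_def v_def a_def)
  have vs: "square_integrable M (v n)" for n using sq[OF va] .
  have mle': "m \<le> (LINT x|M. (w x)^2) - 2 * b" if "(w, b) \<in> G" for w b
    using mle[OF that] by (simp add: J_def)
  \<comment> \<open>Midpoints remain in \<open>G\<close>, so J at the midpoint is at least m. The
    parallelogram law then bounds the squared distance by twice the sum of the two excesses over
    m.\<close>
  have par: "(LINT x|M. (v i x - v j x)^2) < 2 / Suc i + 2 / Suc j" for i j
  proof -
    have "(\<lambda>x. 0 + (1/2) * (v i x + 1 * v j x), 0 + (1/2) * (a i + 1 * a j)) \<in> G"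
      by (rule lin[OF zero lin[OF va va]])
    from mle'[OF this] have h: "m \<le> (LINT x|M. ((1/2) * (v i x + 1 * v j x))^2) - (a i + a j)" by (simp add: add_divide_distrib)
    have h2: "(LINT x|M. ((1/2) * (v i x + 1 * v j x))^2) = (1/4) * (LINT x|M. (v i x + 1 * v j x)^2)"
      by (simp add: power_mult_distrib power2_eq_square)
    have "(LINT x|M. (v i x + (-1) * v j x)^2) + (LINT x|M. (v i x + 1 * v j x)^2) =
        2 * (LINT x|M. (v i x)^2) + 2 * (LINT x|M. (v j x)^2)"
      unfolding square_integrable_lincomb(2)[OF vs vs] by simp
    then show ?thesis using h h2 Jva[of i] Jva[of j] by simp
  qed
  obtain \<xi> where \<xi>: "square_integrable M \<xi>" "(\<lambda>n. LINT x|M. (\<xi> x - v n x)^2) \<longlonglongrightarrow> 0"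
  proof (rule L2_Cauchy_convergent[of v])
    fix e :: real assume "0 < e"
    then obtain N where N: "1 / real (Suc N) < e / 4" using nat_approx_posE[of "e / 4"] by auto
    have "(LINT x|M. (v i x - v j x)^2) < e" if "N \<le> i" "N \<le> j" for i j
    proof -
      have "1 / real (Suc i) \<le> 1 / real (Suc N)" "1 / real (Suc j) \<le> 1 / real (Suc N)"
        using that by (auto intro!: divide_left_mono)
      then show ?thesis using par[of i j] N by simp
    qed
    then show "\<exists>N. \<forall>i\<ge>N. \<forall>j\<ge>N. (LINT x|M. (v i x - v j x)^2) < e" by blast
  qed (rule vs)
  have dsq: "square_integrable M (\<lambda>x. \<xi> x - v n x)" for n
    using square_integrable_lincomb(1)[OF \<xi>(1) vs, of "-1" n] by simp
  have inn: "(\<lambda>n. LINT x|M. v n x * w x) \<longlonglongrightarrow> (LINT x|M. \<xi> x * w x)" if w: "square_integrable M w" for w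
  proof -
    have "(\<lambda>n. LINT x|M. (\<xi> x - v n x) * w x) \<longlonglongrightarrow> 0"
    proof (rule Lim_null_comparison)
      show "\<forall>\<^sub>F n in sequentially. norm (LINT x|M. (\<xi> x - v n x) * w x) \<le> sqrt (LINT x|M. (\<xi> x - v n x)^2) * L2_norm_of M w"
        using L2_abs_inner_le[OF dsq w] by (simp add: L2_norm_of_def)
      show "(\<lambda>n. sqrt (LINT x|M. (\<xi> x - v n x)^2) * L2_norm_of M w) \<longlonglongrightarrow> 0"
        using tendsto_mult[OF tendsto_real_sqrt[OF \<xi>(2)] tendsto_const] by simp
    qed
    moreover have "(LINT x|M. (\<xi> x - v n x) * w x) = (LINT x|M. \<xi> x * w x) - (LINT x|M. v n x * w x)" for n
      using square_integrable_mult_integrable[OF \<xi>(1) w] square_integrable_mult_integrable[OF vs w]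
      by (simp add: left_diff_distrib)
    ultimately have "(\<lambda>n. (LINT x|M. \<xi> x * w x) - ((LINT x|M. \<xi> x * w x) - (LINT x|M. v n x * w x))) \<longlonglongrightarrow> (LINT x|M. \<xi> x * w x) - 0"
      by (intro tendsto_diff tendsto_const) simp
    then show ?thesis by simp
  qed
  have rep: "(LINT x|M. \<xi> x * w x) = b" if wb: "(w, b) \<in> G" for w b
  proof -
    define D where "D = (LINT x|M. \<xi> x * w x) - b"
    define Q where "Q = (LINT x|M. (w x)^2)"
    \<comment> \<open>First variation at the minimum: moving the minimizing sequence by k times (w,
      b) cannot bring J below m, and the excess 1 / Suc n vanishes in the limit.\<close>
    have key: "0 \<le> 2 * k * D + k^2 * Q" for k
    proof (rule LIMSEQ_le_const)
      show "(\<lambda>n. 1 / Suc n + 2 * k * ((LINT x|M. v n x * w x) - b) + k^2 * Q) \<longlonglongrightarrow> 2 * k * D + k^2 * Q"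
        unfolding D_def
        by (rule tendsto_eq_intros inn[OF sq[OF wb]] LIMSEQ_Suc[OF lim_1_over_n] refl)+ simp
      have "0 \<le> 1 / Suc n + 2 * k * ((LINT x|M. v n x * w x) - b) + k^2 * Q" for n
        using mle'[OF lin[OF va wb, of n k]] Jva[of n]
        unfolding square_integrable_lincomb(2)[OF vs sq[OF wb]] Q_def by (simp add: algebra_simps)
      then show "\<exists>N. \<forall>n\<ge>N. 0 \<le> 1 / Suc n + 2 * k * ((LINT x|M. v n x * w x) - b) + k^2 * Q" by blast
    qed
    have "0 \<le> Q" by (simp add: Q_def)
    \<comment> \<open>The multiplier is the minimizer with Q enlarged to Q + 1, which also covers Q
      = 0.\<close>
    then have "0 \<le> 2 * (- D / (Q + 1)) * D + (- D / (Q + 1))^2 * (Q + 1)"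
      using key[of "- D / (Q + 1)"] mult_left_mono[of Q "Q + 1" "(- D / (Q + 1))^2"]
      by (meson add_left_mono le_add_same_cancel1 order_trans zero_le_one zero_le_power2)
    also have "\<dots> = - (D^2 / (Q + 1))"
      using \<open>0 \<le> Q\<close> by (simp add: power2_eq_square divide_simps)
    finally have "D\<^sup>2 / (Q + 1) \<le> 0" by simp
    then have "D = 0" using \<open>0 \<le> Q\<close> by (simp add: divide_le_0_iff)
    then show ?thesis by (simp add: D_def)
  qed
  \<comment> \<open>The inner products of \<xi> with v n equal a n and so are at most r * norm (v
    n). In the limit the square of the norm of \<xi> is at most r times that norm.\<close>
  have lim: "(LINT x|M. (\<xi> x)^2) \<le> r * L2_norm_of M \<xi>"
  proof (rule LIMSEQ_le)
    show "(\<lambda>n. LINT x|M. \<xi> x * v n x) \<longlonglongrightarrow> (LINT x|M. (\<xi> x)^2)"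
      using inn[OF \<xi>(1)] by (simp add: mult.commute power2_eq_square)
    have "(\<lambda>n. (LINT x|M. (\<xi> x)^2) + 2 * (-1) * (LINT x|M. \<xi> x * (\<xi> x - v n x)) + (-1)^2 * (LINT x|M. (\<xi> x - v n x)^2))
      \<longlonglongrightarrow> (LINT x|M. (\<xi> x)^2) + 2 * (-1) * ((LINT x|M. \<xi> x * \<xi> x) - (LINT x|M. \<xi> x * \<xi> x)) + (-1)^2 * 0"
    proof (intro tendsto_intros \<xi>(2))
      have "(\<lambda>n. (LINT x|M. \<xi> x * \<xi> x) - (LINT x|M. v n x * \<xi> x)) \<longlonglongrightarrow> (LINT x|M. \<xi> x * \<xi> x) - (LINT x|M. \<xi> x * \<xi> x)"
        by (intro tendsto_intros inn \<xi>(1))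
      then show "(\<lambda>n. LINT x|M. \<xi> x * (\<xi> x - v n x)) \<longlonglongrightarrow> (LINT x|M. \<xi> x * \<xi> x) - (LINT x|M. \<xi> x * \<xi> x)"
        using square_integrable_mult_integrable[OF \<xi>(1) \<xi>(1)] square_integrable_mult_integrable[OF \<xi>(1) vs]
        by (simp add: right_diff_distrib mult.commute)
    qed
    then have "(\<lambda>n. LINT x|M. (v n x)^2) \<longlonglongrightarrow> (LINT x|M. (\<xi> x)^2)"
      unfolding square_integrable_lincomb(2)[OF \<xi>(1) dsq, symmetric] by simp
    then show "(\<lambda>n. r * L2_norm_of M (v n)) \<longlonglongrightarrow> r * L2_norm_of M \<xi>"
      unfolding L2_norm_of_def by (intro tendsto_intros)
    show "\<exists>N. \<forall>n\<ge>N. (LINT x|M. \<xi> x * v n x) \<le> r * L2_norm_of M (v n)"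
      using rep[OF va] bnd[OF va] by simp
  qed
  have "L2_norm_of M \<xi> \<le> r"
  proof (cases "L2_norm_of M \<xi> = 0")
    case False
    then have "0 < L2_norm_of M \<xi>" using L2_norm_of_nonneg[of \<xi>] by linarith
    then show ?thesis
      using lim unfolding L2_norm_of_power2[symmetric] power2_eq_square[of "L2_norm_of M \<xi>"]
      by (simp add: mult_le_cancel_right)
  qed (use r in simp)
  moreover have "\<exists>(w, b)\<in>G. L2_norm_of M (\<lambda>x. \<xi> x - w x) < \<delta>" if "\<delta> > 0" for \<delta>
  proof -
    have "0 < \<delta>^2" using that by simp
    then obtain n where "(LINT x|M. (\<xi> x - v n x)^2) < \<delta>^2"
      using LIMSEQ_ex_less[OF \<xi>(2)] by blast
    then have "L2_norm_of M (\<lambda>x. \<xi> x - v n x) < \<delta>"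
      unfolding L2_norm_of_def using that by (simp add: real_less_lsqrt)
    then show ?thesis using va[of n] by blast
  qed
  ultimately show ?thesis using that[of \<xi>] \<xi>(1) rep by blast
qed

end

section \<open>Weak limits of Gaussian laws\<close>

lemma (in prob_space) trig_integrable:
  fixes V :: "'a \<Rightarrow> real"
  assumes [measurable]: "V \<in> borel_measurable M"
  shows "integrable M (\<lambda>x. cos (V x))" "integrable M (\<lambda>x. sin (V x))"
  by (auto intro!: integrable_const_bound[where B=1])

lemma (in prob_space) integral_iexp_cos_sin:
  fixes V :: "'a \<Rightarrow> real"
  assumes [measurable]: "V \<in> borel_measurable M"
  shows "(CLINT x|M. iexp (V x)) = Complex (LINT x|M. cos (V x)) (LINT x|M. sin (V x))"
proof -
  have "iexp (V x) = complex_of_real (cos (V x)) + \<i> * complex_of_real (sin (V x))" for x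
    by (simp add: exp_Euler cos_of_real sin_of_real)
  then have "(CLINT x|M. iexp (V x)) = (CLINT x|M. complex_of_real (cos (V x))) + (CLINT x|M. \<i> * complex_of_real (sin (V x)))"
    using trig_integrable[OF assms] by (simp add: Bochner_Integration.integral_add)
  then show ?thesis by (simp add: complex_eq_iff)
qed

lemma (in prob_space) centered_gaussian_cos_sin:
  assumes "centered_gaussian M V"
  shows "(LINT x|M. cos (V x)) = exp (- (LINT x|M. (V x)^2) / 2)" "(LINT x|M. sin (V x)) = 0"
proof -
  have "V \<in> borel_measurable M" using assms by (simp add: centered_gaussian_def)
  from integral_iexp_cos_sin[OF this] centered_gaussian_char[OF assms]
  have "Complex (LINT x|M. cos (V x)) (LINT x|M. sin (V x)) = exp (- (LINT x|M. (V x)^2) / 2)"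
    by simp
  then show "(LINT x|M. cos (V x)) = exp (- (LINT x|M. (V x)^2) / 2)" "(LINT x|M. sin (V x)) = 0"
    by (simp_all add: complex_eq_iff)
qed

text \<open>Convergence in law does not by itself give convergence of second moments. For Gaussian
  variables the variance is a logarithm of E cos (\<theta> V), which does converge. Cosine and sine
  are the real bounded continuous test functions that make up the characteristic function.\<close>

lemma gaussian_weak_limit:
  fixes V :: "'i \<Rightarrow> 'w \<Rightarrow> real" and V0 :: "'v \<Rightarrow> real"
  assumes "prob_space M" "prob_space N" and F: "F \<noteq> bot"
    and G: "\<And>\<theta>. \<forall>\<^sub>F i in F. centered_gaussian M (\<lambda>x. \<theta> * V i x)"
    and V0[measurable]: "V0 \<in> borel_measurable N"
    and cos: "\<And>\<theta>. ((\<lambda>i. LINT x|M. cos (\<theta> * V i x)) \<longlongrightarrow> (LINT x|N. cos (\<theta> * V0 x))) F"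
    and sin: "\<And>\<theta>. ((\<lambda>i. LINT x|M. sin (\<theta> * V i x)) \<longlongrightarrow> (LINT x|N. sin (\<theta> * V0 x))) F"
  shows "centered_gaussian N V0" and "((\<lambda>i. LINT x|M. (V i x)^2) \<longlongrightarrow> (LINT x|N. (V0 x)^2)) F"
proof -
  interpret M: prob_space M by fact
  interpret N: prob_space N by fact
  define L where "L = distr N borel V0"
  interpret L: real_distribution L
    unfolding L_def by (rule N.real_distribution_distr) simp
  define q where "q i = (LINT x|M. (V i x)^2)" for i
  have E: "\<forall>\<^sub>F i in F. (LINT x|M. cos (\<theta> * V i x)) = exp (- (\<theta>\<^sup>2 * q i) / 2)"
    "\<forall>\<^sub>F i in F. (LINT x|M. sin (\<theta> * V i x)) = 0" for \<theta>
    by (use G[of \<theta>] in eventually_elim,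
        use M.centered_gaussian_cos_sin in \<open>simp add: q_def power_mult_distrib\<close>)+
  have sin0: "(LINT x|N. sin (\<theta> * V0 x)) = 0" for \<theta>
    using tendsto_unique[OF F tendsto_cong[THEN iffD1, OF E(2) sin] tendsto_const[of 0]] by simp
  have charL: "char L \<theta> = complex_of_real (LINT x|N. cos (\<theta> * V0 x))" for \<theta>
    using N.integral_iexp_cos_sin[of "\<lambda>x. \<theta> * V0 x"] sin0
    by (simp add: L_def char_def integral_distr complex_eq_iff)
  \<comment> \<open>The logarithm needs one nonzero frequency at which the limit is positive. It
    exists because the limiting characteristic function is continuous with value 1 at 0.\<close>
  obtain \<theta>0 where \<theta>0: "\<theta>0 \<noteq> 0" "0 < (LINT x|N. cos (\<theta>0 * V0 x))"
  proof -
    have "((\<lambda>\<theta>. Re (char L \<theta>)) \<longlongrightarrow> Re (char L 0)) (at 0)"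
      using L.isCont_char[of 0] by (intro tendsto_Re) (simp add: isCont_def)
    moreover have "0 < Re (char L 0)" by (simp add: L.char_zero)
    ultimately have "\<forall>\<^sub>F \<theta> in at 0. 0 < Re (char L \<theta>)" by (rule order_tendstoD)
    then have "\<forall>\<^sub>F \<theta> in at 0. \<theta> \<noteq> 0 \<and> 0 < Re (char L \<theta>)"
      using eventually_neq_at_within[of 0 0 UNIV] by eventually_elim simp
    then obtain \<theta> where "\<theta> \<noteq> 0" "0 < Re (char L \<theta>)" using eventually_happens'[OF at_neq_bot] by blast
    then show ?thesis using that[of \<theta>] by (simp add: charL)
  qed
  define v where "v = - 2 * ln (LINT x|N. cos (\<theta>0 * V0 x)) / \<theta>0\<^sup>2"
  have q: "(q \<longlongrightarrow> v) F"
  proof (rule tendsto_cong[THEN iffD1])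
    show "((\<lambda>i. - 2 * ln (LINT x|M. cos (\<theta>0 * V i x)) / \<theta>0\<^sup>2) \<longlongrightarrow> v) F"
      unfolding v_def using \<theta>0 by (intro tendsto_intros cos) auto
    show "\<forall>\<^sub>F i in F. - 2 * ln (LINT x|M. cos (\<theta>0 * V i x)) / \<theta>0\<^sup>2 = q i"
      using E(1)[of \<theta>0] by eventually_elim (use \<theta>0 in simp)
  qed
  have v0: "0 \<le> v"
    by (rule tendsto_lowerbound[OF q _ F]) (simp add: q_def)
  have cosN: "(LINT x|N. cos (\<theta> * V0 x)) = exp (- (\<theta>\<^sup>2 * v) / 2)" for \<theta>
  proof (rule tendsto_unique[OF F tendsto_cong[THEN iffD1, OF E(1) cos]])
    show "((\<lambda>i. exp (- (\<theta>\<^sup>2 * q i) / 2)) \<longlongrightarrow> exp (- (\<theta>\<^sup>2 * v) / 2)) F"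
      by (intro tendsto_intros q) auto
  qed
  have "L = distr std_normal_distribution borel (\<lambda>x. sqrt v * x)"
  proof (rule Levy_uniqueness)
    show "real_distribution L" ..
    show "real_distribution (distr std_normal_distribution borel (\<lambda>x. sqrt v * x))"
      by (rule std_normal.real_distribution_distr) simp
    show "char L = char (distr std_normal_distribution borel (\<lambda>x. sqrt v * x))"
    proof
      fix \<theta>
      have "char (distr std_normal_distribution borel (\<lambda>x. sqrt v * x)) \<theta> = char std_normal_distribution (\<theta> * sqrt v)"
        by (simp add: char_def integral_distr mult.assoc)
      also have "\<dots> = exp (- (\<theta>\<^sup>2 * v) / 2)"
        using v0 by (simp add: char_std_normal_distribution power_mult_distrib)
      finally show "char L \<theta> = char (distr std_normal_distribution borel (\<lambda>x. sqrt v * x)) \<theta>"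
        by (simp add: charL cosN)
    qed
  qed
  then show g: "centered_gaussian N V0"
    using v0 by (intro N.centered_gaussianI_distr[of V0 "sqrt v"]) (auto simp: L_def)
  have "exp (- (LINT x|N. (V0 x)^2) / 2) = exp (- (1\<^sup>2 * v) / 2)"
    using N.centered_gaussian_cos_sin(1)[OF g] cosN[of 1] by simp
  then have "(LINT x|N. (V0 x)^2) = v" by simp
  then show "((\<lambda>i. LINT x|M. (V i x)^2) \<longlongrightarrow> (LINT x|N. (V0 x)^2)) F"
    using q unfolding q_def[abs_def] by simp
qed

section \<open>Gaussian paths\<close>

abbreviation val :: "('a::topological_space \<Rightarrow>\<^sub>C 'b::metric_space) \<Rightarrow> 'a \<Rightarrow> 'b"
  where "val \<equiv> apply_bcontfun"

text \<open>These functionals replace the dual of the path space: single evaluations determine a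
  path, and any finite number of sums can be written over a common grid.\<close>

definition eval_sum :: "'a set \<Rightarrow> ('a \<Rightarrow> real) \<Rightarrow> ('a::metric_space \<Rightarrow>\<^sub>C real) \<Rightarrow> real"
  where "eval_sum T c f = (\<Sum>s\<in>T. c s * val f s)"

definition gaussian_path :: "'w measure \<Rightarrow> ('w \<Rightarrow> 'a::compact_metric_space \<Rightarrow>\<^sub>C real) \<Rightarrow> bool"
  where "gaussian_path M W \<longleftrightarrow> W \<in> borel_measurable M \<and>
    (\<forall>T c. finite T \<longrightarrow> centered_gaussian M (\<lambda>x. eval_sum T c (W x)))"

text \<open>The modulus of continuity at mesh r. For r > 0 the diagonal pairs belong to the index
  set, which keeps the supremum over a nonempty set.\<close>

definition osc :: "real \<Rightarrow> ('a::metric_space \<Rightarrow>\<^sub>C real) \<Rightarrow> real"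
  where "osc r f =
    (SUP p\<in>{(s, t). dist s t < r}. \<bar>val f (fst p) - val f (snd p)\<bar>)"

lemma continuous_on_eval_sum: "continuous_on UNIV (eval_sum T c)"
  unfolding eval_sum_def by (intro continuous_intros continuous_on_eval)

lemma eval_sum_measurable [measurable]: "eval_sum T c \<in> borel_measurable borel"
  by (rule borel_measurable_continuous_onI[OF continuous_on_eval_sum])

lemma bcontfun_eval_measurable [measurable]:
  "(\<lambda>f :: 'a::metric_space \<Rightarrow>\<^sub>C real. val f s) \<in> borel_measurable borel"
  by (rule borel_measurable_continuous_onI[OF continuous_on_eval])

lemma eval_sum_scale: "eval_sum T (\<lambda>s. k * c s) f = k * eval_sum T c f"
  by (simp add: eval_sum_def sum_distrib_left mult.assoc)

lemma eval_sum_scaleR: "eval_sum T c (k *\<^sub>R f) = k * eval_sum T c f"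
  by (simp add: eval_sum_def sum_distrib_left mult_ac)

lemma eval_sum_add: "eval_sum T c f + eval_sum T d f = eval_sum T (\<lambda>s. c s + d s) f"
  by (simp add: eval_sum_def sum.distrib distrib_right)

lemma eval_sum_single: "finite T \<Longrightarrow> s \<in> T \<Longrightarrow> eval_sum T (\<lambda>u. if u = s then k else 0) f = k * val f s"
  by (simp add: eval_sum_def if_distrib[where f="\<lambda>x. x * _"] sum.delta cong: if_cong)

lemma eval_sum_extend:
  assumes "finite T'" "T \<subseteq> T'"
  shows "eval_sum T c f = eval_sum T' (\<lambda>s. if s \<in> T then c s else 0) f"
proof -
  have "eval_sum T' (\<lambda>s. if s \<in> T then c s else 0) f = (\<Sum>s\<in>T. (if s \<in> T then c s else 0) * val f s)"
    unfolding eval_sum_def using assms by (intro sum.mono_neutral_right) auto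
  then show ?thesis by (simp add: eval_sum_def)
qed

lemma abs_apply_le_norm: "\<bar>val f s\<bar> \<le> norm (f :: 'a::metric_space \<Rightarrow>\<^sub>C real)"
  using norm_bounded[of f s] by simp

lemma abs_apply_diff_le_dist: "\<bar>val f s - val g s\<bar> \<le> dist f (g :: 'a::metric_space \<Rightarrow>\<^sub>C real)"
  using dist_bounded[of f s g] by (simp add: dist_real_def)

lemma eval_sum_diff_le:
  assumes "finite T"
  shows "\<bar>eval_sum T c f - eval_sum T c g\<bar> \<le> (\<Sum>s\<in>T. \<bar>c s\<bar>) * dist f g"
proof -
  have "eval_sum T c f - eval_sum T c g = (\<Sum>s\<in>T. c s * (val f s - val g s))"
    by (simp add: eval_sum_def sum_subtractf right_diff_distrib)
  also have "\<bar>\<dots>\<bar> \<le> (\<Sum>s\<in>T. \<bar>c s\<bar> * dist f g)"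
    by (rule order_trans[OF sum_abs]) (auto intro!: sum_mono mult_left_mono abs_apply_diff_le_dist simp: abs_mult)
  finally show ?thesis by (simp add: sum_distrib_right)
qed

lemma bdd_above_osc:
  fixes f :: "'a::metric_space \<Rightarrow>\<^sub>C real"
  shows "bdd_above ((\<lambda>p. \<bar>val f (fst p) - val f (snd p)\<bar>) ` {(s, t). dist s t < r})"
proof (rule bdd_aboveI2)
  fix p
  show "\<bar>val f (fst p) - val f (snd p)\<bar> \<le> 2 * norm f"
    using abs_apply_le_norm[of f "fst p"] abs_apply_le_norm[of f "snd p"] by linarith
qed

lemma osc_upper:
  fixes f :: "'a::metric_space \<Rightarrow>\<^sub>C real"
  assumes "dist s t < r"
  shows "\<bar>val f s - val f t\<bar> \<le> osc r f"
  unfolding osc_def using assms cSUP_upper[OF _ bdd_above_osc, of "(s, t)"] by simp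

lemma osc_least:
  fixes f :: "'a::metric_space \<Rightarrow>\<^sub>C real"
  assumes "0 < r" "\<And>s t. dist s t < r \<Longrightarrow> \<bar>val f s - val f t\<bar> \<le> b"
  shows "osc r f \<le> b"
proof -
  have "(undefined, undefined) \<in> {(s :: 'a, t). dist s t < r}" using assms(1) by simp
  then have "{(s :: 'a, t). dist s t < r} \<noteq> {}" by (metis empty_iff)
  then show ?thesis unfolding osc_def using assms(2) by (intro cSUP_least) auto
qed

lemma osc_nonneg: "0 < r \<Longrightarrow> 0 \<le> osc r f"
  using osc_upper[of undefined undefined r f] by simp

lemma osc_le_norm: "0 < r \<Longrightarrow> osc r (f :: 'a::metric_space \<Rightarrow>\<^sub>C real) \<le> 2 * norm f"
proof (rule osc_least)
  fix s t
  show "\<bar>val f s - val f t\<bar> \<le> 2 * norm f"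
    using abs_apply_le_norm[of f s] abs_apply_le_norm[of f t] by linarith
qed

text \<open>Exceeding a level is witnessed by one pair of points. A large oscillation is therefore a
  union of open events on evaluation sums, the form required by Fernique's inequality for
  paths.\<close>

lemma less_osc_iff:
  fixes f :: "'a::metric_space \<Rightarrow>\<^sub>C real"
  assumes "0 < r"
  shows "b < osc r f \<longleftrightarrow> (\<exists>p\<in>{(s, t). dist s t < r}. b < \<bar>val f (fst p) - val f (snd p)\<bar>)"
proof -
  have "(undefined, undefined) \<in> {(s :: 'a, t). dist s t < r}" using assms by simp
  then show ?thesis unfolding osc_def by (intro less_cSUP_iff bdd_above_osc) blast
qed

lemma osc_diff_le:
  assumes "0 < r"
  shows "osc r f \<le> osc r g + 2 * dist f (g :: 'a::metric_space \<Rightarrow>\<^sub>C real)"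
proof (rule osc_least[OF assms])
  fix s t :: 'a assume "dist s t < r"
  then show "\<bar>val f s - val f t\<bar> \<le> osc r g + 2 * dist f g"
    using osc_upper[of s t r g] abs_apply_diff_le_dist[of f s g] abs_apply_diff_le_dist[of f t g]
    by linarith
qed

lemma osc_scaleR:
  assumes "0 < r" "0 < k"
  shows "osc r (k *\<^sub>R f) = k * osc r (f :: 'a::metric_space \<Rightarrow>\<^sub>C real)"
proof (rule antisym)
  have e: "\<bar>val (k *\<^sub>R f) s - val (k *\<^sub>R f) t\<bar> = k * \<bar>val f s - val f t\<bar>" for s t
    using assms(2) by (simp add: abs_mult flip: right_diff_distrib)
  show "osc r (k *\<^sub>R f) \<le> k * osc r f"
    by (rule osc_least[OF assms(1)]) (use assms(2) osc_upper[of _ _ r f] in \<open>simp only: e mult_le_cancel_left_pos\<close>)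
  have "osc r f \<le> osc r (k *\<^sub>R f) / k"
  proof (rule osc_least[OF assms(1)])
    fix s t :: 'a assume "dist s t < r"
    from osc_upper[OF this, of "k *\<^sub>R f"] assms(2)
    show "\<bar>val f s - val f t\<bar> \<le> osc r (k *\<^sub>R f) / k"
      unfolding e by (simp add: pos_le_divide_eq mult.commute)
  qed
  then show "k * osc r f \<le> osc r (k *\<^sub>R f)"
    using assms(2) by (simp add: pos_le_divide_eq mult.commute)
qed

lemma continuous_on_osc:
  assumes "0 < r"
  shows "continuous_on UNIV (osc r :: ('a::metric_space \<Rightarrow>\<^sub>C real) \<Rightarrow> real)"
proof (rule continuous_onI)
  fix f :: "'a \<Rightarrow>\<^sub>C real" and e :: real assume "0 < e"
  show "\<exists>d>0. \<forall>g\<in>UNIV. dist g f < d \<longrightarrow> dist (osc r g) (osc r f) \<le> e"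
  proof (intro exI[of _ "e / 2"] conjI ballI impI)
    fix g assume "dist g f < e / 2"
    then show "dist (osc r g) (osc r f) \<le> e"
      using osc_diff_le[OF assms, of f g] osc_diff_le[OF assms, of g f]
      by (simp add: dist_real_def dist_commute abs_le_iff)
  qed (use \<open>0 < e\<close> in simp)
qed

lemma osc_measurable [measurable]: "0 < r \<Longrightarrow> osc r \<in> borel_measurable borel"
  by (rule borel_measurable_continuous_onI[OF continuous_on_osc])

lemma osc_tendsto_0:
  fixes f :: "'a::compact_metric_space \<Rightarrow>\<^sub>C real"
  shows "(\<lambda>n. osc (1 / real (Suc n)) f) \<longlonglongrightarrow> 0"
proof (rule LIMSEQ_I)
  fix e :: real assume e: "0 < e"
  have "uniformly_continuous_on UNIV (val f)"
    using compact_uniformly_continuous[OF _ compact_UNIV_space] continuous_on_apply_bcontfun by blast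
  then obtain d where d: "0 < d" "\<And>s t. dist s t < d \<Longrightarrow> dist (val f s) (val f t) < e / 2"
    unfolding uniformly_continuous_on_def using e by (metis UNIV_I half_gt_zero)
  obtain N where N: "1 / real (Suc N) < d" using nat_approx_posE[OF d(1)] by auto
  show "\<exists>no. \<forall>n\<ge>no. norm (osc (1 / real (Suc n)) f - 0) < e"
  proof (intro exI[of _ N] allI impI)
    fix n assume "N \<le> n"
    then have "1 / real (Suc n) \<le> 1 / real (Suc N)" by (auto intro!: divide_left_mono)
    then have "osc (1 / real (Suc n)) f \<le> e / 2"
      using N d(2) by (intro osc_least) (auto simp: dist_real_def intro!: less_imp_le)
    then show "norm (osc (1 / real (Suc n)) f - 0) < e"
      using e osc_nonneg[of "1 / real (Suc n)" f] by simp
  qed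
qed

text \<open>A finite subfamily, written over the common grid \<open>T'\<close>, is a finite Gaussian
  family, and it inherits the level 1/4 because its event is smaller. The resulting bound does not
  depend on the subfamily and so passes to all of \<open>I\<close>.\<close>

lemma (in prob_space) gaussian_path_fernique:
  fixes W :: "'a \<Rightarrow> ('b::compact_metric_space \<Rightarrow>\<^sub>C real)"
  assumes W: "gaussian_path M W" and T: "\<And>i. i \<in> I \<Longrightarrow> finite (T i)"
    and s: "0 < s" "prob {x\<in>space M. \<exists>i\<in>I. \<bar>eval_sum (T i) (c i) (W x)\<bar> > s} \<le> 1 / 4"
    and t: "4 * s \<le> t"
  shows "prob {x\<in>space M. \<exists>i\<in>I. \<bar>eval_sum (T i) (c i) (W x)\<bar> > t} \<le> exp (- t\<^sup>2 / (32 * s^2))"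
proof -
  have Wm[measurable]: "W \<in> borel_measurable M" using W by (simp add: gaussian_path_def)
  define U where "U r i = {f :: 'b \<Rightarrow>\<^sub>C real. r < \<bar>eval_sum (T i) (c i) f\<bar>}" for r i
  have U: "open (U r i)" for r i
    unfolding U_def by (intro open_Collect_less continuous_intros continuous_on_eval_sum)
  have meas: "{x\<in>space M. \<exists>i\<in>I. W x \<in> U r i} \<in> sets M" for r
  proof -
    have "open (\<Union>i\<in>I. U r i)" using U by blast
    then have "W -` (\<Union>i\<in>I. U r i) \<inter> space M \<in> sets M" by measurable
    also have "W -` (\<Union>i\<in>I. U r i) \<inter> space M = {x\<in>space M. \<exists>i\<in>I. W x \<in> U r i}" by auto
    finally show ?thesis .
  qed
  have "prob {x\<in>space M. \<exists>i\<in>I. W x \<in> U t i} \<le> exp (- t\<^sup>2 / (32 * s^2))"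
  proof (rule measure_Union_open_le[OF Wm U])
    fix K assume K: "finite K" "K \<subseteq> I"
    define T' where "T' = (\<Union>i\<in>K. T i)"
    have T': "finite T'" "\<And>i. i \<in> K \<Longrightarrow> T i \<subseteq> T'" using K T by (auto simp: T'_def)
    have "centered_gaussian M (\<lambda>x. \<Sum>i\<in>K. \<theta> i * eval_sum (T i) (c i) (W x))" for \<theta>
    proof -
      have "(\<Sum>i\<in>K. \<theta> i * eval_sum (T i) (c i) f) = eval_sum T' (\<lambda>s. \<Sum>i\<in>K. \<theta> i * (if s \<in> T i then c i s else 0)) f" for f
      proof -
        have "(\<Sum>i\<in>K. \<theta> i * eval_sum (T i) (c i) f) = (\<Sum>i\<in>K. \<Sum>s\<in>T'. \<theta> i * ((if s \<in> T i then c i s else 0) * val f s))"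
          using T' by (intro sum.cong refl) (simp add: eval_sum_extend[of T'] eval_sum_def[of T'] sum_distrib_left)
        then show ?thesis
          by (subst (asm) sum.swap) (simp add: eval_sum_def sum_distrib_right mult.assoc)
      qed
      then show ?thesis using W T' by (simp add: gaussian_path_def)
    qed
    moreover have "(\<lambda>x. eval_sum (T i) (c i) (W x)) \<in> borel_measurable M" for i by measurable
    moreover have "prob {x\<in>space M. \<exists>i\<in>K. \<bar>eval_sum (T i) (c i) (W x)\<bar> > s} \<le> 1 / 4"
    proof (rule order_trans[OF finite_measure_mono s(2)])
      show "{x\<in>space M. \<exists>i\<in>K. \<bar>eval_sum (T i) (c i) (W x)\<bar> > s} \<subseteq> {x\<in>space M. \<exists>i\<in>I. \<bar>eval_sum (T i) (c i) (W x)\<bar> > s}"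
        using K by blast
    qed (use meas[of s] in \<open>simp add: U_def\<close>)
    ultimately show "prob {x\<in>space M. \<exists>i\<in>K. W x \<in> U t i} \<le> exp (- t\<^sup>2 / (32 * s^2))"
      using fernique_tail[OF K(1), of "\<lambda>i x. eval_sum (T i) (c i) (W x)" s t] s(1) t by (simp add: U_def)
  qed
  then show ?thesis by (simp add: U_def)
qed

lemma (in prob_space) gaussian_path_oscillation_tail:
  fixes W :: "'a \<Rightarrow> ('b::compact_metric_space \<Rightarrow>\<^sub>C real)"
  assumes W: "gaussian_path M W" and r: "0 < r"
    and s: "0 < s" "prob {x\<in>space M. osc r (W x) > s} \<le> 1 / 4"
    and t: "4 * s \<le> t"
  shows "prob {x\<in>space M. osc r (W x) > t} \<le> exp (- t\<^sup>2 / (32 * s^2))"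
proof -
  \<comment> \<open>Written as a sum of two point masses so that the coefficients cancel when the
    two points coincide.\<close>
  define c where "c p = (\<lambda>u. (if u = fst p then 1 else 0) + (if u = snd p then -1 else 0) :: real)" for p :: "'b \<times> 'b"
  have c: "eval_sum {fst p, snd p} (c p) f = val f (fst p) - val f (snd p)" for p f
    unfolding c_def eval_sum_add[symmetric] by (simp add: eval_sum_single)
  show ?thesis
    using gaussian_path_fernique[OF W, of "{(s, t). dist s t < r}" "\<lambda>p. {fst p, snd p}" s c t] s t
    unfolding less_osc_iff[OF r] c by simp
qed

lemma (in prob_space) gaussian_path_norm_tail:
  fixes W :: "'a \<Rightarrow> ('b::compact_metric_space \<Rightarrow>\<^sub>C real)"
  assumes W: "gaussian_path M W"
    and s: "0 < s" "prob {x\<in>space M. norm (W x) > s} \<le> 1 / 4"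
    and t: "4 * s \<le> t"
  shows "prob {x\<in>space M. norm (W x) > t} \<le> exp (- t\<^sup>2 / (32 * s^2))"
proof -
  have n: "b < norm f \<longleftrightarrow> (\<exists>s\<in>UNIV. b < \<bar>eval_sum {s} (\<lambda>_. 1) f\<bar>)" for b and f :: "'b \<Rightarrow>\<^sub>C real"
  proof
    assume "\<exists>s\<in>UNIV. b < \<bar>eval_sum {s} (\<lambda>_. 1) f\<bar>"
    then show "b < norm f" using abs_apply_le_norm[of f] by (auto simp: eval_sum_def intro: less_le_trans)
  next
    assume b: "b < norm f"
    show "\<exists>s\<in>UNIV. b < \<bar>eval_sum {s} (\<lambda>_. 1) f\<bar>"
    proof (rule ccontr)
      assume "\<not> ?thesis"
      then have "norm f \<le> b" by (intro norm_bound) (auto simp: eval_sum_def not_less)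
      then show False using b by simp
    qed
  qed
  show ?thesis
    using gaussian_path_fernique[OF W, of UNIV "\<lambda>s. {s}" s "\<lambda>_ _. 1" t] s t unfolding n by simp
qed

text \<open>The norm is finite everywhere, so some level is exceeded with probability below 1/4.
  Fernique's inequality then makes the tail of the squared norm geometric.\<close>

lemma (in prob_space) gaussian_path_norm_square_integrable:
  fixes W :: "'a \<Rightarrow> ('b::compact_metric_space \<Rightarrow>\<^sub>C real)"
  assumes W: "gaussian_path M W"
  shows "integrable M (\<lambda>x. (norm (W x))^2)"
proof -
  have [measurable]: "W \<in> borel_measurable M" using W by (simp add: gaussian_path_def)
  have "(\<lambda>n. prob {x\<in>space M. norm (W x) > real n}) \<longlonglongrightarrow> prob (\<Inter>n. {x\<in>space M. norm (W x) > real n})"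
    by (intro finite_Lim_measure_decseq) (force simp: decseq_def)+
  also have "(\<Inter>n. {x\<in>space M. norm (W x) > real n}) = {}"
    using reals_Archimedean2 by (auto intro: less_asym)
  finally obtain n where n: "prob {x\<in>space M. norm (W x) > real (Suc n)} < 1 / 4"
    using LIMSEQ_ex_less[OF LIMSEQ_Suc, of _ _ "1 / 4"] by force
  define s where "s = real (Suc n)"
  have tail: "prob {x\<in>space M. norm (W x) > t} \<le> exp (- t\<^sup>2 / (32 * s^2))" if "4 * s \<le> t" for t
    using gaussian_path_norm_tail[OF W, of s t] n that by (simp add: s_def)
  define D where "D = 32 * s^2"
  have D: "0 < D" using n by (simp add: D_def s_def)
  have tail': "prob {x\<in>space M. (norm (W x))^2 > real k} \<le> exp 1 * exp (- 1 / D) ^ k" for k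
  proof (cases "16 * s^2 \<le> real k")
    case True
    then have "(4 * s)^2 \<le> real k" by (simp add: power_mult_distrib)
    then have "4 * s \<le> sqrt (real k)" by (rule real_le_rsqrt)
    from tail[OF this] have "prob {x\<in>space M. norm (W x) > sqrt (real k)} \<le> exp (- real k / D)"
      by (simp add: D_def)
    also have "\<dots> = exp (- 1 / D) ^ k" by (simp add: exp_of_nat_mult[symmetric])
    also have "\<dots> \<le> exp 1 * exp (- 1 / D) ^ k" by simp
    also have "{x\<in>space M. norm (W x) > sqrt (real k)} = {x\<in>space M. (norm (W x))^2 > real k}"
      using real_sqrt_less_iff[of "real k" "(norm (W x))^2" for x] by simp
    finally show ?thesis .
  next
    case False
    then have "real k / D \<le> 1" using D by (simp add: D_def divide_le_eq)
    have "prob {x\<in>space M. (norm (W x))^2 > real k} \<le> exp 0" by simp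
    also have "\<dots> \<le> exp (1 - real k / D)" using \<open>real k / D \<le> 1\<close> by (subst exp_le_cancel_iff) simp
    also have "\<dots> = exp 1 * exp (- 1 / D) ^ k" by (simp add: exp_of_nat_mult[symmetric] exp_add[symmetric])
    finally show ?thesis .
  qed
  \<comment> \<open>Rounding up gives an integer-valued majorant, whose expectation is the sum of
    its tail probabilities.\<close>
  define K where "K x = nat \<lceil>(norm (W x))^2\<rceil>" for x
  have [measurable]: "K \<in> measurable M (count_space UNIV)" unfolding K_def by measurable
  have "(\<integral>\<^sup>+x. of_nat (K x) \<partial>M) = (\<Sum>k. emeasure M {x\<in>space M. k < K x})"
    by (intro nn_integral_nat_function) auto
  also have "\<dots> \<le> (\<Sum>k. ennreal (exp 1 * exp (- 1 / D) ^ k))"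
  proof (intro suminf_le allI)
    fix k
    have "{x\<in>space M. k < K x} = {x\<in>space M. (norm (W x))^2 > real k}"
      unfolding K_def by (auto simp: less_ceiling_iff zless_nat_eq_int_zless)
    then show "emeasure M {x\<in>space M. k < K x} \<le> ennreal (exp 1 * exp (- 1 / D) ^ k)"
      using tail'[of k] by (simp add: emeasure_eq_measure ennreal_leI)
  qed auto
  also have "\<dots> = ennreal (\<Sum>k. exp 1 * exp (- 1 / D) ^ k)"
    using D by (intro suminf_ennreal2 summable_mult summable_geometric) auto
  finally have fin: "(\<integral>\<^sup>+x. of_nat (K x) \<partial>M) < \<infinity>"
    by (rule le_less_trans) simp
  have "(\<integral>\<^sup>+x. ennreal ((norm (W x))^2) \<partial>M) \<le> (\<integral>\<^sup>+x. of_nat (K x) \<partial>M)"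
  proof (rule nn_integral_mono)
    fix x
    have "(norm (W x))^2 \<le> real (K x)" unfolding K_def by (simp add: real_nat_ceiling_ge)
    then show "ennreal ((norm (W x))^2) \<le> of_nat (K x)"
      by (simp add: ennreal_leI flip: ennreal_of_nat_eq_real_of_nat)
  qed
  then show ?thesis using fin by (intro integrableI_nonneg) (auto intro: le_less_trans)
qed

section \<open>The rate function\<close>

lemma finite_net:
  assumes "0 < r"
  obtains T :: "'a::compact_metric_space set" where "finite T" "\<forall>s. \<exists>t\<in>T. dist s t < r"
proof -
  obtain T :: "'a set" where "finite T" "(UNIV :: 'a set) \<subseteq> (\<Union>x\<in>T. ball x r)"
    using seq_compact_imp_totally_bounded[OF compact_imp_seq_compact[OF compact_UNIV_space]] assms
    by metis
  then show ?thesis using that[of T] by (auto simp: dist_commute subset_eq)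
qed

text \<open>Arzela-Ascoli in the form used for level sets: a uniform modulus of continuity reduces a
  path, up to a small error, to its values on a finite net, and bounded values fall into finitely
  many cells.\<close>

lemma compact_bcontfun_equicontinuous:
  fixes S :: "('a::compact_metric_space \<Rightarrow>\<^sub>C real) set"
  assumes "closed S" and R: "\<And>f. f \<in> S \<Longrightarrow> norm f \<le> R"
    and osc: "\<And>e. 0 < e \<Longrightarrow> \<exists>r>0. \<forall>f\<in>S. osc r f \<le> e"
  shows "compact S"
  unfolding compact_eq_totally_bounded
proof (intro conjI allI impI)
  show "Topological_Spaces.complete S" using assms(1) by (simp add: complete_eq_closed)
  fix e :: real assume e: "0 < e"
  define d where "d = e / 4"
  have d: "0 < d" using e by (simp add: d_def)
  then obtain r where r: "0 < r" "\<And>f. f \<in> S \<Longrightarrow> osc r f \<le> d" using osc by metis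
  obtain T :: "'a set" where T: "finite T" "\<forall>s. \<exists>t\<in>T. dist s t < r" using finite_net[OF r(1)] .
  \<comment> \<open>The cells of width d that contain the net values. Paths with equal cells differ
    by at most 3 d: one d from the cell and one from the oscillation of each path.\<close>
  define \<Phi> where "\<Phi> f = restrict (\<lambda>t. \<lfloor>val f t / d\<rfloor>) T" for f :: "'a \<Rightarrow>\<^sub>C real"
  have "\<Phi> f \<in> T \<rightarrow>\<^sub>E {\<lfloor>- R / d\<rfloor>..\<lfloor>R / d\<rfloor>}" if "f \<in> S" for f
  proof -
    have "\<bar>val f t\<bar> \<le> R" for t using abs_apply_le_norm[of f t] R[OF that] by linarith
    then have "- R / d \<le> val f t / d \<and> val f t / d \<le> R / d" for t
      using d by (auto simp: abs_le_iff intro!: divide_right_mono intro: order_trans)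
         (smt (verit) divide_right_mono minus_divide_left)
    then show ?thesis by (auto simp: \<Phi>_def intro!: floor_mono)
  qed
  then have "finite (\<Phi> ` S)"
    using T(1) by (intro finite_subset[OF _ finite_PiE[of T "\<lambda>_. {\<lfloor>- R / d\<rfloor>..\<lfloor>R / d\<rfloor>}"]]) auto
  then obtain C where C: "C \<subseteq> S" "finite C" "\<Phi> ` S = \<Phi> ` C"
    using finite_subset_image[of "\<Phi> ` S" \<Phi> S] by auto
  have "S \<subseteq> (\<Union>g\<in>C. ball g e)"
  proof
    fix f assume f: "f \<in> S"
    then obtain g where g: "g \<in> C" "\<Phi> f = \<Phi> g" using C(3) by (metis imageE image_eqI)
    have "dist g f \<le> 3 * d"
    proof (rule dist_bound)
      fix s
      obtain t where t: "t \<in> T" "dist s t < r" using T(2) by blast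
      have "\<lfloor>val f t / d\<rfloor> = \<lfloor>val g t / d\<rfloor>"
        using fun_cong[OF g(2), of t] t(1) by (simp add: \<Phi>_def)
      then have "\<bar>val f t / d - val g t / d\<bar> < 1" by linarith
      then have "\<bar>val f t - val g t\<bar> < d"
        using d by (simp add: divide_less_eq flip: diff_divide_distrib)
      moreover have "\<bar>val f s - val f t\<bar> \<le> d"
        using osc_upper[OF t(2), of f] r(2)[OF f] by linarith
      moreover have "\<bar>val g s - val g t\<bar> \<le> d"
        using osc_upper[OF t(2), of g] r(2)[of g] g(1) C(1) by fastforce
      ultimately show "dist (val g s) (val f s) \<le> 3 * d"
        unfolding dist_real_def by linarith
    qed
    also have "3 * d < e" using e by (simp add: d_def)
    finally show "f \<in> (\<Union>g\<in>C. ball g e)" using g(1) by auto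
  qed
  then show "\<exists>k. finite k \<and> S \<subseteq> (\<Union>x\<in>k. ball x e)" using C(2) by blast
qed

lemma bounded_linear_eval: "bounded_linear (\<lambda>f :: 'a::metric_space \<Rightarrow>\<^sub>C real. val f s)"
  by (rule bounded_linear_intro[where K=1]) (auto simp: abs_apply_le_norm)

lemma bounded_linear_eval_sum: "bounded_linear (eval_sum T c)"
  unfolding eval_sum_def
  by (intro bounded_linear_sum bounded_linear_const_mult bounded_linear_eval)

definition rkhs_rate :: "'w measure \<Rightarrow> ('w \<Rightarrow> 'e::{banach, second_countable_topology}) \<Rightarrow> 'e \<Rightarrow> ennreal"
  where "rkhs_rate N Z h = (if h \<in> rkhs N Z then ennreal (1 / 2 * (rkhs_norm N Z h)^2) else \<infinity>)"

section \<open>The reproducing kernel Hilbert space of a Gaussian path and its rate function\<close>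

locale gaussian_path_space = prob_space N for N :: "'v measure" +
  fixes Z :: "'v \<Rightarrow> 'a::compact_metric_space \<Rightarrow>\<^sub>C real"
  assumes gaussian: "gaussian_path N Z"
begin

lemma Z_measurable [measurable]: "Z \<in> borel_measurable N"
  using gaussian by (simp add: gaussian_path_def)

abbreviation paired :: "('v \<Rightarrow> real) \<Rightarrow> ('a \<Rightarrow>\<^sub>C real)"
  where "paired \<xi> \<equiv> (\<integral>x. \<xi> x *\<^sub>R Z x \<partial>N)"

abbreviation rate :: "('a \<Rightarrow>\<^sub>C real) \<Rightarrow> ennreal"
  where "rate \<equiv> rkhs_rate N Z"

definition var :: "'a set \<Rightarrow> ('a \<Rightarrow> real) \<Rightarrow> real"
  where "var T c = (LINT x|N. (eval_sum T c (Z x))^2)"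

lemma square_integrable_norm: "square_integrable N (\<lambda>x. norm (Z x))"
  using gaussian_path_norm_square_integrable[OF gaussian] by (simp add: square_integrable_def)

lemma square_integrable_blinfun:
  assumes "bounded_linear \<alpha>"
  shows "square_integrable N (\<lambda>x. \<alpha> (Z x) :: real)"
proof -
  interpret \<alpha>: bounded_linear \<alpha> by fact
  have m[measurable]: "\<alpha> \<in> borel_measurable borel"
    by (intro borel_measurable_continuous_onI \<alpha>.continuous_on continuous_on_id)
  obtain K where K: "\<And>x. norm (\<alpha> x) \<le> norm x * K" using \<alpha>.bounded by blast
  have "integrable N (\<lambda>x. (\<alpha> (Z x))^2)"
  proof (rule Bochner_Integration.integrable_bound)
    show "integrable N (\<lambda>x. K^2 * (norm (Z x))^2)"
      using gaussian_path_norm_square_integrable[OF gaussian] by simp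
    show "AE x in N. norm ((\<alpha> (Z x))^2) \<le> norm (K^2 * (norm (Z x))^2)"
      using power_mono[OF K, of _ 2] by (auto simp: power_mult_distrib mult.commute)
  qed auto
  then show ?thesis by (simp add: square_integrable_def)
qed

lemmas square_integrable_eval_sum = square_integrable_blinfun[OF bounded_linear_eval_sum]
  and square_integrable_eval = square_integrable_blinfun[OF bounded_linear_eval]

lemma integrable_scaleR_path:
  assumes "square_integrable N \<xi>"
  shows "integrable N (\<lambda>x. \<xi> x *\<^sub>R Z x)"
proof (rule Bochner_Integration.integrable_bound)
  show "integrable N (\<lambda>x. \<xi> x * norm (Z x))"
    by (rule square_integrable_mult_integrable[OF assms square_integrable_norm])
qed (use assms in \<open>auto simp: square_integrable_def\<close>)

lemma blinfun_integral_path: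
  assumes "square_integrable N \<xi>" "bounded_linear (\<alpha> :: _ \<Rightarrow> real)"
  shows "\<alpha> (paired \<xi>) = (LINT x|N. \<xi> x * \<alpha> (Z x))"
  using integral_bounded_linear[OF assms(2) integrable_scaleR_path[OF assms(1)]]
  by (simp add: linear_simps(5)[OF assms(2)])

lemma norm_integral_path_le:
  assumes "square_integrable N \<xi>"
  shows "norm (paired \<xi>) \<le> L2_norm_of N \<xi> * L2_norm_of N (\<lambda>x. norm (Z x))"
proof -
  have "norm (paired \<xi>) \<le> (LINT x|N. \<bar>\<xi> x\<bar> * norm (Z x))"
    using integral_norm_bound[of N "\<lambda>x. \<xi> x *\<^sub>R Z x"] by simp
  also have "\<dots> \<le> \<bar>LINT x|N. \<bar>\<xi> x\<bar> * norm (Z x)\<bar>" by simp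
  also have "\<dots> \<le> L2_norm_of N (\<lambda>x. \<bar>\<xi> x\<bar>) * L2_norm_of N (\<lambda>x. norm (Z x))"
    using assms by (intro L2_abs_inner_le square_integrable_norm) (auto simp: square_integrable_def)
  finally show ?thesis by (simp add: L2_norm_of_def)
qed

text \<open>Elements of the Gaussian space are L2 limits of linear functionals of \<open>Z\<close>,
  and the inner product with d is continuous by Cauchy-Schwarz, so orthogonality passes to the
  closure.\<close>

lemma gaussian_space_orthogonal:
  assumes \<xi>: "\<xi> \<in> gaussian_space N Z" and d: "square_integrable N d"
    and orth: "\<And>\<alpha> :: ('a \<Rightarrow>\<^sub>C real) \<Rightarrow>\<^sub>L real. (LINT x|N. d x * blinfun_apply \<alpha> (Z x)) = 0"
  shows "(LINT x|N. d x * \<xi> x) = 0"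
proof -
  have sq: "square_integrable N \<xi>" using \<xi> by (simp add: gaussian_space_def)
  have "\<bar>LINT x|N. d x * \<xi> x\<bar> \<le> L2_norm_of N d * \<delta>" if "0 < \<delta>" for \<delta>
  proof -
    obtain \<alpha> :: "('a \<Rightarrow>\<^sub>C real) \<Rightarrow>\<^sub>L real" where
      a: "square_integrable N (\<lambda>x. blinfun_apply \<alpha> (Z x))"
         "L2_norm_of N (\<lambda>x. \<xi> x - blinfun_apply \<alpha> (Z x)) < \<delta>"
      using \<xi> \<open>0 < \<delta>\<close> by (auto simp: gaussian_space_def)
    have s: "square_integrable N (\<lambda>x. \<xi> x - blinfun_apply \<alpha> (Z x))"
      using square_integrable_lincomb(1)[OF sq a(1), of "-1"] by simp
    have "(LINT x|N. d x * \<xi> x) = (LINT x|N. d x * (\<xi> x - blinfun_apply \<alpha> (Z x)))"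
      using square_integrable_mult_integrable[OF d sq] square_integrable_mult_integrable[OF d a(1)] orth[of \<alpha>]
      by (simp add: right_diff_distrib)
    also have "\<bar>\<dots>\<bar> \<le> L2_norm_of N d * L2_norm_of N (\<lambda>x. \<xi> x - blinfun_apply \<alpha> (Z x))"
      by (rule L2_abs_inner_le[OF d s])
    also have "\<dots> \<le> L2_norm_of N d * \<delta>"
      using a(2) by (intro mult_left_mono L2_norm_of_nonneg) simp
    finally show ?thesis .
  qed
  then have "\<bar>LINT x|N. d x * \<xi> x\<bar> \<le> 0 + e" if "0 < e" for e
  proof -
    have L: "0 < L2_norm_of N d + 1" using L2_norm_of_nonneg[of d] by linarith
    have "\<bar>LINT x|N. d x * \<xi> x\<bar> \<le> L2_norm_of N d * (e / (L2_norm_of N d + 1))"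
      by (rule \<open>\<And>\<delta>. 0 < \<delta> \<Longrightarrow> _\<close>) (use L that in simp)
    also have "\<dots> \<le> e" using L that by (simp add: divide_le_eq field_simps)
    finally show ?thesis by simp
  qed
  then have "\<bar>LINT x|N. d x * \<xi> x\<bar> \<le> 0" by (rule field_le_epsilon)
  then show ?thesis by simp
qed

text \<open>If \<xi> and \<eta> represent the same path, their difference is orthogonal to every
  linear functional of \<open>Z\<close>, hence to \<xi> and to \<eta>. The inner product of \<xi>
  and \<eta> then equals both squared norms, so the description in \<open>rkhs_norm\<close> is
  unambiguous.\<close>

lemma rkhs_norm_eq:
  assumes \<xi>: "\<xi> \<in> gaussian_space N Z"
  shows "rkhs_norm N Z (paired \<xi>) = L2_norm_of N \<xi>"
  unfolding rkhs_norm_def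
proof (rule the_equality)
  show "\<exists>\<eta>\<in>gaussian_space N Z. paired \<xi> = paired \<eta> \<and> L2_norm_of N \<xi> = L2_norm_of N \<eta>"
    using \<xi> by blast
next
  fix r assume "\<exists>\<eta>\<in>gaussian_space N Z. paired \<xi> = paired \<eta> \<and> r = L2_norm_of N \<eta>"
  then obtain \<eta> where \<eta>: "\<eta> \<in> gaussian_space N Z" "paired \<xi> = paired \<eta>" "r = L2_norm_of N \<eta>"
    by blast
  have sq: "square_integrable N \<xi>" "square_integrable N \<eta>" using \<xi> \<eta> by (auto simp: gaussian_space_def)
  have d: "square_integrable N (\<lambda>x. \<xi> x - \<eta> x)"
    using square_integrable_lincomb(1)[OF sq, of "-1"] by simp
  have "(LINT x|N. (\<xi> x - \<eta> x) * blinfun_apply \<alpha> (Z x)) = 0" for \<alpha>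
  proof -
    note s = square_integrable_blinfun[OF blinfun.bounded_linear_right, of \<alpha>]
    have "(LINT x|N. \<xi> x * blinfun_apply \<alpha> (Z x)) = (LINT x|N. \<eta> x * blinfun_apply \<alpha> (Z x))"
      unfolding blinfun_integral_path[OF sq(1) blinfun.bounded_linear_right, symmetric]
        blinfun_integral_path[OF sq(2) blinfun.bounded_linear_right, symmetric] \<eta>(2) ..
    then show ?thesis
      using square_integrable_mult_integrable[OF sq(1) s] square_integrable_mult_integrable[OF sq(2) s]
      by (simp add: left_diff_distrib)
  qed
  note orth = gaussian_space_orthogonal[OF _ d this]
  note i = square_integrable_mult_integrable[OF sq(1) sq(1)] square_integrable_mult_integrable[OF sq(1) sq(2)]
    square_integrable_mult_integrable[OF sq(2) sq(1)] square_integrable_mult_integrable[OF sq(2) sq(2)]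
  have "(LINT x|N. \<xi> x * \<xi> x) = (LINT x|N. \<eta> x * \<xi> x)" "(LINT x|N. \<xi> x * \<eta> x) = (LINT x|N. \<eta> x * \<eta> x)"
    using orth[OF \<xi>] orth[OF \<eta>(1)] i by (simp_all add: left_diff_distrib)
  then have "(LINT x|N. \<xi> x * \<xi> x) = (LINT x|N. \<eta> x * \<eta> x)"
    by (simp add: mult.commute[of "\<xi> _" "\<eta> _"])
  then show "r = L2_norm_of N \<xi>" by (simp add: \<eta>(3) L2_norm_of_def power2_eq_square)
qed

text \<open>The hypothesis says that prescribing the values v defines a functional of norm at most
  sqrt (2 * l) on the L2 span of the evaluations at \<open>S\<close>. With \<open>S\<close> the
  whole space this represents a given path; with \<open>S\<close> a finite grid it extends grid
  values to a path of rate at most l.\<close>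

lemma gaussian_space_representation:
  assumes l: "0 \<le> l"
    and v: "\<And>T c. finite T \<Longrightarrow> T \<subseteq> S \<Longrightarrow> (\<Sum>s\<in>T. c s * v s)^2 \<le> 2 * l * var T c"
  obtains \<xi> where "\<xi> \<in> gaussian_space N Z" "(L2_norm_of N \<xi>)^2 \<le> 2 * l"
    "\<forall>s\<in>S. (LINT x|N. \<xi> x * val (Z x) s) = v s"
    "\<forall>\<delta>>0. \<exists>T c. finite T \<and> L2_norm_of N (\<lambda>x. \<xi> x - eval_sum T c (Z x)) < \<delta>"
proof -
  define G where "G = {(u, a). \<exists>T c. finite T \<and> T \<subseteq> S \<and> u = (\<lambda>x. eval_sum T c (Z x)) \<and> a = (\<Sum>s\<in>T. c s * v s)}"
  obtain \<xi> where \<xi>: "square_integrable N \<xi>" "L2_norm_of N \<xi> \<le> sqrt (2 * l)"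
    "\<forall>(u, a)\<in>G. (LINT x|N. \<xi> x * u x) = a"
    "\<forall>\<delta>>0. \<exists>(u, a)\<in>G. L2_norm_of N (\<lambda>x. \<xi> x - u x) < \<delta>"
  proof (rule L2_Riesz_representation[of "sqrt (2 * l)" G])
    show "((\<lambda>_. 0), 0) \<in> G" by (auto simp: G_def eval_sum_def intro!: exI[of _ "{}"])
    show "square_integrable N u" if "(u, a) \<in> G" for u a
      using that square_integrable_eval_sum by (auto simp: G_def)
    show "a \<le> sqrt (2 * l) * L2_norm_of N u" if "(u, a) \<in> G" for u a
    proof -
      obtain T c where T: "finite T" "T \<subseteq> S" and u: "u = (\<lambda>x. eval_sum T c (Z x))" and a: "a = (\<Sum>s\<in>T. c s * v s)"
        using \<open>(u, a) \<in> G\<close> unfolding G_def mem_Collect_eq prod.case by (elim exE conjE) (rule that)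
      have "a\<^sup>2 \<le> 2 * l * var T c" unfolding a by (rule v[OF T])
      then have "a \<le> sqrt (2 * l * var T c)" by (rule real_le_rsqrt)
      then show ?thesis by (simp add: real_sqrt_mult L2_norm_of_def var_def u)
    qed
    show "((\<lambda>x. u x + k * w x), a + k * b) \<in> G" if "(u, a) \<in> G" "(w, b) \<in> G" for u a w b k
    proof -
      obtain T c where T: "finite T" "T \<subseteq> S" and u: "u = (\<lambda>x. eval_sum T c (Z x))" and a: "a = (\<Sum>s\<in>T. c s * v s)"
        using \<open>(u, a) \<in> G\<close> unfolding G_def mem_Collect_eq prod.case by (elim exE conjE) (rule that)
      obtain T' c' where T': "finite T'" "T' \<subseteq> S" and w: "w = (\<lambda>x. eval_sum T' c' (Z x))" and b: "b = (\<Sum>s\<in>T'. c' s * v s)"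
        using \<open>(w, b) \<in> G\<close> unfolding G_def mem_Collect_eq prod.case by (elim exE conjE) (rule that)
      \<comment> \<open>Extending both coefficient families by zero to the union of the grids shows
        that the graph is closed under linear combinations.\<close>
      define e where "e s = (if s \<in> T then c s else 0) + k * (if s \<in> T' then c' s else 0)" for s
      have ext: "(\<Sum>s\<in>T. c s * f s) + k * (\<Sum>s\<in>T'. c' s * f s) = (\<Sum>s\<in>T \<union> T'. e s * f s)" for f :: "'a \<Rightarrow> real"
      proof -
        have "(\<Sum>s\<in>T \<union> T'. (if s \<in> T then c s else 0) * f s) = (\<Sum>s\<in>T. (if s \<in> T then c s else 0) * f s)"
          "(\<Sum>s\<in>T \<union> T'. (if s \<in> T' then c' s else 0) * f s) = (\<Sum>s\<in>T'. (if s \<in> T' then c' s else 0) * f s)"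
          using T(1) T'(1) by (intro sum.mono_neutral_right; auto)+
        then show ?thesis
          by (simp add: e_def distrib_right sum.distrib sum_distrib_left[symmetric] mult.assoc)
      qed
      have "finite (T \<union> T') \<and> T \<union> T' \<subseteq> S \<and> (\<lambda>x. u x + k * w x) = (\<lambda>x. eval_sum (T \<union> T') e (Z x))
          \<and> a + k * b = (\<Sum>s\<in>T \<union> T'. e s * v s)"
        using T T' by (simp add: u w a b eval_sum_def ext)
      then show ?thesis unfolding G_def by blast
    qed
  qed (use l in simp)
  have app: "\<exists>T c. finite T \<and> L2_norm_of N (\<lambda>x. \<xi> x - eval_sum T c (Z x)) < \<delta>" if "0 < \<delta>" for \<delta>
    using \<xi>(4) that unfolding G_def by fast
  have "\<xi> \<in> gaussian_space N Z"
    unfolding gaussian_space_def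
  proof (intro CollectI conjI allI impI \<xi>(1))
    fix \<delta> :: real assume "0 < \<delta>"
    then obtain T c where T: "finite T" "L2_norm_of N (\<lambda>x. \<xi> x - eval_sum T c (Z x)) < \<delta>" using app by blast
    then show "\<exists>\<alpha> :: ('a \<Rightarrow>\<^sub>C real) \<Rightarrow>\<^sub>L real. square_integrable N (\<lambda>x. blinfun_apply \<alpha> (Z x)) \<and>
        L2_norm_of N (\<lambda>x. \<xi> x - blinfun_apply \<alpha> (Z x)) < \<delta>"
      by (intro exI[of _ "Blinfun (eval_sum T c)"])
         (simp add: bounded_linear_Blinfun_apply[OF bounded_linear_eval_sum] square_integrable_eval_sum)
  qed
  moreover have "(L2_norm_of N \<xi>)^2 \<le> 2 * l"
    using power_mono[OF \<xi>(2) L2_norm_of_nonneg, of 2] l by simp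
  moreover have "(LINT x|N. \<xi> x * val (Z x) s) = v s" if "s \<in> S" for s
  proof -
    have "((\<lambda>x. val (Z x) s), v s) \<in> G"
      unfolding G_def using that by (auto simp: eval_sum_def intro!: exI[of _ "{s}"] exI[of _ "\<lambda>_. 1"])
    from bspec[OF \<xi>(3) this] show ?thesis by simp
  qed
  ultimately show ?thesis using that app by blast
qed

lemma eval_sum_le_var:
  assumes "square_integrable N \<xi>"
  shows "(eval_sum T c (paired \<xi>))^2 \<le> (L2_norm_of N \<xi>)^2 * var T c"
  unfolding blinfun_integral_path[OF assms bounded_linear_eval_sum] var_def L2_norm_of_power2
  by (rule L2_Cauchy_Schwarz[OF assms square_integrable_eval_sum])

lemma path_eq_integralI:
  assumes "square_integrable N \<xi>" "\<And>s. (LINT x|N. \<xi> x * val (Z x) s) = val h s"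
  shows "h = paired \<xi>"
  by (rule bcontfun_eqI) (simp add: blinfun_integral_path[OF assms(1) bounded_linear_eval] assms(2))

lemma rkhs_rate_integral:
  assumes "\<xi> \<in> gaussian_space N Z"
  shows "rate (paired \<xi>) = ennreal (1 / 2 * (L2_norm_of N \<xi>)^2)"
  using assms by (auto simp: rkhs_rate_def rkhs_def rkhs_norm_eq)

text \<open>Cauchy-Schwarz gives one direction and the representation over all points the other.
  Each condition on the right is closed in h, which later makes level sets closed at once.\<close>

lemma rkhs_rate_le_iff:
  assumes l: "0 \<le> l"
  shows "rate h \<le> ennreal l \<longleftrightarrow> (\<forall>T c. finite T \<longrightarrow> (eval_sum T c h)^2 \<le> 2 * l * var T c)"
proof
  assume le: "rate h \<le> ennreal l"
  then have "h \<in> rkhs N Z" by (auto simp: rkhs_rate_def top_unique split: if_splits)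
  then obtain \<xi> where \<xi>: "\<xi> \<in> gaussian_space N Z" "h = paired \<xi>" by (auto simp: rkhs_def)
  have n: "(L2_norm_of N \<xi>)^2 \<le> 2 * l"
    using le l unfolding \<xi>(2) rkhs_rate_integral[OF \<xi>(1)] by simp
  show "\<forall>T c. finite T \<longrightarrow> (eval_sum T c h)^2 \<le> 2 * l * var T c"
  proof (intro allI impI)
    fix T :: "'a set" and c
    have "(eval_sum T c h)^2 \<le> (L2_norm_of N \<xi>)^2 * var T c"
      unfolding \<xi>(2) using \<xi>(1) by (intro eval_sum_le_var) (simp add: gaussian_space_def)
    also have "\<dots> \<le> 2 * l * var T c" using n by (intro mult_right_mono) (simp_all add: var_def)
    finally show "(eval_sum T c h)^2 \<le> 2 * l * var T c" .
  qed
next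
  assume "\<forall>T c. finite T \<longrightarrow> (eval_sum T c h)^2 \<le> 2 * l * var T c"
  then have v: "finite T \<Longrightarrow> T \<subseteq> UNIV \<Longrightarrow> (\<Sum>s\<in>T. c s * val h s)^2 \<le> 2 * l * var T c" for T c
    unfolding eval_sum_def by blast
  obtain \<xi> where \<xi>: "\<xi> \<in> gaussian_space N Z" "(L2_norm_of N \<xi>)^2 \<le> 2 * l"
    "\<forall>s\<in>UNIV. (LINT x|N. \<xi> x * val (Z x) s) = val h s"
    "\<forall>\<delta>>0. \<exists>T c. finite T \<and> L2_norm_of N (\<lambda>x. \<xi> x - eval_sum T c (Z x)) < \<delta>"
    by (rule gaussian_space_representation[OF l v])
  then have "h = paired \<xi>" by (intro path_eq_integralI) (auto simp: gaussian_space_def)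
  then show "rate h \<le> ennreal l"
    using \<xi>(1,2) by (simp add: rkhs_rate_integral ennreal_leI)
qed

text \<open>The variable representing h is an L2 limit of evaluation sums. Pairing with
  \<open>Z\<close> is L2-continuous, so the paths converge, and \<open>var T c\<close> is the
  squared norm of the approximant.\<close>

lemma rkhs_rate_approximation:
  assumes h: "rate h = ennreal l" and l: "0 \<le> l" and e: "0 < e"
  obtains T c where "finite T" "dist h (paired (\<lambda>x. eval_sum T c (Z x))) < e" "var T c / 2 < l + e"
proof -
  have v: "finite T \<Longrightarrow> T \<subseteq> UNIV \<Longrightarrow> (\<Sum>s\<in>T. c s * val h s)^2 \<le> 2 * l * var T c" for T c
    using rkhs_rate_le_iff[OF l, of h] h unfolding eval_sum_def by simp
  obtain \<xi> where \<xi>: "\<xi> \<in> gaussian_space N Z" "(L2_norm_of N \<xi>)^2 \<le> 2 * l"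
    "\<forall>s\<in>UNIV. (LINT x|N. \<xi> x * val (Z x) s) = val h s"
    "\<forall>\<delta>>0. \<exists>T c. finite T \<and> L2_norm_of N (\<lambda>x. \<xi> x - eval_sum T c (Z x)) < \<delta>"
    by (rule gaussian_space_representation[OF l v])
  have sq: "square_integrable N \<xi>" using \<xi>(1) by (simp add: gaussian_space_def)
  have hI: "h = paired \<xi>" using sq \<xi>(3) by (auto intro: path_eq_integralI)
  define A where "A = L2_norm_of N \<xi>"
  define B where "B = L2_norm_of N (\<lambda>x. norm (Z x))"
  have AB: "0 \<le> A" "0 \<le> B" by (simp_all add: A_def B_def L2_norm_of_nonneg)
  \<comment> \<open>With A the norm of \<xi> and B that of the path norm, an L2 error D moves the
    path by at most D * B and the variance by at most 2 A D + D^2. The cap 1 bounds D^2 by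
    D.\<close>
  define \<delta> where "\<delta> = min 1 (e / (2 * A + 1 + B))"
  have pos: "0 < 2 * A + 1 + B" using AB by linarith
  have \<delta>: "0 < \<delta>" "\<delta> \<le> 1" "\<delta> * (2 * A + 1 + B) \<le> e"
    using e pos by (auto simp: \<delta>_def min_def pos_le_divide_eq not_le less_imp_le)
  obtain T c where T: "finite T" "L2_norm_of N (\<lambda>x. \<xi> x - eval_sum T c (Z x)) < \<delta>" using \<xi>(4) \<delta>(1) by blast
  define D where "D = L2_norm_of N (\<lambda>x. \<xi> x - eval_sum T c (Z x))"
  have D: "0 \<le> D" "D < \<delta>" using T by (simp_all add: D_def L2_norm_of_nonneg)
  note sT = square_integrable_eval_sum[of T c]
  have sd: "square_integrable N (\<lambda>x. \<xi> x - eval_sum T c (Z x))"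
    using square_integrable_lincomb(1)[OF sq sT, of "-1"] by simp
  have "h - (paired (\<lambda>x. eval_sum T c (Z x))) = (paired (\<lambda>x. \<xi> x - eval_sum T c (Z x)))"
    unfolding hI using integrable_scaleR_path[OF sq] integrable_scaleR_path[OF sT] by (simp add: scaleR_left_diff_distrib)
  then have "dist h (paired (\<lambda>x. eval_sum T c (Z x))) \<le> D * B"
    using norm_integral_path_le[OF sd] by (simp add: dist_norm D_def B_def)
  also have "\<dots> \<le> \<delta> * B" using D AB by (intro mult_right_mono) auto
  also have "\<dots> < \<delta> * (2 * A + 1 + B)" using \<delta> AB by (intro mult_strict_left_mono) auto
  also have "\<dots> \<le> e" by fact
  finally have 1: "dist h (paired (\<lambda>x. eval_sum T c (Z x))) < e" .
  have "var T c = (LINT x|N. (\<xi> x + (-1) * (\<xi> x - eval_sum T c (Z x)))^2)" by (simp add: var_def)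
  also have "\<dots> = A^2 - 2 * (LINT x|N. \<xi> x * (\<xi> x - eval_sum T c (Z x))) + D^2"
    unfolding square_integrable_lincomb(2)[OF sq sd] by (simp add: A_def D_def L2_norm_of_power2)
  also have "\<dots> \<le> A\<^sup>2 + 2 * (A * D) + D^2"
    using L2_abs_inner_le[OF sq sd] by (simp add: A_def D_def abs_le_iff)
  also have "\<dots> \<le> 2 * l + D * (2 * A + 1)"
    using \<xi>(2) D \<delta>(2) mult_left_mono[of D 1 D] by (simp add: A_def power2_eq_square algebra_simps)
  also have "D * (2 * A + 1) \<le> \<delta> * (2 * A + 1 + B)" using D AB by (intro mult_mono) auto
  also have "\<dots> \<le> e" by fact
  finally have "var T c / 2 < l + e" using e by simp
  with 1 T(1) show ?thesis using that by blast
qed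

lemma oscillation_var_tendsto_0:
  "(\<lambda>n. LINT x|N. (osc (1 / real (Suc n)) (Z x))^2) \<longlonglongrightarrow> 0"
proof -
  have "(\<lambda>n. LINT x|N. (osc (1 / real (Suc n)) (Z x))^2) \<longlonglongrightarrow> (LINT x|N. 0)"
  proof (rule integral_dominated_convergence[where w="\<lambda>x. 4 * (norm (Z x))^2"])
    show "integrable N (\<lambda>x. 4 * (norm (Z x))^2)"
      using gaussian_path_norm_square_integrable[OF gaussian] by simp
    show "AE x in N. (\<lambda>n. (osc (1 / real (Suc n)) (Z x))^2) \<longlonglongrightarrow> 0"
      using osc_tendsto_0 by (intro AE_I2) simp
    show "AE x in N. norm ((osc (1 / real (Suc n)) (Z x))^2) \<le> 4 * (norm (Z x))^2" for n
    proof (rule AE_I2)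
      fix x
      have "(osc (1 / real (Suc n)) (Z x))^2 \<le> (2 * norm (Z x))^2"
        by (intro power_mono osc_le_norm osc_nonneg) auto
      then show "norm ((osc (1 / real (Suc n)) (Z x))^2) \<le> 4 * (norm (Z x))^2"
        by (simp add: power_mult_distrib)
    qed
    show "(\<lambda>x. (osc (1 / real (Suc n)) (Z x))^2) \<in> borel_measurable N" for n
      using osc_measurable[of "1 / real (Suc n)", measurable] by measurable
  qed auto
  then show ?thesis by simp
qed

text \<open>A path of rate at most l satisfies (h s - h t)^2 \<le> 2 l E (Z s - Z t)^2, so its
  modulus of continuity is controlled by the mean square oscillation of \<open>Z\<close>, which
  vanishes with the mesh.\<close>

lemma level_oscillation:
  assumes l: "0 \<le> l" and e: "0 < e"
  shows "\<exists>r>0. \<forall>h\<in>{h. rate h \<le> ennreal l}. osc r h \<le> e"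
proof -
  \<comment> \<open>The summand 1 covers l = 0.\<close>
  have "0 < e^2 / (2 * l + 1)" using l e by simp
  then obtain n where n: "(LINT x|N. (osc (1 / real (Suc n)) (Z x))^2) < e^2 / (2 * l + 1)"
    using LIMSEQ_ex_less[OF oscillation_var_tendsto_0] by blast
  define r where "r = 1 / real (Suc n)"
  have r: "0 < r" by (simp add: r_def)
  have osq: "square_integrable N (\<lambda>x. osc r (Z x))"
  proof -
    note [measurable] = osc_measurable[OF r]
    have "integrable N (\<lambda>x. (osc r (Z x))^2)"
    proof (rule Bochner_Integration.integrable_bound)
      show "integrable N (\<lambda>x. 4 * (norm (Z x))^2)"
        using gaussian_path_norm_square_integrable[OF gaussian] by simp
      show "AE x in N. norm ((osc r (Z x))^2) \<le> norm (4 * (norm (Z x))^2)"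
      proof (rule AE_I2)
        fix x
        have "(osc r (Z x))^2 \<le> (2 * norm (Z x))^2"
          by (intro power_mono osc_le_norm osc_nonneg r)
        then show "norm ((osc r (Z x))^2) \<le> norm (4 * (norm (Z x))^2)"
          by (simp add: power_mult_distrib)
      qed
    qed measurable
    then show ?thesis by (simp add: square_integrable_def)
  qed
  have "osc r h \<le> e" if h: "rate h \<le> ennreal l" for h
  proof (rule osc_least[OF r])
    fix s t :: 'a assume st: "dist s t < r"
    define c where "c u = (if u = s then 1 else 0) + (if u = t then -1 else 0 :: real)" for u
    have c: "eval_sum {s, t} c f = val f s - val f t" for f
      unfolding c_def eval_sum_add[symmetric] by (simp add: eval_sum_single)
    have "(val h s - val h t)^2 \<le> 2 * l * var {s, t} c"
      using rkhs_rate_le_iff[OF l, of h] h unfolding c[symmetric] by simp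
    also have "var {s, t} c \<le> (LINT x|N. (osc r (Z x))^2)"
      unfolding var_def
    proof (rule integral_mono)
      show "(eval_sum {s, t} c (Z x))^2 \<le> (osc r (Z x))^2" for x
        unfolding c using osc_upper[OF st, of "Z x"] by (rule power2_le_iff_abs_le[THEN iffD2, rotated]) (rule osc_nonneg[OF r])
    qed (use square_integrable_eval_sum osq in \<open>auto simp: square_integrable_def\<close>)
    also have "\<dots> \<le> e\<^sup>2 / (2 * l + 1)" using n by (simp add: r_def)
    also have "2 * l * (e^2 / (2 * l + 1)) \<le> e\<^sup>2" using l by (simp add: divide_le_eq field_simps)
    finally have "(val h s - val h t)^2 \<le> e\<^sup>2" using l by (auto simp: mult_left_mono)
    then show "\<bar>val h s - val h t\<bar> \<le> e" using e by (simp add: abs_le_square_iff[symmetric])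
  qed
  then show ?thesis using r by blast
qed

lemma compact_level:
  assumes l: "0 \<le> l"
  shows "compact {h. rate h \<le> ennreal l}"
proof (rule compact_bcontfun_equicontinuous)
  have "{h. rate h \<le> ennreal l} = (\<Inter>T\<in>{T. finite T}. \<Inter>c. {h. (eval_sum T c h)^2 \<le> 2 * l * var T c})"
    by (auto simp: rkhs_rate_le_iff[OF l])
  also have "closed \<dots>"
    by (intro closed_INT ballI closed_Collect_le continuous_intros continuous_on_eval_sum)
  finally show "closed {h. rate h \<le> ennreal l}" .
  fix h assume h: "h \<in> {h. rate h \<le> ennreal l}"
  show "norm h \<le> sqrt (2 * l * (LINT x|N. (norm (Z x))^2))"
  proof (rule norm_bound)
    fix s
    have "(eval_sum {s} (\<lambda>_. 1) h)^2 \<le> 2 * l * var {s} (\<lambda>_. 1)"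
      using h rkhs_rate_le_iff[OF l, of h] by simp
    also have "\<dots> \<le> 2 * l * (LINT x|N. (norm (Z x))^2)"
      unfolding var_def
    proof (intro mult_left_mono integral_mono)
      show "(eval_sum {s} (\<lambda>_. 1) (Z x))^2 \<le> (norm (Z x))^2" for x
        using abs_apply_le_norm[of "Z x" s] by (simp add: eval_sum_def power2_le_iff_abs_le)
    qed (use l square_integrable_eval_sum square_integrable_norm in \<open>auto simp: square_integrable_def\<close>)
    finally have "\<bar>val h s\<bar>\<^sup>2 \<le> 2 * l * (LINT x|N. (norm (Z x))^2)" by (simp add: eval_sum_def)
    then show "norm (val h s) \<le> sqrt (2 * l * (LINT x|N. (norm (Z x))^2))"
      unfolding real_norm_def by (rule real_le_rsqrt)
  qed
qed (use level_oscillation[OF l] in blast)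

lemma rate_function_rkhs_rate: "rate_function (rate)"
  unfolding rate_function_def
proof (intro conjI allI impI compact_level)
  fix a :: ennreal
  show "open {h. a < rate h}"
  proof (cases a)
    case (real l)
    have "{h. a < rate h} = - {h. rate h \<le> ennreal l}"
      using real by (auto simp: not_le)
    then show ?thesis using compact_imp_closed[OF compact_level[OF real(1)]] by (simp add: open_Compl)
  qed simp
qed

end

section \<open>Exponential estimates\<close>

context gaussian_path_space begin

text \<open>Suppose no functional separates. Optimising the linear inequality over multiples of c
  turns it into the quadratic one of the rate characterisation, and the representation over
  \<open>T\<close> yields a path of rate at most l with exactly the values v on the grid, against
  the hypothesis.\<close>

lemma exists_halfspace:
  assumes T: "finite T" and l: "0 \<le> l" and r: "0 < r"
    and v: "\<And>f. rate f \<le> ennreal l \<Longrightarrow> \<exists>t\<in>T. r \<le> \<bar>v t - val f t\<bar>"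
  shows "\<exists>c. l + var T c / 2 < (\<Sum>t\<in>T. c t * v t)"
proof (rule ccontr)
  assume "\<nexists>c. l + var T c / 2 < (\<Sum>t\<in>T. c t * v t)"
  then have le: "(\<Sum>t\<in>T. c t * v t) \<le> l + var T c / 2" for c by (auto simp: not_less)
  have quad: "(\<Sum>t\<in>T. c t * v t)^2 \<le> 2 * l * var T c" for c
  proof -
    define A where "A = (\<Sum>t\<in>T. c t * v t)"
    define B where "B = var T c"
    have B: "0 \<le> B" by (simp add: B_def var_def)
    have k: "k * A \<le> l + k^2 * B / 2" for k
      using le[of "\<lambda>t. k * c t"] unfolding var_def eval_sum_scale A_def B_def
      by (simp add: sum_distrib_left mult.assoc power_mult_distrib)
    show ?thesis
    \<comment> \<open>If the variance vanishes, the bound k * A \<le> l for all k forces A = 0;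
      otherwise k = A / B is the optimal multiplier.\<close>
    proof (cases "B = 0")
      case True
      have "A = 0"
      proof (rule ccontr)
        assume "A \<noteq> 0"
        then show False using k[of "(l + 1) / A"] True by simp
      qed
      then show ?thesis using True by (simp add: A_def B_def)
    next
      case False
      then have "0 < B" using B by simp
      have e: "A / B * A = A^2 / B" "(A / B)^2 * B / 2 = A^2 / B / 2"
        using False by (simp_all add: power2_eq_square)
      have "x \<le> l + x / 2 \<Longrightarrow> x \<le> 2 * l" for x :: real by simp
      from this[OF k[of "A / B", unfolded e]] have "A\<^sup>2 / B \<le> 2 * l" .
      then show ?thesis using \<open>0 < B\<close> by (simp add: A_def B_def pos_divide_le_eq)
    qed
  qed
  have v': "(\<Sum>s\<in>T'. c s * v s)^2 \<le> 2 * l * var T' c" if "finite T'" "T' \<subseteq> T" for T' c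
  proof -
    have "(\<Sum>t\<in>T. (if t \<in> T' then c t else 0) * v t) = (\<Sum>t\<in>T'. (if t \<in> T' then c t else 0) * v t)"
      using T that by (intro sum.mono_neutral_right) auto
    also have "\<dots> = (\<Sum>s\<in>T'. c s * v s)" by simp
    finally show ?thesis
      using quad[of "\<lambda>t. if t \<in> T' then c t else 0"]
      unfolding var_def eval_sum_extend[OF T that(2), symmetric] by simp
  qed
  obtain \<xi> where \<xi>: "\<xi> \<in> gaussian_space N Z" "(L2_norm_of N \<xi>)^2 \<le> 2 * l"
    "\<forall>s\<in>T. (LINT x|N. \<xi> x * val (Z x) s) = v s"
    "\<forall>\<delta>>0. \<exists>T c. finite T \<and> L2_norm_of N (\<lambda>x. \<xi> x - eval_sum T c (Z x)) < \<delta>"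
    by (rule gaussian_space_representation[OF l v'])
  have "rate (paired \<xi>) \<le> ennreal l"
    unfolding rkhs_rate_integral[OF \<xi>(1)] using \<xi>(2) by (intro ennreal_leI) simp
  from v[OF this] obtain t where "t \<in> T" "r \<le> \<bar>v t - val (paired \<xi>) t\<bar>" by blast
  moreover have "val (paired \<xi>) t = v t" if "t \<in> T" for t
    using \<xi>(1,3) that by (subst blinfun_integral_path[OF _ bounded_linear_eval]) (auto simp: gaussian_space_def)
  ultimately show False using r by simp
qed

text \<open>The set of admissible grid values is closed in the product topology, so Tychonoff's theorem
  gives a finite subcover of its bounded part; the unbounded part is covered by coordinate half-spaces.\<close>

lemma finite_halfspace_cover:
  assumes T: "finite T" and l: "0 \<le> l" and r: "0 < r"
  obtains C where "finite C"
    "\<forall>v. (\<forall>f. rate f \<le> ennreal l \<longrightarrow> (\<exists>t\<in>T. r \<le> \<bar>v t - val f t\<bar>))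
      \<longrightarrow> (\<exists>c\<in>C. l + var T c / 2 < (\<Sum>t\<in>T. c t * v t))"
proof -
  define e where "e \<sigma> t = (\<lambda>u. if u = t then \<sigma> else 0 :: real)" for \<sigma> :: real and t :: 'a
  have e: "(\<Sum>u\<in>T. e \<sigma> t u * v u) = \<sigma> * v t" if "t \<in> T" for \<sigma> t and v :: "'a \<Rightarrow> real"
    using T that by (simp add: e_def if_distrib[where f="\<lambda>x. x * _"] sum.delta cong: if_cong)
  \<comment> \<open>Beyond R a single coordinate with sign 1 or -1 already satisfies the half-space
    inequality.\<close>
  define R where "R = l + (\<Sum>t\<in>T. var T (e 1 t))"
  have var_neg: "var T (e (-1) t) = var T (e 1 t)" for t
    using eval_sum_scale[of T "-1" "e 1 t"] by (simp add: var_def e_def if_distrib cong: if_cong)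
  have var0: "0 \<le> var T c" for c by (simp add: var_def)
  have eR: "l + var T (e 1 t) / 2 \<le> R" if "t \<in> T" for t
  proof -
    have "var T (e 1 t) \<le> (\<Sum>t\<in>T. var T (e 1 t))" using T that var0 by (intro member_le_sum) auto
    then show ?thesis using var0[of "e 1 t"] unfolding R_def by linarith
  qed
  define adm where "adm v \<longleftrightarrow> (\<forall>f. rate f \<le> ennreal l \<longrightarrow> (\<exists>t\<in>T. r \<le> \<bar>v t - val f t\<bar>))"
    for v :: "'a \<Rightarrow> real"
  \<comment> \<open>Coordinates outside \<open>T\<close> are confined to the same interval, so that
    the box over the whole index type is compact; the truncation \<open>w\<close> below is zero
    there.\<close>
  define K where "K = (\<Pi>\<^sub>E t\<in>UNIV. {- R..R}) \<inter> {v. adm v}"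
  have "compactin (product_topology (\<lambda>_. euclidean) UNIV) (\<Pi>\<^sub>E t\<in>(UNIV :: 'a set). {- R..R})"
    unfolding compactin_PiE by (simp add: compactin_euclidean_iff)
  then have "compact (\<Pi>\<^sub>E t\<in>(UNIV :: 'a set). {- R..R})"
    by (simp add: euclidean_product_topology compactin_euclidean_iff)
  moreover have "closed {v. adm v}"
  proof -
    have "{v. adm v} = (\<Inter>f\<in>{f. rate f \<le> ennreal l}. \<Union>t\<in>T. {v. r \<le> \<bar>v t - val f t\<bar>})"
      unfolding adm_def by auto
    also have "closed \<dots>"
      using T by (intro closed_INT ballI closed_UN closed_Collect_le continuous_intros continuous_on_product_coordinates)
    finally show ?thesis .
  qed
  ultimately have K: "compact K" unfolding K_def by (rule compact_Int_closed)
  define U where "U c = {v. l + var T c / 2 < (\<Sum>t\<in>T. c t * v t)}" for c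
  have "open (U c)" for c
    unfolding U_def by (intro open_Collect_less continuous_intros continuous_on_product_coordinates)
  moreover have "K \<subseteq> (\<Union>c\<in>UNIV. U c)"
  proof
    fix v assume "v \<in> K"
    then have "adm v" by (simp add: K_def)
    then obtain c where "l + var T c / 2 < (\<Sum>t\<in>T. c t * v t)"
      using exists_halfspace[OF T l r, of v] unfolding adm_def by blast
    then show "v \<in> (\<Union>c\<in>UNIV. U c)" by (auto simp: U_def)
  qed
  ultimately obtain C0 where C0: "finite C0" "K \<subseteq> (\<Union>c\<in>C0. U c)"
    by (rule compactE_image[OF K, of UNIV U])
  define C where "C = C0 \<union> e 1 ` T \<union> e (-1) ` T"
  have "\<exists>c\<in>C. l + var T c / 2 < (\<Sum>t\<in>T. c t * v t)" if v: "adm v" for v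
  proof (cases "\<forall>t\<in>T. \<bar>v t\<bar> \<le> R")
    case True
    have "0 \<le> R" using l var0 by (simp add: R_def sum_nonneg)
    define w where "w t = (if t \<in> T then v t else 0)" for t
    have "adm w" using v by (auto simp: adm_def w_def)
    then have "w \<in> K" using True \<open>0 \<le> R\<close> by (auto simp: K_def w_def abs_le_iff minus_le_iff)
    then obtain c where "c \<in> C0" "w \<in> U c" using C0(2) by blast
    then show ?thesis by (intro bexI[of _ c]) (auto simp: U_def w_def C_def)
  next
    case False
    then obtain t where t: "t \<in> T" "R < \<bar>v t\<bar>" by (auto simp: not_le)
    show ?thesis
    proof (cases "0 \<le> v t")
      case True
      then show ?thesis using t eR[OF t(1)] by (intro bexI[of _ "e 1 t"]) (auto simp: e C_def)
    next
      case False
      then show ?thesis using t eR[OF t(1)] by (intro bexI[of _ "e (-1) t"]) (auto simp: e var_neg C_def)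
    qed
  qed
  moreover have "finite C" using C0(1) T by (simp add: C_def)
  ultimately show ?thesis using that[of C] by (simp add: adm_def)
qed

end

section \<open>Exponential moments and exponential equicontinuity of the rescaled family\<close>

lemma (in prob_space) integrable_indicator_event:
  "A \<in> events \<Longrightarrow> integrable M (indicator A :: 'a \<Rightarrow> real)"
  by (rule integrable_real_indicator) (simp_all add: emeasure_eq_measure)

lemma (in prob_space) exponential_Markov:
  assumes [measurable]: "V \<in> borel_measurable M" and i: "integrable M (\<lambda>x. exp (V x))"
  shows "prob {x\<in>space M. b < V x} \<le> exp (- b) * (LINT x|M. exp (V x))"
proof -
  have "prob {x\<in>space M. b < V x} = (LINT x|M. indicator {x\<in>space M. b < V x} x)" by simp
  also have "\<dots> \<le> (LINT x|M. exp (- b) * exp (V x))"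
  proof (rule integral_mono)
    show "indicator {x\<in>space M. b < V x} x \<le> exp (- b) * exp (V x)" for x
      by (auto simp: indicator_def simp flip: exp_add)
    show "integrable M (indicator {x\<in>space M. b < V x} :: 'a \<Rightarrow> real)"
      by (rule integrable_indicator_event) simp
  qed (use i in simp)
  finally show ?thesis by simp
qed

text \<open>Abstracts from the time change: Gaussian paths whose rescalings by
  \<open>sqrt (g i)\<close> converge in law to \<open>Z\<close>. Gaussianity is required only
  eventually along the filter, as suits small times.\<close>

locale small_noise_gaussian = prob_space M + N: prob_space N
  for M :: "'w measure" and N :: "'v measure" +
  fixes F :: "'i filter" and g :: "'i \<Rightarrow> real"
    and W :: "'i \<Rightarrow> 'w \<Rightarrow> 'a::compact_metric_space \<Rightarrow>\<^sub>C real"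
    and Z :: "'v \<Rightarrow> 'a \<Rightarrow>\<^sub>C real"
  assumes F: "F \<noteq> bot" and g: "filterlim g at_top F"
    and W: "\<forall>\<^sub>F i in F. gaussian_path M (W i)"
    and Z[measurable]: "Z \<in> borel_measurable N"
    and weak: "\<And>\<phi> :: ('a \<Rightarrow>\<^sub>C real) \<Rightarrow>\<^sub>C real.
      ((\<lambda>i. LINT x|M. val \<phi> (sqrt (g i) *\<^sub>R W i x)) \<longlongrightarrow> (LINT x|N. val \<phi> (Z x))) F"
begin

lemma eventually_pos: "\<forall>\<^sub>F i in F. gaussian_path M (W i) \<and> 0 < g i"
  using W filterlim_at_top_dense[THEN iffD1, OF g, rule_format, of 0] by eventually_elim simp

lemma weak_tendsto:
  assumes "continuous_on UNIV \<phi>" "\<And>f. \<bar>\<phi> f\<bar> \<le> B"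
  shows "((\<lambda>i. LINT x|M. \<phi> (sqrt (g i) *\<^sub>R W i x)) \<longlongrightarrow> (LINT x|N. \<phi> (Z x) :: real)) F"
proof -
  have "\<phi> \<in> bcontfun"
    using assms by (auto simp: bcontfun_def intro!: boundedI)
  then show ?thesis using weak[of "Bcontfun \<phi>"] by (simp add: Bcontfun_inverse)
qed

lemma eval_sum_limit:
  assumes T: "finite T"
  shows "centered_gaussian N (\<lambda>x. eval_sum T c (Z x))"
    and "((\<lambda>i. LINT x|M. (eval_sum T c (sqrt (g i) *\<^sub>R W i x))^2) \<longlongrightarrow> (LINT x|N. (eval_sum T c (Z x))^2)) F"
proof -
  have G: "\<forall>\<^sub>F i in F. centered_gaussian M (\<lambda>x. \<theta> * eval_sum T c (sqrt (g i) *\<^sub>R W i x))" for \<theta>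
    using W
  proof eventually_elim
    case (elim i)
    then have "centered_gaussian M (\<lambda>x. eval_sum T (\<lambda>s. (\<theta> * sqrt (g i)) * c s) (W i x))"
      using T unfolding gaussian_path_def by blast
    then show ?case unfolding eval_sum_scale eval_sum_scaleR by (simp add: mult.assoc)
  qed
  have c: "((\<lambda>i. LINT x|M. cos (\<theta> * eval_sum T c (sqrt (g i) *\<^sub>R W i x))) \<longlongrightarrow> (LINT x|N. cos (\<theta> * eval_sum T c (Z x)))) F"
    and s: "((\<lambda>i. LINT x|M. sin (\<theta> * eval_sum T c (sqrt (g i) *\<^sub>R W i x))) \<longlongrightarrow> (LINT x|N. sin (\<theta> * eval_sum T c (Z x)))) F"
    for \<theta>
    by (rule weak_tendsto[where B=1], intro continuous_intros continuous_on_eval_sum, simp)+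
  show "centered_gaussian N (\<lambda>x. eval_sum T c (Z x))"
    "((\<lambda>i. LINT x|M. (eval_sum T c (sqrt (g i) *\<^sub>R W i x))^2) \<longlongrightarrow> (LINT x|N. (eval_sum T c (Z x))^2)) F"
    using gaussian_weak_limit[OF prob_space_axioms N.prob_space_axioms F G _ c s] by auto
qed

text \<open>Gaussianity of the limit, just derived from weak convergence, gives access to the whole
  RKHS theory for \<open>Z\<close>.\<close>

sublocale gaussian_path_space N Z
  by standard (simp add: gaussian_path_def eval_sum_limit)

definition scaled_var :: "'i \<Rightarrow> 'a set \<Rightarrow> ('a \<Rightarrow> real) \<Rightarrow> real"
  where "scaled_var i T c = g i * (LINT x|M. (eval_sum T c (W i x))^2)"

abbreviation mass :: "'i \<Rightarrow> 'a set \<Rightarrow> ('a \<Rightarrow> real) \<Rightarrow> real"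
  where "mass i T c \<equiv> exp (g i * scaled_var i T c / 2)"

text \<open>The exponentially tilted measure, left unnormalised; \<open>mass\<close> is its total
  mass by \<open>exp_moment\<close>, for eventually all i.\<close>

abbreviation tilted :: "'i \<Rightarrow> 'a set \<Rightarrow> ('a \<Rightarrow> real) \<Rightarrow> 'w set \<Rightarrow> real"
  where "tilted i T c Y \<equiv> (LINT x|M. indicator Y x * exp (g i * eval_sum T c (W i x)))"

lemma scaled_var_tendsto:
  assumes "finite T"
  shows "((\<lambda>i. scaled_var i T c) \<longlongrightarrow> var T c) F"
  unfolding var_def
proof (rule tendsto_cong[THEN iffD1, OF _ eval_sum_limit(2)[OF assms, of c]])
  show "\<forall>\<^sub>F i in F. (LINT x|M. (eval_sum T c (sqrt (g i) *\<^sub>R W i x))^2) = scaled_var i T c"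
    using eventually_pos
    by eventually_elim (simp add: scaled_var_def eval_sum_scaleR power_mult_distrib)
qed

lemma exp_moment:
  assumes i: "gaussian_path M (W i)" "0 < g i" and T: "finite T"
  shows "integrable M (\<lambda>x. exp (g i * eval_sum T c (W i x)))"
    and "(LINT x|M. exp (g i * eval_sum T c (W i x))) = mass i T c"
proof -
  have G: "centered_gaussian M (\<lambda>x. eval_sum T (\<lambda>s. g i * c s) (W i x))"
    using i(1) T unfolding gaussian_path_def by blast
  show "integrable M (\<lambda>x. exp (g i * eval_sum T c (W i x)))"
    using centered_gaussian_exp_integrable[OF G] by (simp add: eval_sum_scale)
  show "(LINT x|M. exp (g i * eval_sum T c (W i x))) = mass i T c"
    using centered_gaussian_mgf[OF G]
    by (simp add: eval_sum_scale scaled_var_def power_mult_distrib power2_eq_square[of "g i"] mult.assoc)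
qed

text \<open>Exponential Markov with parameter \<open>g i\<close>; any further multiplier is absorbed
  into c.\<close>

lemma halfspace_prob_le:
  assumes i: "gaussian_path M (W i)" "0 < g i" and T: "finite T"
  shows "prob {x\<in>space M. b < eval_sum T c (W i x)} \<le> exp (g i * (scaled_var i T c / 2 - b))"
proof -
  have [measurable]: "W i \<in> borel_measurable M" using i by (simp add: gaussian_path_def)
  have "prob {x\<in>space M. b < eval_sum T c (W i x)} = prob {x\<in>space M. g i * b < g i * eval_sum T c (W i x)}"
    using i(2) by simp
  also have "\<dots> \<le> exp (- (g i * b)) * mass i T c"
    using exponential_Markov[of "\<lambda>x. g i * eval_sum T c (W i x)" "g i * b"] exp_moment[OF i T, of c] by simp
  finally show ?thesis by (simp add: exp_add[symmetric] right_diff_distrib)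
qed

text \<open>On the scale of the rescaled paths the threshold becomes \<delta> * sqrt (g i), so
  Fernique's bound is exp (- \<delta>^2 * g i / (32 s^2)). A small s gives any rate, and weak
  convergence provides a mesh r at which the oscillation exceeds s with probability at most
  1/4.\<close>

lemma exponential_equicontinuity:
  assumes \<delta>: "0 < \<delta>" and a: "0 \<le> a"
  obtains r where "0 < r" "\<forall>\<^sub>F i in F. prob {x\<in>space M. osc r (W i x) > \<delta>} \<le> exp (- (a * g i))"
proof -
  \<comment> \<open>Chosen so that Fernique's exponent is exactly (a + 1) * g i; the summand 1
    allows a = 0.\<close>
  define s where "s = \<delta> / sqrt (32 * (a + 1))"
  have s: "0 < s" "32 * s^2 * (a + 1) = \<delta>^2" using \<delta> a by (simp_all add: s_def power_divide field_simps)
  \<comment> \<open>A continuous function with values in [0, 1] that equals 1 where the oscillation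
    exceeds s. Dominated convergence makes its integral small for the limit, and weak convergence
    transfers this to the family.\<close>
  define \<phi> where "\<phi> n f = min 1 (osc (1 / real (Suc n)) f / s)" for n and f :: "'a \<Rightarrow>\<^sub>C real"
  have \<phi>c: "continuous_on UNIV (\<phi> n)" for n
    unfolding \<phi>_def using s(1) by (intro continuous_intros continuous_on_osc) auto
  have \<phi>b: "0 \<le> \<phi> n f" "\<phi> n f \<le> 1" for n f
    using s(1) osc_nonneg[of "1 / real (Suc n)" f] by (auto simp: \<phi>_def)
  have \<phi>m[measurable]: "\<phi> n \<in> borel_measurable borel" for n
    by (rule borel_measurable_continuous_onI[OF \<phi>c])
  have "(\<lambda>n. LINT x|N. \<phi> n (Z x)) \<longlonglongrightarrow> (LINT x|N. 0)"
  proof (rule integral_dominated_convergence[where w="\<lambda>_. 1"])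
    have "(\<lambda>n. \<phi> n (Z x)) \<longlonglongrightarrow> min 1 (0 / s)" for x
      unfolding \<phi>_def using s(1) by (intro tendsto_intros osc_tendsto_0) auto
    then show "AE x in N. (\<lambda>n. \<phi> n (Z x)) \<longlonglongrightarrow> 0" by simp
    show "AE x in N. norm (\<phi> n (Z x)) \<le> 1" for n using \<phi>b by simp
  qed auto
  then obtain n where n: "(LINT x|N. \<phi> n (Z x)) < 1 / 4"
    using LIMSEQ_ex_less[of _ _ "1 / 4"] by force
  define r where "r = 1 / real (Suc n)"
  have r: "0 < r" by (simp add: r_def)
  have "((\<lambda>i. LINT x|M. \<phi> n (sqrt (g i) *\<^sub>R W i x)) \<longlongrightarrow> (LINT x|N. \<phi> n (Z x))) F"
    using \<phi>b by (intro weak_tendsto[OF \<phi>c, where B=1]) (auto simp: abs_le_iff intro: order_trans[of _ 0])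
  then have "\<forall>\<^sub>F i in F. (LINT x|M. \<phi> n (sqrt (g i) *\<^sub>R W i x)) < 1 / 4"
    using n by (rule order_tendstoD(2))
  \<comment> \<open>This is the condition 4 s \<le> \<delta> * sqrt (g i), where Fernique's tail
    begins.\<close>
  moreover have "\<forall>\<^sub>F i in F. 16 * s^2 / \<delta>^2 \<le> g i"
    using g by (simp add: filterlim_at_top)
  ultimately have "\<forall>\<^sub>F i in F. prob {x\<in>space M. osc r (W i x) > \<delta>} \<le> exp (- (a * g i))"
    using eventually_pos
  proof eventually_elim
    case (elim i)
    define k where "k = sqrt (g i)"
    have k: "0 < k" "k\<^sup>2 = g i" using elim by (simp_all add: k_def)
    define Y where "Y x = k *\<^sub>R W i x" for x
    have [measurable]: "W i \<in> borel_measurable M" using elim by (simp add: gaussian_path_def)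
    have Ym[measurable]: "Y \<in> borel_measurable M" unfolding Y_def by measurable
    note [measurable] = osc_measurable[OF r]
    have Y: "gaussian_path M Y"
    proof -
      have "centered_gaussian M (\<lambda>x. eval_sum T (\<lambda>s. k * c s) (W i x))" if "finite T" for T c
        using elim that unfolding gaussian_path_def by blast
      then show ?thesis using Ym by (simp add: gaussian_path_def Y_def eval_sum_scale eval_sum_scaleR)
    qed
    have "prob {x\<in>space M. osc r (Y x) > s} = (LINT x|M. indicator {x\<in>space M. osc r (Y x) > s} x)"
      by simp
    also have "\<dots> \<le> (LINT x|M. \<phi> n (Y x))"
    proof (rule integral_mono)
      show "indicator {x\<in>space M. osc r (Y x) > s} x \<le> \<phi> n (Y x)" for x
        using \<phi>b s(1) by (auto simp: indicator_def \<phi>_def r_def)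
      show "integrable M (\<lambda>x. \<phi> n (Y x))" using \<phi>b by (intro integrable_const_bound[where B=1]) auto
      show "integrable M (indicator {x\<in>space M. osc r (Y x) > s} :: 'w \<Rightarrow> real)"
        by (rule integrable_indicator_event) simp
    qed
    also have "\<dots> \<le> 1 / 4" using elim by (simp add: Y_def k_def)
    finally have q: "prob {x\<in>space M. osc r (Y x) > s} \<le> 1 / 4" .
    have "(4 * s)^2 \<le> (\<delta> * k)^2"
      using elim(2) \<delta> by (simp add: power_mult_distrib k(2) divide_le_eq mult.commute)
    then have t: "4 * s \<le> \<delta> * k" using \<delta> k(1) by (intro power2_le_imp_le[of "4 * s" "\<delta> * k"]) auto
    have "prob {x\<in>space M. osc r (W i x) > \<delta>} = prob {x\<in>space M. osc r (Y x) > \<delta> * k}"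
      using k(1) by (simp add: Y_def osc_scaleR[OF r k(1)] mult.commute)
    also have "\<dots> \<le> exp (- (\<delta> * k)\<^sup>2 / (32 * s^2))"
      by (rule gaussian_path_oscillation_tail[OF Y r s(1) q t])
    also have "(\<delta> * k)^2 / (32 * s^2) = (a + 1) * g i"
      unfolding power_mult_distrib k(2) s(2)[symmetric] using s(1) by simp
    then have "exp (- (\<delta> * k)\<^sup>2 / (32 * s^2)) = exp (- ((a + 1) * g i))" by simp
    also have "\<dots> \<le> exp (- (a * g i))" using elim by (simp add: distrib_right)
    finally show ?case .
  qed
  then show ?thesis using that[OF r] by blast
qed

end

section \<open>Upper and lower bounds\<close>

lemma compact_closed_dist_pos:
  fixes L A :: "'b::metric_space set"
  assumes "compact L" "closed A" "L \<inter> A = {}"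
  shows "\<exists>d>0. \<forall>x\<in>L. \<forall>y\<in>A. d \<le> dist x y"
proof (cases "L = {} \<or> A = {}")
  case False
  then obtain x0 where x0: "x0 \<in> L" "\<forall>x\<in>L. infdist x0 A \<le> infdist x A"
    using continuous_attains_inf[OF assms(1) _ continuous_on_infdist[OF continuous_on_id], of A] by metis
  have "infdist x0 A \<noteq> 0" using in_closed_iff_infdist_zero[OF assms(2)] False x0(1) assms(3) by auto
  then have "0 < infdist x0 A" using infdist_nonneg[of x0 A] by linarith
  moreover have "infdist x0 A \<le> dist x y" if "x \<in> L" "y \<in> A" for x y
    using x0(2) that infdist_le[of y A x] by force
  ultimately show ?thesis by blast
qed (auto intro: exI[of _ 1])

context small_noise_gaussian begin

lemma eventually_mult_exp_le:
  assumes "a < b"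
  shows "\<forall>\<^sub>F i in F. K * exp (a * g i) \<le> exp (b * g i)"
proof -
  have "\<forall>\<^sub>F i in F. ln (max 1 K) / (b - a) \<le> g i" using g by (simp add: filterlim_at_top)
  then show ?thesis
  proof eventually_elim
    case (elim i)
    then have "ln (max 1 K) \<le> (b - a) * g i" using assms by (simp add: pos_divide_le_eq mult.commute)
    then have "exp (ln (max 1 K)) \<le> exp ((b - a) * g i)" by (rule exp_le_cancel_iff[THEN iffD2])
    also have "exp (ln (max 1 K)) = max 1 K" by (rule exp_ln) simp
    finally have "max 1 K \<le> exp ((b - a) * g i)" .
    then have "K * exp (a * g i) \<le> exp ((b - a) * g i) * exp (a * g i)" by (intro mult_right_mono) auto
    then show ?case by (simp add: exp_add[symmetric] left_diff_distrib)
  qed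
qed

text \<open>The closed set has positive distance d from the compact level set. A path in
  \<open>A\<close> with small oscillation therefore cannot have grid values close to those of any f
  of rate at most l, since it would then be uniformly close to f. So either the oscillation is large
  or one of finitely many half-space events occurs.\<close>

lemma upper_bound:
  assumes A: "closed A" and l: "0 \<le> l" "l' < l"
    and rate: "\<And>f. f \<in> A \<Longrightarrow> \<not> rate f \<le> ennreal l"
  shows "\<forall>\<^sub>F i in F. prob {x\<in>space M. W i x \<in> A} \<le> exp (- l' * g i)"
proof -
  define L where "L = {f. rate f \<le> ennreal l}"
  have "L \<inter> A = {}" using rate by (auto simp: L_def)
  then obtain d where d: "0 < d" "\<And>f h. f \<in> L \<Longrightarrow> h \<in> A \<Longrightarrow> d \<le> dist f h"
    using compact_closed_dist_pos[of L A] compact_level[OF l(1)] A unfolding L_def by metis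
  \<comment> \<open>Grid values within e / 2 and two oscillations of at most e give a distance of at
    most 5 / 2 * e, which is below d.\<close>
  define e where "e = d / 4"
  have e: "0 < e" using d by (simp add: e_def)
  obtain r1 where r1: "0 < r1" "\<forall>\<^sub>F i in F. prob {x\<in>space M. osc r1 (W i x) > e} \<le> exp (- (l * g i))"
    using exponential_equicontinuity[OF e l(1)] .
  obtain r2 where r2: "0 < r2" "\<And>h. h \<in> L \<Longrightarrow> osc r2 h \<le> e"
    using level_oscillation[OF l(1) e] unfolding L_def by blast
  define r where "r = min r1 r2"
  have r: "0 < r" using r1 r2 by (simp add: r_def)
  obtain T :: "'a set" where T: "finite T" "\<forall>s. \<exists>t\<in>T. dist s t < r" using finite_net[OF r] .
  obtain C where C: "finite C"
    "\<forall>v. (\<forall>f. rate f \<le> ennreal l \<longrightarrow> (\<exists>t\<in>T. e / 2 \<le> \<bar>v t - val f t\<bar>))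
      \<longrightarrow> (\<exists>c\<in>C. l + var T c / 2 < (\<Sum>t\<in>T. c t * v t))"
    using finite_halfspace_cover[OF T(1) l(1), of "e / 2"] e by auto
  \<comment> \<open>An intermediate rate: the gap below l absorbs the error of the variances, and
    the gap above l' absorbs the number of half-spaces.\<close>
  define l'' where "l'' = (l + l') / 2"
  have l'': "l' < l''" "l'' < l" using l by (auto simp: l''_def)
  have half: "\<forall>\<^sub>F i in F. prob {x\<in>space M. l + var T c / 2 < eval_sum T c (W i x)} \<le> exp (- l'' * g i)" for c
  proof -
    have "\<forall>\<^sub>F i in F. scaled_var i T c < var T c + 2 * (l - l'')"
      using l'' by (intro order_tendstoD(2)[OF scaled_var_tendsto[OF T(1)]]) simp
    then show ?thesis using eventually_pos
    proof eventually_elim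
      case (elim i)
      have "prob {x\<in>space M. l + var T c / 2 < eval_sum T c (W i x)} \<le> exp (g i * (scaled_var i T c / 2 - (l + var T c / 2)))"
        using elim T(1) by (intro halfspace_prob_le) auto
      also have "\<dots> \<le> exp (g i * (- l''))"
        using elim by (intro exp_le_cancel_iff[THEN iffD2] mult_left_mono) (auto simp: field_simps)
      finally show ?case by (simp add: mult.commute)
    qed
  qed
  have "\<forall>\<^sub>F i in F. \<forall>c\<in>C. prob {x\<in>space M. l + var T c / 2 < eval_sum T c (W i x)} \<le> exp (- l'' * g i)"
    using C(1) half by (simp add: eventually_ball_finite)
  then show ?thesis
    using eventually_pos r1(2) eventually_mult_exp_le[of "- l''" "- l'" "1 + real (card C)", simplified, OF l''(1)]
  proof eventually_elim
    case (elim i)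
    have [measurable]: "W i \<in> borel_measurable M" using elim by (simp add: gaussian_path_def)
    note [measurable] = osc_measurable[OF r1(1)]
    define B where "B c = {x\<in>space M. l + var T c / 2 < eval_sum T c (W i x)}" for c
    define O1 where "O1 = {x\<in>space M. osc r1 (W i x) > e}"
    have [measurable]: "B c \<in> events" "O1 \<in> events" for c unfolding B_def O1_def by measurable
    have "{x\<in>space M. W i x \<in> A} \<subseteq> O1 \<union> (\<Union>c\<in>C. B c)"
    proof
      fix x assume "x \<in> {x\<in>space M. W i x \<in> A}"
      then have x: "x \<in> space M" "W i x \<in> A" by auto
      show "x \<in> O1 \<union> (\<Union>c\<in>C. B c)"
      proof (cases "osc r1 (W i x) \<le> e")
        case False
        then show ?thesis using x by (simp add: O1_def)
      next
        case True
        have "\<exists>t\<in>T. e / 2 \<le> \<bar>val (W i x) t - val f t\<bar>" if "rate f \<le> ennreal l" for f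
        proof (rule ccontr)
          assume no: "\<not> ?thesis"
          have f: "f \<in> L" using that by (simp add: L_def)
          have "dist f (W i x) \<le> 5 / 2 * e"
          proof (rule dist_bound)
            fix s
            obtain t where t: "t \<in> T" "dist s t < r" using T(2) by blast
            have "\<bar>val (W i x) t - val f t\<bar> < e / 2" using no t(1) by force
            moreover have "\<bar>val (W i x) s - val (W i x) t\<bar> \<le> e"
              using osc_upper[of s t r1 "W i x"] t(2) True by (simp add: r_def)
            moreover have "\<bar>val f s - val f t\<bar> \<le> e"
              using osc_upper[of s t r2 f] t(2) r2(2)[OF f] by (simp add: r_def)
            ultimately show "dist (val f s) (val (W i x) s) \<le> 5 / 2 * e"
              unfolding dist_real_def by linarith
          qed
          then show False using d(2)[OF f x(2)] e by (simp add: e_def)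
        qed
        then obtain c where "c \<in> C" "l + var T c / 2 < (\<Sum>t\<in>T. c t * val (W i x) t)"
          using C(2) by blast
        then show ?thesis using x by (auto simp: B_def eval_sum_def)
      qed
    qed
    then have "prob {x\<in>space M. W i x \<in> A} \<le> prob (O1 \<union> (\<Union>c\<in>C. B c))"
      using C(1) by (intro finite_measure_mono) (auto intro!: sets.Un sets.finite_UN)
    also have "\<dots> \<le> prob O1 + prob (\<Union>c\<in>C. B c)"
      using C(1) by (intro measure_Un_le sets.finite_UN) auto
    also have "prob (\<Union>c\<in>C. B c) \<le> (\<Sum>c\<in>C. prob (B c))"
      using C(1) by (intro measure_UNION_le) auto
    also have "prob O1 \<le> exp (- l'' * g i)"
    proof -
      have "prob O1 \<le> exp (- (l * g i))" using elim by (simp add: O1_def)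
      also have "\<dots> \<le> exp (- l'' * g i)" using l''(2) elim by (simp add: mult_right_mono)
      finally show ?thesis .
    qed
    also have "(\<Sum>c\<in>C. prob (B c)) \<le> (\<Sum>c\<in>C. exp (- l'' * g i))"
      using elim by (intro sum_mono) (simp add: B_def)
    finally have "prob {x\<in>space M. W i x \<in> A} \<le> (1 + real (card C)) * exp (- l'' * g i)"
      by (simp add: distrib_right)
    also have "\<dots> \<le> exp (- l' * g i)" using elim by simp
    finally show ?case .
  qed
qed

text \<open>Under the tilted law the value at t is Gaussian with a mean close to the covariance of
  the functional with \<open>Z\<close> at t, which is the value of h there. Adding a multiple of the
  evaluation at t to the tilt is the exponential Markov inequality for this law; \<sigma> selects
  the side of the deviation.\<close>

lemma tilted_halfspace:
  assumes T: "finite T" "t \<in> T" and b: "0 < b"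
    and h: "h = paired (\<lambda>x. eval_sum T c (Z x))" and \<sigma>: "\<sigma>\<^sup>2 = 1"
  shows "\<exists>\<kappa>>0. \<forall>\<^sub>F i in F. tilted i T c {x\<in>space M. b < \<sigma> * (val (W i x) t - val h t)} \<le> exp (- \<kappa> * g i) * mass i T c"
proof -
  define e where "e = (\<lambda>u. if u = t then 1 else 0 :: real)"
  have e: "eval_sum T e f = val f t" for f using eval_sum_single[OF T, of 1 f] by (simp add: e_def)
  define v where "v = var T e"
  have v: "0 \<le> v" by (simp add: v_def var_def)
  \<comment> \<open>The limiting exponent is k^2 * v / 2 - k * b. Since k * v \<le> b, it is at most
    - k * b / 2, strictly below - \<kappa> = - k * b / 4.\<close>
  define k where "k = b / (v + 1)"
  have k: "0 < k" using b v by (simp add: k_def)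
  define \<kappa> where "\<kappa> = k * b / 4"
  have \<kappa>: "0 < \<kappa>" using k b by (simp add: \<kappa>_def)
  define c' where "c' = (\<lambda>s. c s + (k * \<sigma>) * e s)"
  have c': "eval_sum T c' f = eval_sum T c f + (k * \<sigma>) * val f t" for f
    unfolding c'_def eval_sum_add[symmetric] eval_sum_scale e ..
  have ht: "val h t = (LINT x|N. eval_sum T c (Z x) * val (Z x) t)"
    unfolding h by (rule blinfun_integral_path[OF square_integrable_eval_sum bounded_linear_eval])
  have var': "var T c' = var T c + 2 * (k * \<sigma>) * val h t + k^2 * v"
    unfolding var_def c' N.square_integrable_lincomb(2)[OF square_integrable_eval_sum square_integrable_eval] ht v_def e
    by (simp add: power_mult_distrib \<sigma>)
  have "((\<lambda>i. scaled_var i T c' / 2 - scaled_var i T c / 2 - k * (\<sigma> * val h t + b)) \<longlongrightarrow>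
     var T c' / 2 - var T c / 2 - k * (\<sigma> * val h t + b)) F"
    by (intro tendsto_intros scaled_var_tendsto T) auto
  moreover have "var T c' / 2 - var T c / 2 - k * (\<sigma> * val h t + b) < - \<kappa>"
  proof -
    have "k * v \<le> b" using v b by (simp add: k_def divide_le_eq field_simps)
    then have "k * (k * v) \<le> k * b" using k by (intro mult_left_mono) auto
    moreover have "0 < k * b" using k b by simp
    ultimately show ?thesis unfolding var' \<kappa>_def by (simp add: power2_eq_square algebra_simps)
  qed
  ultimately have "\<forall>\<^sub>F i in F. scaled_var i T c' / 2 - scaled_var i T c / 2 - k * (\<sigma> * val h t + b) < - \<kappa>"
    by (rule order_tendstoD(2))
  then have "\<forall>\<^sub>F i in F. tilted i T c {x\<in>space M. b < \<sigma> * (val (W i x) t - val h t)} \<le> exp (- \<kappa> * g i) * mass i T c"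
    using eventually_pos
  proof eventually_elim
    case (elim i)
    have [measurable]: "W i \<in> borel_measurable M" using elim by (simp add: gaussian_path_def)
    have gi: "gaussian_path M (W i)" "0 < g i" using elim by auto
    note E = exp_moment[OF gi T(1)]
    let ?D = "exp (- (g i * k * (\<sigma> * val h t + b)))"
    have "tilted i T c {x\<in>space M. b < \<sigma> * (val (W i x) t - val h t)} \<le> (LINT x|M. ?D * exp (g i * eval_sum T c' (W i x)))"
    proof (rule integral_mono)
      show "integrable M (\<lambda>x. indicator {x\<in>space M. b < \<sigma> * (val (W i x) t - val h t)} x
          * exp (g i * eval_sum T c (W i x)))"
        by (rule Bochner_Integration.integrable_bound[OF E(1)[of c]]) (auto simp: indicator_def)
      show "integrable M (\<lambda>x. ?D * exp (g i * eval_sum T c' (W i x)))" using E(1)[of c'] by simp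
      fix x
      show "indicator {x\<in>space M. b < \<sigma> * (val (W i x) t - val h t)} x * exp (g i * eval_sum T c (W i x))
        \<le> ?D * exp (g i * eval_sum T c' (W i x))"
      proof (cases "b < \<sigma> * (val (W i x) t - val h t)")
        case True
        have "0 \<le> (g i * k) * (\<sigma> * (val (W i x) t - val h t) - b)"
          using True k gi by (intro mult_nonneg_nonneg) auto
        then have "g i * eval_sum T c (W i x) \<le> - (g i * k * (\<sigma> * val h t + b)) + g i * eval_sum T c' (W i x)"
          unfolding c' by (simp add: algebra_simps)
        then have "exp (g i * eval_sum T c (W i x)) \<le> ?D * exp (g i * eval_sum T c' (W i x))"
          unfolding exp_add[symmetric] by simp
        then show ?thesis by (auto simp: indicator_def)
      qed simp
    qed
    also have "\<dots> = ?D * mass i T c'" using E(2)[of c'] by simp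
    also have "\<dots> = exp (g i * (scaled_var i T c' / 2 - scaled_var i T c / 2 - k * (\<sigma> * val h t + b))) * mass i T c"
      unfolding exp_add[symmetric] by (simp add: algebra_simps)
    also have "\<dots> \<le> exp (- \<kappa> * g i) * mass i T c"
    proof (intro mult_right_mono exp_le_cancel_iff[THEN iffD2])
      show "g i * (scaled_var i T c' / 2 - scaled_var i T c / 2 - k * (\<sigma> * val h t + b)) \<le> - \<kappa> * g i"
        using mult_left_mono[OF less_imp_le[OF elim(1)], of "g i"] gi by (simp add: mult.commute)
    qed simp
    finally show ?case .
  qed
  then show ?thesis using \<kappa> by blast
qed

text \<open>Cauchy-Schwarz separates the event from the tilt: the square is at most its untilted
  probability times the exponential moment at 2 c, which is the fourth power of \<open>mass\<close>.
  Exponential equicontinuity makes the first factor as small as needed; a = \<open>var T c\<close> +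
  2 is enough for rate 1/2.\<close>

lemma tilted_oscillation:
  assumes T: "finite T" and b: "0 < b"
  obtains r where "0 < r" "\<forall>\<^sub>F i in F. tilted i T c {x\<in>space M. b < osc r (W i x)} \<le> exp (- (1/2) * g i) * mass i T c"
proof -
  define a where "a = var T c + 2"
  have a: "0 \<le> a" by (simp add: a_def var_def)
  obtain r where r: "0 < r" "\<forall>\<^sub>F i in F. prob {x\<in>space M. osc r (W i x) > b} \<le> exp (- (a * g i))"
    using exponential_equicontinuity[OF b a] .
  have "\<forall>\<^sub>F i in F. scaled_var i T c < var T c + 1"
    by (rule order_tendstoD(2)[OF scaled_var_tendsto[OF T]]) simp
  then have "\<forall>\<^sub>F i in F. tilted i T c {x\<in>space M. b < osc r (W i x)} \<le> exp (- (1/2) * g i) * mass i T c"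
    using eventually_pos r(2)
  proof eventually_elim
    case (elim i)
    have [measurable]: "W i \<in> borel_measurable M" using elim by (simp add: gaussian_path_def)
    note [measurable] = osc_measurable[OF r(1)]
    have gi: "gaussian_path M (W i)" "0 < g i" using elim by auto
    define u where "u = (indicator {x\<in>space M. b < osc r (W i x)} :: 'w \<Rightarrow> real)"
    define w where "w x = exp (g i * eval_sum T c (W i x))" for x
    have w2: "(w x)^2 = exp (g i * eval_sum T (\<lambda>s. 2 * c s) (W i x))" for x
      by (simp add: w_def eval_sum_scale exp_double[symmetric] mult.left_commute)
    have sv: "scaled_var i T (\<lambda>s. 2 * c s) = 4 * scaled_var i T c"
      by (simp add: scaled_var_def eval_sum_scale power_mult_distrib)
    have u2: "(u x)^2 = u x" for x by (simp add: u_def indicator_def)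
    have um: "integrable M u" unfolding u_def by (rule integrable_indicator_event) simp
    have su: "square_integrable M u" unfolding square_integrable_def u2 using um by auto
    have [measurable]: "w \<in> borel_measurable M" unfolding w_def by measurable
    have sw: "square_integrable M w"
      unfolding square_integrable_def w2 using exp_moment(1)[OF gi T] by simp
    have "(LINT x|M. u x * w x)^2 \<le> (LINT x|M. (u x)^2) * (LINT x|M. (w x)^2)"
      by (rule L2_Cauchy_Schwarz[OF su sw])
    also have "(LINT x|M. (u x)^2) \<le> exp (- (a * g i))"
      using elim unfolding u2 by (simp add: u_def)
    also have "(LINT x|M. (w x)^2) = exp (2 * (g i * scaled_var i T c))"
      unfolding w2 exp_moment(2)[OF gi T] sv by simp
    also have "exp (- (a * g i)) * exp (2 * (g i * scaled_var i T c)) = exp (2 * (g i * scaled_var i T c) - a * g i)"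
      by (simp add: exp_add[symmetric])
    also have "\<dots> \<le> exp (2 * (- (1/2) * g i + g i * scaled_var i T c / 2))"
    proof (rule exp_le_cancel_iff[THEN iffD2])
      have "g i * scaled_var i T c \<le> g i * (var T c + 1)" using elim by (intro mult_left_mono) auto
      then show "2 * (g i * scaled_var i T c) - a * g i \<le> 2 * (- (1/2) * g i + g i * scaled_var i T c / 2)"
        unfolding a_def by (simp add: algebra_simps)
    qed
    also have "\<dots> = (exp (- (1/2) * g i) * mass i T c)^2"
      by (simp only: exp_double exp_add)
    finally have "(LINT x|M. u x * w x)^2 \<le> (exp (- (1/2) * g i) * mass i T c)^2"
      by (simp add: mult_right_mono)
    then have "(LINT x|M. u x * w x) \<le> exp (- (1/2) * g i) * mass i T c"
      by (rule power2_le_imp_le) simp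
    then show ?case by (simp add: u_def w_def)
  qed
  then show ?thesis using that[OF r(1)] by blast
qed

end

context small_noise_gaussian begin

text \<open>At most half of the tilted mass lies outside a small ball around h. On that ball the
  functional is close to its value at h, which is \<open>var T c\<close>, so the density is at most
  about exp (g i * var T c). Dividing the mass, about exp (g i * var T c / 2), by this leaves the
  rate \<open>var T c / 2\<close>.\<close>

lemma lower_bound:
  assumes T: "finite T" and R: "0 < R" and e: "0 < e"
    and h: "h = paired (\<lambda>x. eval_sum T c (Z x))"
  shows "\<forall>\<^sub>F i in F. exp (- (var T c / 2 + e) * g i) \<le> prob {x\<in>space M. W i x \<in> ball h R}"
proof -
  define S where "S = (\<Sum>s\<in>T. \<bar>c s\<bar>)"
  have S: "0 \<le> S" by (simp add: S_def sum_nonneg)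
  \<comment> \<open>On the ball of radius 4 b the functional varies by at most S * (4 * b) \<le> e /
    4, and 4 b \<le> R keeps that ball inside the target.\<close>
  define b where "b = min R (e / (4 * (S + 1))) / 4"
  have b: "0 < b" "4 * b \<le> R" "S * (4 * b) \<le> e / 4"
  proof -
    show "0 < b" "4 * b \<le> R" using R e S by (auto simp: b_def)
    have "S * (4 * b) \<le> S * (e / (4 * (S + 1)))" using S by (intro mult_left_mono) (auto simp: b_def)
    also have "\<dots> = (S / (S + 1)) * (e / 4)" using S by (simp add: field_simps)
    also have "\<dots> \<le> 1 * (e / 4)" using S e by (intro mult_right_mono) auto
    finally show "S * (4 * b) \<le> e / 4" by simp
  qed
  have hval: "eval_sum T c h = var T c"
    unfolding h blinfun_integral_path[OF square_integrable_eval_sum bounded_linear_eval_sum] var_def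
    by (simp add: power2_eq_square)
  obtain r1 where r1: "0 < r1" "\<forall>\<^sub>F i in F. tilted i T c {x\<in>space M. b < osc r1 (W i x)} \<le> exp (- (1/2) * g i) * mass i T c"
    using tilted_oscillation[OF T b(1)] .
  obtain r2 where r2: "0 < r2" "osc r2 h \<le> b"
  proof -
    obtain n where "osc (1 / real (Suc n)) h < b"
      using LIMSEQ_ex_less[OF osc_tendsto_0 b(1)] by blast
    then show ?thesis using that[of "1 / real (Suc n)"] by simp
  qed
  define r where "r = min r1 r2"
  have r: "0 < r" using r1 r2 by (simp add: r_def)
  obtain T0 :: "'a set" where T0: "finite T0" "\<forall>s. \<exists>t\<in>T0. dist s t < r" using finite_net[OF r] .
  \<comment> \<open>The tilted half-space estimate needs the tested point in the grid of the tilt,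
    so the net is added with zero coefficients.\<close>
  define T' where "T' = T \<union> T0"
  define c' where "c' s = (if s \<in> T then c s else 0)" for s
  have T': "finite T'" "T0 \<subseteq> T'" using T T0 by (auto simp: T'_def)
  have cc: "eval_sum T' c' = eval_sum T c"
    unfolding c'_def[abs_def] by (rule ext, rule eval_sum_extend[OF T'(1), symmetric]) (simp add: T'_def)
  have vv: "scaled_var i T' c' = scaled_var i T c" for i by (simp add: scaled_var_def cc)
  define I where "I = T0 \<times> {1, -1 :: real}"
  have I: "finite I" using T0 by (simp add: I_def)
  define X where "X i p = {x\<in>space M. b < snd p * (val (W i x) (fst p) - val h (fst p))}" for i and p :: "'a \<times> real"
  define O1 where "O1 i = {x\<in>space M. b < osc r1 (W i x)}" for i
  let ?E = "\<lambda>i x. exp (g i * eval_sum T c (W i x))"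
  have tilted_X: "\<exists>\<kappa>>0. \<forall>\<^sub>F i in F. tilted i T c (X i p) \<le> exp (- \<kappa> * g i) * mass i T c"
    if "p \<in> I" for p
  proof -
    have "fst p \<in> T'" "(snd p)^2 = 1" using that T'(2) by (auto simp: I_def)
    from tilted_halfspace[OF T'(1) this(1) b(1) h[folded cc] this(2)]
    show ?thesis unfolding cc vv X_def .
  qed
  have "\<exists>\<kappa>. \<forall>p\<in>I. 0 < \<kappa> p \<and> (\<forall>\<^sub>F i in F. tilted i T c (X i p)
      \<le> exp (- \<kappa> p * g i) * mass i T c)"
    by (rule bchoice, rule ballI, rule tilted_X)
  then obtain \<kappa> where \<kappa>: "\<forall>p\<in>I. 0 < \<kappa> p \<and> (\<forall>\<^sub>F i in F. tilted i T c (X i p)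
      \<le> exp (- \<kappa> p * g i) * mass i T c)" ..
  define k where "k = Min (insert (1/2) (\<kappa> ` I))"
  have fin: "finite (insert (1/2) (\<kappa> ` I))" using I by simp
  have k: "0 < k" "k \<le> 1/2" "\<And>p. p \<in> I \<Longrightarrow> k \<le> \<kappa> p"
  proof -
    show "0 < k" unfolding k_def using \<kappa> by (subst Min_gr_iff[OF fin]) auto
    show "k \<le> 1/2" unfolding k_def by (rule Min_le[OF fin]) simp
    show "k \<le> \<kappa> p" if "p \<in> I" for p unfolding k_def using that by (intro Min_le[OF fin]) simp
  qed
  have ev: "\<forall>\<^sub>F i in F. \<forall>p\<in>I. tilted i T c (X i p) \<le> exp (- \<kappa> p * g i) * mass i T c"
    using I \<kappa> by (simp add: eventually_ball_finite)
  have ev2: "\<forall>\<^sub>F i in F. 2 * (1 + real (card I)) * exp (- k * g i) \<le> 1"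
    using eventually_mult_exp_le[of "- k" 0] k(1) by simp
  have ev3: "\<forall>\<^sub>F i in F. 2 * exp (- (e / 4) * g i) \<le> 1"
    using eventually_mult_exp_le[of "- (e / 4)" 0] e by simp
  have ev4: "\<forall>\<^sub>F i in F. var T c - e < scaled_var i T c"
    by (rule order_tendstoD(1)[OF scaled_var_tendsto[OF T]]) (use e in simp)
  show ?thesis
    using ev ev2 ev3 ev4 r1(2) eventually_pos
  proof eventually_elim
    case (elim i)
    have [measurable]: "W i \<in> borel_measurable M" using elim by (simp add: gaussian_path_def)
    note [measurable] = osc_measurable[OF r1(1)]
    have gi: "gaussian_path M (W i)" "0 < g i" using elim by auto
    have Ei: "integrable M (?E i)" "(LINT x|M. ?E i x) = mass i T c"
      using exp_moment[OF gi T, of c] by simp_all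
    define P where "P = mass i T c"
    define B where "B = {x\<in>space M. W i x \<in> ball h (4 * b)}"
    have ball: "{x\<in>space M. W i x \<in> ball h \<eta>} \<in> events" for \<eta>
      using borel_open[OF open_ball, of h \<eta>] by measurable
    have B[measurable]: "B \<in> events" unfolding B_def by (rule ball)
    have Xm[measurable]: "X i p \<in> events" "O1 i \<in> events" for p unfolding X_def O1_def by measurable
    have ind: "integrable M (\<lambda>x. indicator Y x * ?E i x)" if [measurable]: "Y \<in> events" for Y
      by (rule Bochner_Integration.integrable_bound[OF Ei(1)]) (auto simp: indicator_def)
    \<comment> \<open>Outside the exceptional events the net error and the two oscillations sum to
      at most 3 b, hence the path lies in the open ball of radius 4 b.\<close>
    have cover: "1 \<le> indicator B x + indicator (O1 i) x + (\<Sum>p\<in>I. indicator (X i p) x :: real)" if x: "x \<in> space M" for x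
    proof (cases "x \<in> O1 i \<or> (\<exists>p\<in>I. x \<in> X i p)")
      case True
      then show ?thesis
      proof
        assume "x \<in> O1 i"
        then show ?thesis by (simp add: sum_nonneg)
      next
        assume "\<exists>p\<in>I. x \<in> X i p"
        then obtain p where p: "p \<in> I" "x \<in> X i p" by blast
        have "indicator (X i p) x \<le> (\<Sum>p\<in>I. indicator (X i p) x :: real)"
          using I p(1) by (intro member_le_sum) auto
        then have "1 \<le> (\<Sum>p\<in>I. indicator (X i p) x :: real)" using p(2) by simp
        moreover have "0 \<le> (indicator B x :: real)" "0 \<le> (indicator (O1 i) x :: real)" by simp_all
        ultimately show ?thesis by linarith
      qed
    next
      case False
      then have osc: "osc r1 (W i x) \<le> b" using x by (auto simp: O1_def)
      have "dist h (W i x) \<le> 3 * b"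
      proof (rule dist_bound)
        fix s
        obtain t where t: "t \<in> T0" "dist s t < r" using T0(2) by blast
        have "x \<notin> X i (t, 1)" "x \<notin> X i (t, -1)" using False t(1) by (auto simp: I_def)
        then have "\<bar>val (W i x) t - val h t\<bar> \<le> b" using x by (auto simp: X_def abs_le_iff)
        moreover have "\<bar>val (W i x) s - val (W i x) t\<bar> \<le> b"
          using osc_upper[of s t r1 "W i x"] t(2) osc by (simp add: r_def)
        moreover have "\<bar>val h s - val h t\<bar> \<le> b"
          using osc_upper[of s t r2 h] t(2) r2(2) by (simp add: r_def)
        ultimately show "dist (val h s) (val (W i x) s) \<le> 3 * b"
          unfolding dist_real_def by linarith
      qed
      then have "x \<in> B" using x b(1) by (simp add: B_def)
      then show ?thesis by (simp add: sum_nonneg)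
    qed
    have "P \<le> (LINT x|M. (indicator B x + indicator (O1 i) x + (\<Sum>p\<in>I. indicator (X i p) x)) * ?E i x)"
      unfolding P_def Ei(2)[symmetric]
    proof (rule integral_mono[OF Ei(1)])
      show "integrable M (\<lambda>x. (indicator B x + indicator (O1 i) x + (\<Sum>p\<in>I. indicator (X i p) x)) * ?E i x)"
        unfolding distrib_right sum_distrib_right
        by (intro Bochner_Integration.integrable_add Bochner_Integration.integrable_sum ind) auto
      show "?E i x \<le> (indicator B x + indicator (O1 i) x + (\<Sum>p\<in>I. indicator (X i p) x)) * ?E i x" if "x \<in> space M" for x
        using mult_right_mono[OF cover[OF that], of "?E i x"] by simp
    qed
    also have "\<dots> = tilted i T c B + tilted i T c (O1 i)
        + (\<Sum>p\<in>I. tilted i T c (X i p))"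
      unfolding distrib_right sum_distrib_right
      using ind B Xm by simp
    also have "tilted i T c (O1 i) \<le> exp (- k * g i) * P"
    proof -
      have "tilted i T c (O1 i) \<le> exp (- (1/2) * g i) * P"
        using elim by (simp add: O1_def P_def)
      also have "\<dots> \<le> exp (- k * g i) * P"
        using k(2) gi by (intro mult_right_mono) (auto simp: P_def)
      finally show ?thesis .
    qed
    also have "(\<Sum>p\<in>I. tilted i T c (X i p)) \<le> (\<Sum>p\<in>I. exp (- k * g i) * P)"
    proof (rule sum_mono)
      fix p assume p: "p \<in> I"
      have "tilted i T c (X i p) \<le> exp (- \<kappa> p * g i) * P"
        using elim p by (simp add: P_def)
      also have "\<dots> \<le> exp (- k * g i) * P"
        using k(3)[OF p] gi by (intro mult_right_mono) (auto simp: P_def)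
      finally show "tilted i T c (X i p) \<le> exp (- k * g i) * P" .
    qed
    also have "tilted i T c B \<le> exp (g i * (var T c + e / 4)) * prob B"
    proof -
      have "tilted i T c B \<le> (LINT x|M. exp (g i * (var T c + e / 4)) * indicator B x)"
      proof (rule integral_mono[OF ind[OF B]])
        show "integrable M (\<lambda>x. exp (g i * (var T c + e / 4)) * indicator B x)"
          by (intro integrable_mult_right integrable_indicator_event B)
        show "indicator B x * ?E i x \<le> exp (g i * (var T c + e / 4)) * indicator B x" for x
        proof (cases "x \<in> B")
          case True
          have "eval_sum T c (W i x) \<le> eval_sum T c h + S * dist (W i x) h"
            using eval_sum_diff_le[OF T, of c "W i x" h] by (simp add: S_def abs_le_iff)
          also have "\<dots> \<le> var T c + S * (4 * b)"
            using True S unfolding hval B_def by (intro add_left_mono mult_left_mono) (auto simp: dist_commute)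
          also have "\<dots> \<le> var T c + e / 4" using b(3) by simp
          finally show ?thesis using True gi by (simp add: mult_left_mono)
        qed simp
      qed
      also have "\<dots> = exp (g i * (var T c + e / 4)) * prob B" by simp
      finally show ?thesis .
    qed
    finally have "P \<le> exp (g i * (var T c + e / 4)) * prob B + (1 + real (card I)) * exp (- k * g i) * P"
      by (simp add: distrib_right)
    also have "(1 + real (card I)) * exp (- k * g i) * P \<le> 1 / 2 * P"
      using elim(2) by (intro mult_right_mono) (auto simp: P_def algebra_simps)
    finally have 1: "1 / 2 * P \<le> exp (g i * (var T c + e / 4)) * prob B" by simp
    \<comment> \<open>The budget e consists of e / 4 for the factor 1/2, e / 2 for the convergence
      of the variance and e / 4 for the variation of the functional on the ball.\<close>
    have "exp (- (e / 4) * g i) * exp (g i * (var T c - e) / 2) \<le> 1 / 2 * P"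
      unfolding P_def using elim(3,4) gi by (intro mult_mono) (auto intro: mult_left_mono)
    from order_trans[OF this 1]
    have "exp (- (e / 4) * g i + g i * (var T c - e) / 2) \<le> exp (g i * (var T c + e / 4)) * prob B"
      by (simp only: exp_add)
    then have "exp (- (g i * (var T c + e / 4))) * exp (- (e / 4) * g i + g i * (var T c - e) / 2)
        \<le> exp (- (g i * (var T c + e / 4))) * (exp (g i * (var T c + e / 4)) * prob B)"
      by (rule mult_left_mono) simp
    also have "\<dots> = prob B" by (simp add: mult.assoc[symmetric] exp_add[symmetric])
    also have "exp (- (g i * (var T c + e / 4))) * exp (- (e / 4) * g i + g i * (var T c - e) / 2) = exp (- (var T c / 2 + e) * g i)"
      unfolding exp_add[symmetric] by (simp add: field_simps)
    finally have "exp (- (var T c / 2 + e) * g i) \<le> prob B" .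
    also have "prob B \<le> prob {x\<in>space M. W i x \<in> ball h R}"
      using b(2) by (intro finite_measure_mono ball) (auto simp: B_def)
    finally show ?case .
  qed
qed

lemma lower_bound_open:
  assumes G: "open G" "h \<in> G" and h: "rate h < ennreal x" and x: "0 \<le> x"
  shows "\<forall>\<^sub>F i in F. exp (- x * g i) \<le> prob {x\<in>space M. W i x \<in> G}"
proof -
  obtain l where l: "0 \<le> l" "rate h = ennreal l" "l < x"
    using h by (cases "rate h") (auto simp: ennreal_less_iff)
  obtain R where R: "0 < R" "ball h R \<subseteq> G" using G openE by blast
  \<comment> \<open>Half the radius leaves room for a ball around the approximant; half the slack x
    - l pays once for the approximation and once for the lower bound.\<close>
  define e where "e = min (R / 2) ((x - l) / 2)"
  have e: "0 < e" "e \<le> R / 2" "l + e + e \<le> x" using R l by (auto simp: e_def min_def field_simps)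
  obtain T c where T: "finite T" "dist h (paired (\<lambda>x. eval_sum T c (Z x))) < e" "var T c / 2 < l + e"
    using rkhs_rate_approximation[OF l(2,1) e(1)] .
  define h' where "h' = paired (\<lambda>x. eval_sum T c (Z x))"
  have sub: "ball h' (R / 2) \<subseteq> G"
  proof
    fix f assume "f \<in> ball h' (R / 2)"
    then have "dist h f < R" using T(2) e(2) dist_triangle[of h f h'] by (simp add: h'_def)
    then show "f \<in> G" using R(2) by auto
  qed
  show ?thesis
    using lower_bound[OF T(1) _ e(1) h'_def, of "R / 2", simplified, OF R(1)] eventually_pos
  proof eventually_elim
    case (elim i)
    have [measurable]: "W i \<in> borel_measurable M" using elim by (simp add: gaussian_path_def)
    have "exp (- x * g i) \<le> exp (- (var T c / 2 + e) * g i)"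
      using T(3) e(3) elim by (intro exp_le_cancel_iff[THEN iffD2] mult_right_mono) auto
    also have "\<dots> \<le> prob {x\<in>space M. W i x \<in> ball h' (R / 2)}" using elim by simp
    also have "\<dots> \<le> prob {x\<in>space M. W i x \<in> G}"
    proof (rule finite_measure_mono)
      show "{x\<in>space M. W i x \<in> G} \<in> events" using borel_open[OF G(1)] by measurable
    qed (use sub in auto)
    finally show ?case .
  qed
qed

end

text \<open>Translates the eventual exponential bounds into limits of extended reals. Arguing by
  contradiction with a real number strictly in between treats finite and infinite infima
  alike.\<close>

theorem small_noise_gaussian_LDP:
  assumes "small_noise_gaussian M N (at_right 0) g W Z"
  shows "satisfies_LDP (\<lambda>\<epsilon>. distr M borel (W \<epsilon>)) g (rkhs_rate N Z)"
proof -
  interpret small_noise_gaussian M N "at_right 0" g W Z by fact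
  let ?\<mu> = "\<lambda>\<epsilon>. distr M borel (W \<epsilon>)"
  have meas: "measure (?\<mu> \<epsilon>) A = prob {x\<in>space M. W \<epsilon> x \<in> A}"
    if "gaussian_path M (W \<epsilon>)" "A \<in> sets borel" for \<epsilon> A
  proof -
    have "W \<epsilon> \<in> borel_measurable M" using that by (simp add: gaussian_path_def)
    then show ?thesis using that(2) by (simp add: measure_distr vimage_def Int_def conj_commute)
  qed
  show ?thesis
    unfolding satisfies_LDP_def
  proof (intro conjI allI impI rate_function_rkhs_rate)
    fix A :: "('c \<Rightarrow>\<^sub>C real) set" assume A: "closed A"
    define S where "S = Limsup (at_right 0) (\<lambda>\<epsilon>. ereal (1 / g \<epsilon>) * log_prob (?\<mu> \<epsilon>) A)"
    define m where "m = (INF f\<in>A. rkhs_rate N Z f)"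
    have bound: "S \<le> ereal (- x)" if "\<forall>\<^sub>F \<epsilon> in at_right 0. prob {x\<in>space M. W \<epsilon> x \<in> A} \<le> exp (- x * g \<epsilon>)" for x
      unfolding S_def
    proof (rule Limsup_bounded)
      show "\<forall>\<^sub>F \<epsilon> in at_right 0. ereal (1 / g \<epsilon>) * log_prob (?\<mu> \<epsilon>) A \<le> ereal (- x)"
        using that eventually_pos
      proof eventually_elim
        case (elim \<epsilon>)
        have p: "measure (?\<mu> \<epsilon>) A \<le> exp (- x * g \<epsilon>)" using elim A by (simp add: meas)
        show ?case
        proof (cases "measure (?\<mu> \<epsilon>) A = 0")
          case True
          then show ?thesis using elim by (simp add: log_prob_def)
        next
          case False
          then have "0 < measure (?\<mu> \<epsilon>) A" by (simp add: less_le)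
          then have "ln (measure (?\<mu> \<epsilon>) A) \<le> - x * g \<epsilon>" using p by (metis exp_gt_zero ln_exp ln_le_cancel_iff)
          then have "1 / g \<epsilon> * ln (measure (?\<mu> \<epsilon>) A) \<le> - x" using elim by (simp add: divide_le_eq)
          then show ?thesis using False by (simp add: log_prob_def)
        qed
      qed
    qed
    have S0: "S \<le> 0" using bound[of 0] by (simp add: zero_ereal_def)
    have "S \<le> - enn2ereal m"
    proof (rule ccontr)
      assume "\<not> ?thesis"
      then have "- enn2ereal m < S" by simp
      then obtain y where y: "- enn2ereal m < ereal y" "ereal y < S" using ereal_dense2 by blast
      have y0: "y < 0" using y(2) S0 by (metis ereal_less_eq(3) less_le_trans not_less zero_ereal_def ereal_less(2) order.strict_trans2)
      have "ereal (- y) < enn2ereal m" using y(1) by (metis ereal_uminus_less_reorder uminus_ereal.simps(1))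
      \<comment> \<open>\<open>upper_bound\<close> loses an arbitrarily small part of the rate,
        hence a second real below m. The trivial bound S \<le> 0 made y negative, so z is an
        admissible level.\<close>
      then obtain z where z: "ereal (- y) < ereal z" "ereal z < enn2ereal m" using ereal_dense2 by blast
      have zm: "ennreal z < m"
        using z y0 by (simp add: less_ennreal.rep_eq enn2ereal_ennreal)
      have "\<forall>\<^sub>F \<epsilon> in at_right 0. prob {x\<in>space M. W \<epsilon> x \<in> A} \<le> exp (- (- y) * g \<epsilon>)"
      proof (rule upper_bound[OF A, of z])
        fix f assume "f \<in> A"
        then have "m \<le> rkhs_rate N Z f" unfolding m_def by (rule INF_lower)
        then show "\<not> rkhs_rate N Z f \<le> ennreal z" using zm by (meson not_le order.strict_trans2)
      qed (use z y0 in auto)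
      from bound[OF this] show False using y(2) by simp
    qed
    then show "Limsup (at_right 0) (\<lambda>\<epsilon>. ereal (1 / g \<epsilon>) * log_prob (?\<mu> \<epsilon>) A) \<le> - enn2ereal (INF f\<in>A. rkhs_rate N Z f)"
      by (simp add: S_def m_def)
  next
    fix G :: "('c \<Rightarrow>\<^sub>C real) set" assume G: "open G"
    define S where "S = Liminf (at_right 0) (\<lambda>\<epsilon>. ereal (1 / g \<epsilon>) * log_prob (?\<mu> \<epsilon>) G)"
    define m where "m = (INF f\<in>G. rkhs_rate N Z f)"
    have "- enn2ereal m \<le> S"
    proof (rule ccontr)
      assume "\<not> ?thesis"
      then have "S < - enn2ereal m" by simp
      then obtain y where y: "S < ereal y" "ereal y < - enn2ereal m" using ereal_dense2 by blast
      have my: "enn2ereal m < ereal (- y)" using y(2) by (metis ereal_less_uminus_reorder uminus_ereal.simps(1))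
      have y0: "0 \<le> - y"
        using my enn2ereal_nonneg[of m] by (metis ereal_less_eq(3) le_less_trans less_imp_le zero_ereal_def)
      have "m < ennreal (- y)"
        using my y0 by (simp add: less_ennreal.rep_eq enn2ereal_ennreal)
      then obtain h where h: "h \<in> G" "rkhs_rate N Z h < ennreal (- y)" unfolding m_def INF_less_iff by blast
      have "ereal y \<le> S"
        unfolding S_def
      proof (rule Liminf_bounded)
        show "\<forall>\<^sub>F \<epsilon> in at_right 0. ereal y \<le> ereal (1 / g \<epsilon>) * log_prob (?\<mu> \<epsilon>) G"
          using lower_bound_open[OF G h y0] eventually_pos
        proof eventually_elim
          case (elim \<epsilon>)
          have p: "exp (y * g \<epsilon>) \<le> measure (?\<mu> \<epsilon>) G" using elim G by (simp add: meas)
          then have pos: "0 < measure (?\<mu> \<epsilon>) G" by (rule less_le_trans[OF exp_gt_zero])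
          then have "y * g \<epsilon> \<le> ln (measure (?\<mu> \<epsilon>) G)" using p by (simp add: ln_ge_iff)
          then have "y \<le> 1 / g \<epsilon> * ln (measure (?\<mu> \<epsilon>) G)" using elim by (simp add: le_divide_eq)
          then show ?case using pos by (simp add: log_prob_def)
        qed
      qed
      then show False using y(1) by simp
    qed
    then show "- enn2ereal (INF f\<in>G. rkhs_rate N Z f) \<le> Liminf (at_right 0) (\<lambda>\<epsilon>. ereal (1 / g \<epsilon>) * log_prob (?\<mu> \<epsilon>) G)"
      by (simp add: S_def m_def)
  qed
qed

section \<open>Small time processes\<close>

lemma path_measurable:
  assumes "continuous_process M X"
  shows "(\<lambda>x. path_of (\<lambda>t. X t x)) \<in> borel_measurable M"
proof (rule borel_measurable_bcontfunI)
  fix s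
  have "(\<lambda>x. apply_bcontfun (path_of (\<lambda>t. X t x)) s) \<in> borel_measurable M \<longleftrightarrow> X (time_of s) \<in> borel_measurable M"
    using assms by (intro measurable_cong) (simp add: continuous_process_def apply_path_of)
  then show "(\<lambda>x. apply_bcontfun (path_of (\<lambda>t. X t x)) s) \<in> borel_measurable M"
    using assms time_of[of s] by (simp add: continuous_process_def)
qed

lemma gaussian_path_of:
  assumes X: "continuous_process M X" and G: "centered_gaussian_process M X"
  shows "gaussian_path M (\<lambda>x. path_of (\<lambda>t. X t x))"
  unfolding gaussian_path_def
proof (intro conjI allI impI path_measurable[OF X])
  fix T :: "unit_interval set" and c assume T: "finite T"
  have inj: "inj_on time_of T" by (auto simp: inj_on_def time_of_inject)
  define f where "f x = (\<Sum>t\<in>time_of ` T. c (Unit_Interval t) * X t x)" for x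
  have f: "centered_gaussian M f"
    unfolding f_def
  proof (rule G[unfolded centered_gaussian_process_def, rule_format])
    show "finite (time_of ` T) \<and> time_of ` T \<subseteq> {0..1}" using T time_of by blast
  qed
  \<comment> \<open>Continuity of trajectories is known only on \<open>space M\<close>, so
    Gaussianity is transferred through equality there rather than equality of functions.\<close>
  have eq: "eval_sum T c (path_of (\<lambda>t. X t x)) = f x" if "x \<in> space M" for x
    using X that by (simp add: eval_sum_def f_def sum.reindex[OF inj] apply_path_of continuous_process_def time_of_inverse)
  have m: "(\<lambda>x. eval_sum T c (path_of (\<lambda>t. X t x))) \<in> borel_measurable M"
    using measurable_compose[OF path_measurable[OF X] eval_sum_measurable] .
  have d: "distr M lborel (\<lambda>x. eval_sum T c (path_of (\<lambda>t. X t x))) = distr M lborel f"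
    using eq by (intro distr_cong) auto
  have "(AE x in M. eval_sum T c (path_of (\<lambda>t. X t x)) = 0) \<longleftrightarrow> (AE x in M. f x = 0)"
    using eq by (intro AE_cong) auto
  then show "centered_gaussian M (\<lambda>x. eval_sum T c (path_of (\<lambda>t. X t x)))"
    using f m d unfolding centered_gaussian_def distributed_def by auto
qed

lemma continuous_process_time_scale:
  assumes "continuous_process M X" "0 < \<epsilon>" "\<epsilon> \<le> 1"
  shows "continuous_process M (\<lambda>t. X (\<epsilon> * t))"
  unfolding continuous_process_def
proof (intro conjI ballI)
  have sub: "\<epsilon> * t \<in> {0..1}" if "t \<in> {0..1}" for t
    using assms(2,3) that by (auto intro: mult_le_one)
  show "X (\<epsilon> * t) \<in> borel_measurable M" if "t \<in> {0..1}" for t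
    using assms(1) sub[OF that] by (simp add: continuous_process_def)
  show "continuous_on {0..1} (\<lambda>t. X (\<epsilon> * t) x)" if "x \<in> space M" for x
    using assms(1) that sub unfolding continuous_process_def
    by (intro continuous_on_compose2[of "{0..1}" "\<lambda>t. X t x" _ "\<lambda>t. \<epsilon> * t"] continuous_intros) auto
qed

lemma centered_gaussian_process_time_scale:
  assumes "centered_gaussian_process M X" "0 < \<epsilon>" "\<epsilon> \<le> 1"
  shows "centered_gaussian_process M (\<lambda>t. X (\<epsilon> * t))"
  unfolding centered_gaussian_process_def
proof (intro allI impI)
  fix T c assume T: "finite T \<and> T \<subseteq> {0..1::real}"
  have inj: "inj_on ((*) \<epsilon>) T" using assms(2) by (auto simp: inj_on_def)
  have "\<epsilon> * t \<in> {0..1}" if "t \<in> {0..1}" for t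
    using assms(2,3) that by (auto intro: mult_le_one)
  then have "finite ((*) \<epsilon> ` T) \<and> (*) \<epsilon> ` T \<subseteq> {0..1}" using T by blast
  then have "centered_gaussian M (\<lambda>x. \<Sum>t\<in>(*) \<epsilon> ` T. c (t / \<epsilon>) * X t x)"
    by (rule assms(1)[unfolded centered_gaussian_process_def, rule_format])
  then show "centered_gaussian M (\<lambda>x. \<Sum>t\<in>T. c t * X (\<epsilon> * t) x)"
    using assms(2) by (simp add: sum.reindex[OF inj])
qed

lemma path_of_scale:
  assumes "continuous_on {0..1} f"
  shows "path_of (\<lambda>t. k * f t) = k *\<^sub>R path_of f"
  using assms by (intro bcontfun_eqI) (simp add: apply_path_of continuous_intros)

theorem corollary3p4:
  fixes M :: "'w measure" and X :: "real \<Rightarrow> 'w \<Rightarrow> real"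
    and N :: "'v measure" and Y0 :: "real \<Rightarrow> 'v \<Rightarrow> real"
    and g :: "real \<Rightarrow> real"
  assumes "prob_space M"
    and "continuous_process M X"
    and "centered_gaussian_process M X"
    and "speed_function g"
    and "prob_space N"
    and "continuous_process N Y0"
    and "converges_weakly (\<lambda>\<epsilon>. path_law M (\<lambda>t \<omega>. sqrt (g \<epsilon>) * X (\<epsilon> * t) \<omega>))
           (path_law N Y0) (at_right 0)"
  shows "satisfies_LDP (\<lambda>\<epsilon>. path_law M (\<lambda>t. X (\<epsilon> * t))) g
           (\<lambda>h. if h \<in> rkhs N (\<lambda>\<omega>. path_of (\<lambda>t. Y0 t \<omega>))
                then ennreal (1 / 2 * (rkhs_norm N (\<lambda>\<omega>. path_of (\<lambda>t. Y0 t \<omega>)) h)\<^sup>2)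
                else \<infinity>)"
proof -
  interpret M: prob_space M by fact
  interpret N: prob_space N by fact
  define W where "W \<epsilon> \<omega> = path_of (\<lambda>t. X (\<epsilon> * t) \<omega>)" for \<epsilon> \<omega>
  define Z where "Z \<omega> = path_of (\<lambda>t. Y0 t \<omega>)" for \<omega>
  \<comment> \<open>For \<epsilon> \<le> 1 the scaled time stays in the unit interval, where
    continuity and Gaussianity of X are known.\<close>
  have small: "\<forall>\<^sub>F \<epsilon> in at_right 0. 0 < \<epsilon> \<and> \<epsilon> \<le> (1::real)"
    unfolding eventually_at_right_field by (intro exI[of _ 1]) auto
  have Zm[measurable]: "Z \<in> borel_measurable N"
    unfolding Z_def by (rule path_measurable) fact
  have "small_noise_gaussian M N (at_right 0) g W Z"
  proof (unfold_locales)
    show "at_right (0::real) \<noteq> bot" by simp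
    show "filterlim g at_top (at_right 0)" using assms(4) by (simp add: speed_function_def)
    show "\<forall>\<^sub>F \<epsilon> in at_right 0. gaussian_path M (W \<epsilon>)"
      using small
    proof eventually_elim
      case (elim \<epsilon>)
      then show ?case unfolding W_def
        using assms(2,3) by (intro gaussian_path_of continuous_process_time_scale centered_gaussian_process_time_scale) auto
    qed
    show "Z \<in> borel_measurable N" by fact
    fix \<phi> :: "(unit_interval \<Rightarrow>\<^sub>C real) \<Rightarrow>\<^sub>C real"
    let ?Y = "\<lambda>\<epsilon> t \<omega>. sqrt (g \<epsilon>) * X (\<epsilon> * t) \<omega>"
    have \<phi>[measurable]: "apply_bcontfun \<phi> \<in> borel_measurable borel"
      by (intro borel_measurable_continuous_onI continuous_on_apply_bcontfun)
    have "((\<lambda>\<epsilon>. \<integral>x. apply_bcontfun \<phi> x \<partial>path_law M (?Y \<epsilon>)) \<longlongrightarrow> (\<integral>x. apply_bcontfun \<phi> x \<partial>path_law N Y0)) (at_right 0)"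
      using assms(7) by (simp add: converges_weakly_def)
    also have "(\<integral>x. apply_bcontfun \<phi> x \<partial>path_law N Y0) = (LINT \<omega>|N. apply_bcontfun \<phi> (Z \<omega>))"
      unfolding path_law_def Z_def[symmetric] by (rule integral_distr) auto
    finally show "((\<lambda>\<epsilon>. LINT \<omega>|M. apply_bcontfun \<phi> (sqrt (g \<epsilon>) *\<^sub>R W \<epsilon> \<omega>)) \<longlongrightarrow> (LINT \<omega>|N. apply_bcontfun \<phi> (Z \<omega>))) (at_right 0)"
    proof (rule tendsto_cong[THEN iffD1, rotated])
      show "\<forall>\<^sub>F \<epsilon> in at_right 0. (\<integral>x. apply_bcontfun \<phi> x \<partial>path_law M (?Y \<epsilon>)) = (LINT \<omega>|M. apply_bcontfun \<phi> (sqrt (g \<epsilon>) *\<^sub>R W \<epsilon> \<omega>))"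
        using small
      proof eventually_elim
        case (elim \<epsilon>)
        then have cp: "continuous_process M (\<lambda>t. X (\<epsilon> * t))" using assms(2) continuous_process_time_scale by blast
        have c: "path_of (\<lambda>t. ?Y \<epsilon> t \<omega>) = sqrt (g \<epsilon>) *\<^sub>R W \<epsilon> \<omega>" if "\<omega> \<in> space M" for \<omega>
          using cp that unfolding W_def by (intro path_of_scale) (simp add: continuous_process_def)
        have [measurable]: "W \<epsilon> \<in> borel_measurable M"
          unfolding W_def using path_measurable[OF cp] .
        have "path_law M (?Y \<epsilon>) = distr M borel (\<lambda>\<omega>. sqrt (g \<epsilon>) *\<^sub>R W \<epsilon> \<omega>)"
          unfolding path_law_def using c by (intro distr_cong) auto
        then show ?case by (simp add: integral_distr)
      qed
    qed
  qed
  from small_noise_gaussian_LDP[OF this] show ?thesis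
    unfolding rkhs_rate_def[abs_def] Z_def W_def path_law_def .
qed

end
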